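(* Let $G$ be a reductive group as in the context, let $\mathbf{R}$ be a finite multiset based in $I\dot{\times}\mathbb{Z}$, and let $w_\circ$ be the longest element of the Weyl group $W$. Then $$\operatorname{ch}\mathcal{M}(\mathbf{R})=\pi_{w_\circ}\operatorname{ch}\mathcal{M}(\mathbf{R},J)$$ for any upward-closed set $J\subseteq I\dot{\times}\mathbb{Z}$ containing $\operatorname{Supp}\mathbf{R}$.
   Context: Setting. $G$ is a reductive algebraic group over $\mathbb{C}$ with a fixed maximal torus and Borel subgroup, weight lattice $P$, simple roots $\alpha_i\in P$ and simple coroots $\alpha_i^\vee$ ($i\in I$), pairing $\langle\cdot,\cdot\rangle$, dominant weights $P^+$, finite Weyl group $W$ generated by the simple reflections $s_i$. $G$ is simply-laced (Cartan matrix symmetric with off-diagonal entries $0$ or $-1$), and the Dynkin diagram (vertex set $I$, $i\sim j$ iff $\langle\alpha_i^\vee,\alpha_j\rangle=-1$) is connected. Fix a two-colouring of the Dynkin diagram into even and odd vertices, and let $I\dot{\times}\mathbb{Z}=\{(i,c)\in I\times\mathbb{Z}: i,c\text{ have the same parity}\}$. Fix fundamental weights $\varpi_i\in P\otimes\mathbb{Q}$ with $\langle\alpha_i^\vee,\varpi_j\rangle=\delta_{ij}$. Multisets. A finite multiset based in $I\dot{\times}\mathbb{Z}$ is a finitely supported function $\mathbf{R}:I\dot{\times}\mathbb{Z}\to\mathbb{N}$, with values $\mathbf{R}[i,c]$. It is assumed that $\mathbf{R}[i,c]\varpi_i\in P$ for all $(i,c)$. Put $\operatorname{wt}(\mathbf{R})=\sum\mathbf{R}[i,c]\varpi_i$.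 Monomial crystal. Let $\mathcal{M}$ be the multiplicative abelian group of formal monomials $p=e^{\operatorname{wt}(p)}\prod_{(i,c)}y_{i,c}^{p[i,c]}$, with $\operatorname{wt}(p)\in P$ and $p[i,c]\in\mathbb{Z}$ for $(i,c)\in I\dot{\times}\mathbb{Z}$, finitely many nonzero, such that $\langle\alpha_i^\vee,\operatorname{wt}(p)\rangle=\sum_c p[i,c]$ for all $i$. For $(i,k)\in I\dot{\times}\mathbb{Z}$ let $z_{i,k}=e^{\alpha_i}y_{i,k}y_{i,k+2}\prod_{j\sim i}y_{j,k+1}^{-1}$. Put $\varphi_i^k(p)=\sum_{l\ge k}p[i,l]$, $\varphi_i(p)=\max_k\varphi_i^k(p)$, $\varepsilon_i^k(p)=-\sum_{l\le k}p[i,l]$, $\varepsilon_i(p)=\max_k\varepsilon_i^k(p)$. If $\varphi_i(p)=0$ then $f_i(p)=0$; otherwise $f_i(p)=p\,z_{i,F-2}^{-1}$ with $F$ the largest $k$ such that $\varphi_i^k(p)=\varphi_i(p)$. If $\varepsilon_i(p)=0$ then $e_i(p)=0$; otherwise $e_i(p)=p\,z_{i,E}$ with $E$ the smallest $k$ such that $\varepsilon_i^k(p)=\varepsilon_i(p)$. This makes $\mathcal{M}$ a $G$-crystal, i.e. isomorphic to a disjoint union of crystals $\mathcal{B}(\lambda)$ of irreducible modules $V(\lambda)$, $\lambda\in P^+$ (known). Product monomial crystal. For $n\ge0$ with $n\varpi_i\in P$, $\mathcal{M}(i,c)^n$ is the subcrystal of $\mathcal{M}$ generated by $e^{n\varpi_i}y_{i,c}^n$.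 Set $\mathcal{M}(\mathbf{R})=\prod_{(i,c)}\mathcal{M}(i,c)^{\mathbf{R}[i,c]}$, the set of all products of monomials taken one from each factor; $\mathcal{M}(\varnothing)=\{1\}$. It is known that $\mathcal{M}(\mathbf{R})$ is a subcrystal of $\mathcal{M}$; it is finite. With $y_{\mathbf{R}}=e^{\operatorname{wt}(\mathbf{R})}\prod y_{i,c}^{\mathbf{R}[i,c]}$ and $z_{\mathbf{S}}=\prod z_{i,k}^{\mathbf{S}[i,k]}$, each $p\in\mathcal{M}(\mathbf{R})$ is $p=y_{\mathbf{R}}z_{\mathbf{S}}^{-1}$ for a unique finite multiset $\mathbf{S}$ based in $I\dot{\times}\mathbb{Z}$; put $\operatorname{Supp}_{\mathbf{R}}(p)=\operatorname{Supp}\mathbf{R}\cup\operatorname{Supp}\mathbf{S}$. Truncations. Let $\le$ be the partial order on $I\dot{\times}\mathbb{Z}$ generated by $(i,c)\le(i,c+2)$ and $(i,c)\le(j,c+1)$ for $j\sim i$; upward-closed is with respect to $\le$. For an upward-closed $J\supseteq\operatorname{Supp}\mathbf{R}$, the truncation is $\mathcal{M}(\mathbf{R},J)=\{p\in\mathcal{M}(\mathbf{R}):\operatorname{Supp}_{\mathbf{R}}(p)\subseteq J\}$. Characters. For a finite subset $X$ of a crystal, $\operatorname{ch}X=\sum_{x\in X}e^{\operatorname{wt}(x)}\in\mathbb{Z}[P]$. The Demazure operator $\pi_i:\mathbb{Z}[P]\to\mathbb{Z}[P]$ is the $\mathbb{Z}$-linear map $\pi_i(e^\lambda)=\dfrac{e^\lambda-e^{s_i\lambda-\alpha_i}}{1-e^{-\alpha_i}}$.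 The $\pi_i$ are idempotent and satisfy the braid relations; for $w=s_{i_1}\cdots s_{i_r}$ reduced, $\pi_w=\pi_{i_1}\cdots\pi_{i_r}$. *)

theory Defs
  imports
    "HOL-Analysis.Cartesian_Space"
    "HOL-Library.Multiset"
    "HOL-Library.Poly_Mapping"
begin

section \<open>Based root data\<close>

text \<open>
  A reductive group over the complex numbers with a maximal torus and a Borel subgroup enters
  only through its based root datum.  The weight lattice \<open>P\<close> is \<open>int ^ 'n\<close> (a \<open>\<int>\<close>-basis has been
  chosen), \<open>P \<otimes> \<rat>\<close> is \<open>rat ^ 'n\<close>, and the cocharacter lattice is again \<open>int ^ 'n\<close> in the dual basis,
  so that the perfect pairing between the two lattices is the dot product.  The Dynkin diagram
  has vertex set \<open>'i\<close>.  The record also carries the two auxiliary choices of the setting: the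
  fundamental weights and the two-colouring.
\<close>

record ('i, 'n) root_datum =
  simple_root :: "'i \<Rightarrow> int ^ 'n"
  simple_coroot :: "'i \<Rightarrow> int ^ 'n"
  fund_weight :: "'i \<Rightarrow> rat ^ 'n"
  even_vertex :: "'i \<Rightarrow> bool"

definition pairing :: "int ^ 'n::finite \<Rightarrow> 'a::ring_1 ^ 'n \<Rightarrow> 'a" where
  "pairing a x = (\<Sum>k\<in>UNIV. of_int (a $ k) * x $ k)"

definition of_lattice :: "int ^ 'n::finite \<Rightarrow> rat ^ 'n" where
  "of_lattice \<mu> = (\<chi> k. of_int (\<mu> $ k))"

definition to_lattice :: "rat ^ 'n::finite \<Rightarrow> int ^ 'n" where
  "to_lattice v = (THE \<mu>. of_lattice \<mu> = v)"

definition adjacent :: "('i::finite, 'n::finite) root_datum \<Rightarrow> 'i \<Rightarrow> 'i \<Rightarrow> bool" where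
  "adjacent D i j \<longleftrightarrow> pairing (simple_coroot D i) (simple_root D j) = -1"

definition simple_reflection ::
    "('i::finite, 'n::finite) root_datum \<Rightarrow> 'i \<Rightarrow> int ^ 'n \<Rightarrow> int ^ 'n" where
  "simple_reflection D i \<mu> = \<mu> - pairing (simple_coroot D i) \<mu> *s simple_root D i"

definition word_element ::
    "('i::finite, 'n::finite) root_datum \<Rightarrow> 'i list \<Rightarrow> int ^ 'n \<Rightarrow> int ^ 'n" where
  "word_element D is = foldr (\<lambda>i w. simple_reflection D i \<circ> w) is id"

text \<open>
  The simple reflections are involutions, so the products of words in them already form the
  group that they generate.
\<close>

definition weyl_group ::
    "('i::finite, 'n::finite) root_datum \<Rightarrow> (int ^ 'n \<Rightarrow> int ^ 'n) set" where
  "weyl_group D = range (word_element D)"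

definition weyl_length ::
    "('i::finite, 'n::finite) root_datum \<Rightarrow> (int ^ 'n \<Rightarrow> int ^ 'n) \<Rightarrow> nat" where
  "weyl_length D w = (LEAST r. \<exists>is. length is = r \<and> word_element D is = w)"

definition reduced_word ::
    "('i::finite, 'n::finite) root_datum \<Rightarrow> (int ^ 'n \<Rightarrow> int ^ 'n) \<Rightarrow> 'i list \<Rightarrow> bool" where
  "reduced_word D w is \<longleftrightarrow> word_element D is = w \<and> length is = weyl_length D w"

definition longest_element ::
    "('i::finite, 'n::finite) root_datum \<Rightarrow> (int ^ 'n \<Rightarrow> int ^ 'n) \<Rightarrow> bool" where
  "longest_element D w \<longleftrightarrow>
     w \<in> weyl_group D \<and> (\<forall>v \<in> weyl_group D. weyl_length D v \<le> weyl_length D w)"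

text \<open>
  Finiteness of the Weyl group alone would not force the Cartan matrix to be of finite type:
  without linear independence an affine matrix can also act through a finite group.
\<close>

locale simply_laced_datum =
  fixes D :: "('i::finite, 'n::finite) root_datum"
  assumes cartan_diag: "pairing (simple_coroot D i) (simple_root D i) = 2"
    and cartan_off_diag:
      "i \<noteq> j \<Longrightarrow> pairing (simple_coroot D i) (simple_root D j) \<in> {0, -1}"
    and cartan_sym: "pairing (simple_coroot D i) (simple_root D j) =
      pairing (simple_coroot D j) (simple_root D i)"
    and roots_independent:
      "(\<Sum>i\<in>UNIV. c i *s simple_root D i) = 0 \<Longrightarrow> c j = 0"
    and coroots_independent:
      "(\<Sum>i\<in>UNIV. c i *s simple_coroot D i) = 0 \<Longrightarrow> c j = 0"
    and finite_weyl_group: "finite (weyl_group D)"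
    and connected_diagram: "(adjacent D)\<^sup>*\<^sup>* i j"
    and fund_weight: "pairing (simple_coroot D i) (fund_weight D j) = (if i = j then 1 else 0)"
    and two_colouring: "adjacent D i j \<Longrightarrow> even_vertex D i \<noteq> even_vertex D j"

definition parity_vertices :: "('i::finite, 'n::finite) root_datum \<Rightarrow> ('i \<times> int) set" where
  "parity_vertices D = {(i, c). even c \<longleftrightarrow> even_vertex D i}"

section \<open>The monomial crystal\<close>

text \<open>
  The monomial \<open>e\<^sup>\<mu> \<Prod> y\<^bsub>i,c\<^esub>\<^bsup>p[i,c]\<^esup>\<close> is the pair of \<open>\<mu>\<close> and the finitely supported exponent function
  \<open>p\<close>.  The multiplicative group of monomials is thus written additively: products of monomials
  become sums, and the monomial \<open>1\<close> is \<open>0\<close>.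
\<close>

type_synonym ('i, 'n) monomial = "(int ^ 'n) \<times> ('i \<times> int \<Rightarrow>\<^sub>0 int)"

abbreviation wt :: "('i, 'n) monomial \<Rightarrow> int ^ 'n" where
  "wt \<equiv> fst"

definition expo :: "('i, 'n) monomial \<Rightarrow> 'i \<Rightarrow> int \<Rightarrow> int" where
  "expo p i c = Poly_Mapping.lookup (snd p) (i, c)"

text \<open>Sums over all integers are restricted to the support, where they are finite sums.\<close>

definition monomials :: "('i::finite, 'n::finite) root_datum \<Rightarrow> ('i, 'n) monomial set" where
  "monomials D = {p. Poly_Mapping.keys (snd p) \<subseteq> parity_vertices D \<and>
     (\<forall>i. pairing (simple_coroot D i) (wt p) = (\<Sum>c \<in> {c. expo p i c \<noteq> 0}. expo p i c))}"

definition z_mon :: "('i::finite, 'n::finite) root_datum \<Rightarrow> 'i \<times> int \<Rightarrow> ('i, 'n) monomial" where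
  "z_mon D = (\<lambda>(i, k). (simple_root D i,
     Poly_Mapping.single (i, k) 1 + Poly_Mapping.single (i, k + 2) 1
       - (\<Sum>j \<in> {j. adjacent D i j}. Poly_Mapping.single (j, k + 1) 1)))"

definition phi_at :: "'i \<Rightarrow> int \<Rightarrow> ('i, 'n) monomial \<Rightarrow> int" where
  "phi_at i k p = (\<Sum>l \<in> {l. k \<le> l \<and> expo p i l \<noteq> 0}. expo p i l)"

definition phi :: "'i \<Rightarrow> ('i, 'n) monomial \<Rightarrow> int" where
  "phi i p = Max (range (\<lambda>k. phi_at i k p))"

definition eps_at :: "'i \<Rightarrow> int \<Rightarrow> ('i, 'n) monomial \<Rightarrow> int" where
  "eps_at i k p = - (\<Sum>l \<in> {l. l \<le> k \<and> expo p i l \<noteq> 0}. expo p i l)"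

definition eps :: "'i \<Rightarrow> ('i, 'n) monomial \<Rightarrow> int" where
  "eps i p = Max (range (\<lambda>k. eps_at i k p))"

text \<open>The value \<open>None\<close> is the crystal zero, not to be confused with the monomial \<open>0\<close>.\<close>

definition crystal_f ::
    "('i::finite, 'n::finite) root_datum \<Rightarrow> 'i \<Rightarrow> ('i, 'n) monomial \<Rightarrow> ('i, 'n) monomial option"
  where
  "crystal_f D i p = (if phi i p = 0 then None
     else Some (p - z_mon D (i, (GREATEST k. phi_at i k p = phi i p) - 2)))"

definition crystal_e ::
    "('i::finite, 'n::finite) root_datum \<Rightarrow> 'i \<Rightarrow> ('i, 'n) monomial \<Rightarrow> ('i, 'n) monomial option"
  where
  "crystal_e D i p = (if eps i p = 0 then None
     else Some (p + z_mon D (i, (LEAST k. eps_at i k p = eps i p))))"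

definition subcrystal ::
    "('i::finite, 'n::finite) root_datum \<Rightarrow> ('i, 'n) monomial set \<Rightarrow> bool" where
  "subcrystal D X \<longleftrightarrow> X \<subseteq> monomials D \<and>
     (\<forall>p \<in> X. \<forall>i q. crystal_f D i p = Some q \<or> crystal_e D i p = Some q \<longrightarrow> q \<in> X)"

section \<open>The product monomial crystal and its truncations\<close>

definition wt_mset ::
    "('i::finite, 'n::finite) root_datum \<Rightarrow> ('i \<times> int) multiset \<Rightarrow> int ^ 'n" where
  "wt_mset D R = to_lattice (\<Sum>(i, c) \<in># R. fund_weight D i)"

definition y_mset ::
    "('i::finite, 'n::finite) root_datum \<Rightarrow> ('i \<times> int) multiset \<Rightarrow> ('i, 'n) monomial" where
  "y_mset D R = (wt_mset D R, \<Sum>x \<in># R. Poly_Mapping.single x 1)"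

definition z_mset ::
    "('i::finite, 'n::finite) root_datum \<Rightarrow> ('i \<times> int) multiset \<Rightarrow> ('i, 'n) monomial" where
  "z_mset D S = (\<Sum>x \<in># S. z_mon D x)"

definition based_mset ::
    "('i::finite, 'n::finite) root_datum \<Rightarrow> ('i \<times> int) multiset \<Rightarrow> bool" where
  "based_mset D R \<longleftrightarrow> set_mset R \<subseteq> parity_vertices D \<and>
     (\<forall>i c. of_nat (count R (i, c)) *s fund_weight D i \<in> range of_lattice)"

definition fund_crystal ::
    "('i::finite, 'n::finite) root_datum \<Rightarrow> 'i \<times> int \<Rightarrow> nat \<Rightarrow> ('i, 'n) monomial set" where
  "fund_crystal D x n = subcrystal D hull {y_mset D (replicate_mset n x)}"

text \<open>A product of sets of monomials is a sum of sets, since monomials are written additively.\<close>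

definition product_crystal ::
    "('i::finite, 'n::finite) root_datum \<Rightarrow> ('i \<times> int) multiset \<Rightarrow> ('i, 'n) monomial set" where
  "product_crystal D R =
     {\<Sum>x \<in> set_mset R. q x | q. \<forall>x \<in> set_mset R. q x \<in> fund_crystal D x (count R x)}"

definition mon_supp ::
    "('i::finite, 'n::finite) root_datum \<Rightarrow> ('i \<times> int) multiset \<Rightarrow> ('i, 'n) monomial
      \<Rightarrow> ('i \<times> int) set" where
  "mon_supp D R p = set_mset R \<union>
     set_mset (THE S. set_mset S \<subseteq> parity_vertices D \<and> p = y_mset D R - z_mset D S)"

definition vertex_le :: "('i::finite, 'n::finite) root_datum \<Rightarrow> 'i \<times> int \<Rightarrow> 'i \<times> int \<Rightarrow> bool"
  where
  "vertex_le D = (\<lambda>x y. x \<in> parity_vertices D \<and>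
     (\<exists>i c. x = (i, c) \<and> (y = (i, c + 2) \<or> (\<exists>j. adjacent D i j \<and> y = (j, c + 1)))))\<^sup>*\<^sup>*"

definition upward_closed ::
    "('i::finite, 'n::finite) root_datum \<Rightarrow> ('i \<times> int) set \<Rightarrow> bool" where
  "upward_closed D J \<longleftrightarrow> J \<subseteq> parity_vertices D \<and> (\<forall>x \<in> J. \<forall>y. vertex_le D x y \<longrightarrow> y \<in> J)"

definition truncation ::
    "('i::finite, 'n::finite) root_datum \<Rightarrow> ('i \<times> int) multiset \<Rightarrow> ('i \<times> int) set
      \<Rightarrow> ('i, 'n) monomial set" where
  "truncation D R J = {p \<in> product_crystal D R. mon_supp D R p \<subseteq> J}"

section \<open>Characters and Demazure operators\<close>

text \<open>The group ring \<open>\<int>[P]\<close>: the product of finitely supported functions is convolution.\<close>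

type_synonym 'n char_ring = "(int ^ 'n) \<Rightarrow>\<^sub>0 int"

abbreviation wt_exp :: "int ^ 'n \<Rightarrow> 'n char_ring" where
  "wt_exp \<mu> \<equiv> Poly_Mapping.single \<mu> 1"

text \<open>Only meaningful for finite sets; product monomial crystals are finite.\<close>

definition crystal_char :: "('i, 'n::finite) monomial set \<Rightarrow> 'n char_ring" where
  "crystal_char X = (\<Sum>p\<in>X. wt_exp (wt p))"

text \<open>
  The quotient \<open>(e\<^sup>\<mu> - e\<^bsup>s\<^sub>i\<mu>-\<alpha>\<^sub>i\<^esup>) / (1 - e\<^bsup>-\<alpha>\<^sub>i\<^esup>)\<close> exists in \<open>\<int>[P]\<close> and is unique, since \<open>1 - e\<^bsup>-\<alpha>\<^sub>i\<^esup>\<close> is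
  not a zero divisor.
\<close>

definition demazure_exp ::
    "('i::finite, 'n::finite) root_datum \<Rightarrow> 'i \<Rightarrow> int ^ 'n \<Rightarrow> 'n char_ring" where
  "demazure_exp D i \<mu> = (THE g. g * (1 - wt_exp (- simple_root D i)) =
     wt_exp \<mu> - wt_exp (simple_reflection D i \<mu> - simple_root D i))"

definition demazure ::
    "('i::finite, 'n::finite) root_datum \<Rightarrow> 'i \<Rightarrow> 'n char_ring \<Rightarrow> 'n char_ring" where
  "demazure D i g = (\<Sum>\<mu> \<in> Poly_Mapping.keys g.
     of_int (Poly_Mapping.lookup g \<mu>) * demazure_exp D i \<mu>)"

text \<open>The choice of the reduced word is immaterial by the braid relations.\<close>

definition demazure_weyl ::
    "('i::finite, 'n::finite) root_datum \<Rightarrow> (int ^ 'n \<Rightarrow> int ^ 'n) \<Rightarrow> 'n char_ring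
      \<Rightarrow> 'n char_ring" where
  "demazure_weyl D w = foldr (demazure D) (SOME is. reduced_word D w is)"

end

theory Submission
  imports Defs "HOL-Library.Z2" "HOL-Library.Function_Algebras"
begin

text \<open>
  Write the elements of the product crystal as \<open>y\<^sub>R z\<^sub>S\<^sup>-\<^sup>1\<close>.  The multisets \<open>S\<close> that occur are the
  dimension vectors of submodules of an injective module over the \<open>\<int>\<close>-cover of the preprojective
  algebra.  Counting dimensions in its mesh complexes shows that any positive exponent of
  \<open>y\<^bsub>i,k+2\<^esub>\<close> allows multiplication by \<open>z\<^bsub>i,k\<^esub>\<^sup>-\<^sup>1\<close> and any negative exponent of \<open>y\<^bsub>i,k\<^esub>\<close>
  multiplication by \<open>z\<^bsub>i,k\<^esub>\<close>.  This closure property is inherited by products, and it implies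
  closure under the crystal operators.

  If \<open>(i, k)\<close> is a new minimal element of the upward-closed set, then within an \<open>i\<close>-string the
  operators \<open>f\<^sub>i\<close> acting at \<open>k\<close> come first, so the smaller truncation meets each \<open>i\<close>-string of
  the larger one in its top or in the whole string, and the larger character is \<open>\<pi>\<^sub>i\<close> of the smaller.
  Finitely many such steps lead from any truncation to the whole crystal, whose character is fixed
  by every \<open>\<pi>\<^sub>i\<close>, and \<open>\<pi>\<^sub>w \<pi>\<^sub>i = \<pi>\<^sub>w\<close> for the longest element \<open>w\<close>.
\<close>

section \<open>The Weyl group\<close>

text \<open>Products force all signed exponents to be usable, not only the positions that the
  crystal operators choose: \<open>f_i\<close> may act on a product at a position where it acts on
  no factor, whereas a positive exponent of a product is positive in some factor. The price is paid
  for a single generator \<open>y_{i,c}\<close>. There the exponent of \<open>y_{i,k+2}\<close> is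
  the dimension of the middle term of a mesh complex minus the dimensions of its outer terms, so its
  sign tells at which end a vector can be added or removed. Over the field with two elements the
  only linear algebra needed is that a space has as many elements as kernel times image.

  The chain of enlargements of a truncation need not spell a reduced word. None is needed, because
  the operator of the longest element absorbs \<open>pi_i\<close> for whichever \<open>i\<close>
  comes next; what matters is that the chain is finite. Finiteness has two sources: Weyl symmetry of
  the weights bounds the size of \<open>S\<close>, and the absence of gaps between occupied levels
  then bounds how far down \<open>S\<close> can reach.\<close>

lemma pairing_add: "pairing a (x + y) = pairing a x + pairing a y"
  by (simp add: pairing_def sum.distrib distrib_left)

lemma pairing_scale: "pairing a (c *s x) = c * pairing a (x :: 'a::comm_ring_1 ^ _)"
  by (simp add: pairing_def sum_distrib_left mult_ac)

lemma pairing_zero [simp]: "pairing a 0 = 0"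
  by (simp add: pairing_def)

lemma pairing_diff: "pairing a (x - y) = pairing a x - pairing a y"
  by (simp add: pairing_def sum_subtractf right_diff_distrib)

lemma pairing_sum: "pairing a (\<Sum>x\<in>A. f x) = (\<Sum>x\<in>A. pairing a (f x))"
  by (induction A rule: infinite_finite_induct) (simp_all add: pairing_add)

lemma word_element_Nil [simp]: "word_element D [] = id"
  and word_element_Cons [simp]: "word_element D (i # is) = simple_reflection D i \<circ> word_element D is"
  by (simp_all add: word_element_def)

lemma word_element_append: "word_element D (is @ js) = word_element D is \<circ> word_element D js"
  by (induction "is") (simp_all add: comp_assoc)

lemma foldr_snoc: "foldr f (xs @ [x]) = foldr f xs \<circ> f x"
  by (simp add: fun_eq_iff)

lemma weyl_length_le: "weyl_length D (word_element D is) \<le> length is"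
  unfolding weyl_length_def by (rule Least_le) blast

lemma reduced_word_exists:
  assumes "w \<in> weyl_group D"
  obtains "is" where "reduced_word D w is"
proof -
  from assms obtain js where "word_element D js = w"
    by (auto simp: weyl_group_def)
  then have "\<exists>r is. length is = r \<and> word_element D is = w"
    by blast
  from LeastI_ex[OF this] show ?thesis
    using that by (auto simp: reduced_word_def weyl_length_def)
qed

context simply_laced_datum
begin

abbreviation root ("\<alpha>") where "\<alpha> \<equiv> simple_root D"
abbreviation coroot ("\<alpha>\<^sup>\<or>") where "\<alpha>\<^sup>\<or> \<equiv> simple_coroot D"
abbreviation refl where "refl \<equiv> simple_reflection D"
abbreviation cartan :: "'i \<Rightarrow> 'i \<Rightarrow> int" where "cartan i j \<equiv> pairing (\<alpha>\<^sup>\<or> i) (\<alpha> j)"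

lemma adjacent_sym: "adjacent D i j \<longleftrightarrow> adjacent D j i"
  by (simp add: adjacent_def cartan_sym)

lemma adjacent_irrefl [simp]: "\<not> adjacent D i i"
  by (simp add: adjacent_def cartan_diag)

lemma cartan_eq: "cartan i j = (if i = j then 2 else if adjacent D i j then -1 else 0)"
  using cartan_diag cartan_off_diag[of i j] by (auto simp: adjacent_def)

lemma root_nonzero: "\<alpha> i \<noteq> 0"
  using cartan_diag[of i] by auto

lemma refl_add: "refl i (x + y) = refl i x + refl i y"
  by (simp add: simple_reflection_def pairing_add vec_eq_iff algebra_simps)

lemma refl_scale: "refl i (c *s x) = c *s refl i x"
  by (simp add: simple_reflection_def pairing_scale vec_eq_iff algebra_simps)

lemma refl_zero [simp]: "refl i 0 = 0"
  by (simp add: simple_reflection_def)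

lemma refl_minus: "refl i (- x) = - refl i x"
  using refl_scale[of i "-1" x] by (metis vector_sneg_minus1 mult_minus1)

lemma refl_diff: "refl i (x - y) = refl i x - refl i y"
  using refl_add[of i x "- y"] by (simp add: refl_minus)

lemma refl_root: "refl i (\<alpha> j) = \<alpha> j - cartan i j *s \<alpha> i"
  by (simp add: simple_reflection_def)

lemma refl_root_self: "refl i (\<alpha> i) = - \<alpha> i"
  by (simp add: refl_root cartan_diag vec_eq_iff)

lemma refl_root_adj: "adjacent D i j \<Longrightarrow> refl i (\<alpha> j) = \<alpha> i + \<alpha> j"
  by (simp add: refl_root adjacent_def vec_eq_iff)

lemma refl_root_nonadj: "\<lbrakk>\<not> adjacent D i j; i \<noteq> j\<rbrakk> \<Longrightarrow> refl i (\<alpha> j) = \<alpha> j"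
  by (simp add: refl_root cartan_eq)

lemma refl_refl [simp]: "refl i (refl i x) = x"
  by (simp add: simple_reflection_def pairing_diff pairing_scale cartan_diag vec_eq_iff)

lemma refl_comp_refl [simp]: "refl i \<circ> refl i = id"
  by (simp add: fun_eq_iff)

lemma refl_commute: "\<lbrakk>\<not> adjacent D i j; i \<noteq> j\<rbrakk> \<Longrightarrow> refl i (refl j x) = refl j (refl i x)"
  by (simp add: simple_reflection_def pairing_diff pairing_scale cartan_eq adjacent_sym[of j i])

lemma refl_braid:
  assumes "adjacent D i j"
  shows "refl i (refl j (refl i x)) = refl j (refl i (refl j x))"
proof -
  have "cartan i j = -1" "cartan j i = -1"
    using assms adjacent_sym by (auto simp: adjacent_def)
  then show ?thesis
    by (simp add: simple_reflection_def pairing_diff pairing_scale cartan_diag)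
       (simp add: vec_eq_iff algebra_simps)
qed

lemma word_element_add: "word_element D is (x + y) = word_element D is x + word_element D is y"
  by (induction "is") (simp_all add: refl_add)

lemma word_element_minus: "word_element D is (- x) = - word_element D is x"
  by (induction "is") (simp_all add: refl_minus)

lemma word_element_scale: "word_element D is (c *s x) = c *s word_element D is x"
  by (induction "is") (simp_all add: refl_scale)

lemma word_element_zero [simp]: "word_element D is 0 = 0"
  by (induction "is") simp_all

lemma weyl_comp_refl: "w \<in> weyl_group D \<Longrightarrow> w \<circ> refl i \<in> weyl_group D"
proof -
  assume "w \<in> weyl_group D"
  then obtain "is" where "w = word_element D is"
    by (auto simp: weyl_group_def)
  then have "w \<circ> refl i = word_element D (is @ [i])"
    by (simp add: word_element_append)
  then show ?thesis
    by (auto simp: weyl_group_def)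
qed

text \<open>The dot product summed over the orbit of the finite Weyl group. It turns finiteness of
  the group into an invariant, positive definite notion of length.\<close>

definition inv_form :: "int ^ 'n \<Rightarrow> int ^ 'n \<Rightarrow> int" where
  "inv_form x y = (\<Sum>w\<in>weyl_group D. \<Sum>k\<in>UNIV. w x $ k * w y $ k)"

lemma inv_form_refl: "inv_form (refl i x) (refl i y) = inv_form x y"
  unfolding inv_form_def
  by (rule sum.reindex_bij_witness[where i = "\<lambda>w. w \<circ> refl i" and j = "\<lambda>w. w \<circ> refl i"])
     (auto simp: weyl_comp_refl comp_assoc)

lemma inv_form_word: "inv_form (word_element D is x) (word_element D is y) = inv_form x y"
  by (induction "is") (simp_all add: inv_form_refl)

lemma inv_form_commute: "inv_form x y = inv_form y x"
  by (simp add: inv_form_def mult.commute)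

lemma inv_form_add_right: "inv_form x (y + z) = inv_form x y + inv_form x z"
  unfolding inv_form_def sum.distrib[symmetric]
  by (intro sum.cong refl) (auto simp: weyl_group_def word_element_add algebra_simps)

lemma inv_form_scale_right: "inv_form x (c *s y) = c * inv_form x y"
  unfolding inv_form_def sum_distrib_left
  by (intro sum.cong refl) (auto simp: weyl_group_def word_element_scale algebra_simps)

lemma inv_form_minus_right: "inv_form x (- y) = - inv_form x y"
  by (subst vector_sneg_minus1) (simp only: inv_form_scale_right mult_minus1)

lemma inv_form_zero_right [simp]: "inv_form x 0 = 0"
  using inv_form_scale_right[of x 0 0] by simp

lemma inv_form_sum_right: "inv_form x (\<Sum>a\<in>A. f a) = (\<Sum>a\<in>A. inv_form x (f a))"
  by (induction A rule: infinite_finite_induct) (simp_all add: inv_form_add_right)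

lemma inv_form_scale_left: "inv_form (c *s x) y = c * inv_form x y"
  using inv_form_scale_right[of y c x] by (simp add: inv_form_commute)

lemma inv_form_sum_left: "inv_form (\<Sum>a\<in>A. f a) y = (\<Sum>a\<in>A. inv_form (f a) y)"
  using inv_form_sum_right[of y f A] by (simp add: inv_form_commute)

lemma inv_form_add_left: "inv_form (x + y) z = inv_form x z + inv_form y z"
  using inv_form_add_right[of z x y] by (simp add: inv_form_commute)

lemma inv_form_minus_left: "inv_form (- x) y = - inv_form x y"
  using inv_form_minus_right[of y x] by (simp add: inv_form_commute)

lemma inv_form_pos:
  assumes "x \<noteq> 0"
  shows "inv_form x x > 0"
proof -
  obtain k where k: "x $ k \<noteq> 0"
    using assms by (auto simp: vec_eq_iff)
  have id: "id \<in> weyl_group D"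
    unfolding weyl_group_def by (metis rangeI word_element_Nil)
  have "0 < (\<Sum>k\<in>UNIV. x $ k * x $ k)"
    by (rule sum_pos2[of UNIV k]) (use k in \<open>auto simp: zero_less_mult_iff\<close>)
  then show ?thesis
    unfolding inv_form_def
    by (intro sum_pos2[OF finite_weyl_group id]) (auto intro: sum_nonneg)
qed

text \<open>Reflecting both arguments by \<open>s_i\<close> negates the root and shifts
  \<open>x\<close> by a multiple of it. Hence the form determines the coroot, which is what lets
  invariance carry over to reflections in \<open>refl_conj\<close>.\<close>

lemma inv_form_root: "2 * inv_form (\<alpha> i) x = pairing (\<alpha>\<^sup>\<or> i) x * inv_form (\<alpha> i) (\<alpha> i)"
proof -
  have "inv_form (\<alpha> i) x = inv_form (- \<alpha> i) (x + (- pairing (\<alpha>\<^sup>\<or> i) x) *s \<alpha> i)"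
    using inv_form_refl[of i "\<alpha> i" x]
    by (simp add: refl_root_self) (simp add: simple_reflection_def vector_smult_lneg)
  also have "\<dots> = - inv_form (\<alpha> i) x + pairing (\<alpha>\<^sup>\<or> i) x * inv_form (\<alpha> i) (\<alpha> i)"
    by (simp only: inv_form_add_right inv_form_scale_right)
       (simp add: inv_form_commute[of "- \<alpha> i"] inv_form_minus_right inv_form_commute[of x])
  finally show ?thesis
    by simp
qed

text \<open>For adjacent vertices the two Cartan entries agree, and \<open>inv_form_root\<close>
  then equates the lengths; connectedness spreads this over the diagram.\<close>

lemma inv_form_root_const: "inv_form (\<alpha> i) (\<alpha> i) = inv_form (\<alpha> j) (\<alpha> j)"
proof -
  have "inv_form (\<alpha> k) (\<alpha> k) = inv_form (\<alpha> l) (\<alpha> l)" if "adjacent D k l" for k l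
    using that inv_form_root[of k "\<alpha> l"] inv_form_root[of l "\<alpha> k"] adjacent_sym[of k l]
      inv_form_commute[of "\<alpha> k" "\<alpha> l"]
    by (simp add: adjacent_def)
  with connected_diagram[of i j] show ?thesis
    by (induction rule: rtranclp_induct) simp_all
qed

section \<open>Signs of roots\<close>

definition root_comb :: "('i \<Rightarrow> int) \<Rightarrow> int ^ 'n" where
  "root_comb m = (\<Sum>j\<in>UNIV. m j *s \<alpha> j)"

definition nonneg_comb :: "int ^ 'n \<Rightarrow> bool" where
  "nonneg_comb x \<longleftrightarrow> (\<exists>m. (\<forall>j. m j \<ge> 0) \<and> x = root_comb m)"

lemma root_comb_add: "root_comb (\<lambda>j. m j + n j) = root_comb m + root_comb n"
  by (simp add: root_comb_def vector_sadd_rdistrib sum.distrib)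

lemma root_comb_scale: "root_comb (\<lambda>j. c * m j) = c *s root_comb m"
  by (simp add: root_comb_def vec_eq_iff sum_distrib_left mult_ac)

lemma root_comb_minus: "root_comb (\<lambda>j. - m j) = - root_comb m"
  by (simp add: root_comb_def vec_eq_iff sum_negf)

lemma root_comb_single: "root_comb (\<lambda>j. if j = i then c else 0) = c *s \<alpha> i"
  by (simp add: root_comb_def if_distrib[of "\<lambda>c. c *s _"] cong: if_cong)

lemma root_comb_inj: "root_comb m = root_comb n \<Longrightarrow> m = n"
  using roots_independent[of "\<lambda>j. m j - n j"]
  by (auto simp: root_comb_def vector_sub_rdistrib sum_subtractf fun_eq_iff)

lemma nonneg_comb_add: "\<lbrakk>nonneg_comb x; nonneg_comb y\<rbrakk> \<Longrightarrow> nonneg_comb (x + y)"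
  unfolding nonneg_comb_def by (metis (no_types, lifting) add_nonneg_nonneg root_comb_add)

lemma nonneg_comb_root: "nonneg_comb (\<alpha> i)"
  unfolding nonneg_comb_def
  by (rule exI[of _ "\<lambda>j. if j = i then 1 else 0"]) (simp add: root_comb_single)

lemma nonneg_comb_antisym: "\<lbrakk>nonneg_comb x; nonneg_comb (- x)\<rbrakk> \<Longrightarrow> x = 0"
proof -
  assume "nonneg_comb x" "nonneg_comb (- x)"
  then obtain m n where m: "\<forall>j. m j \<ge> 0" "x = root_comb m"
    and n: "\<forall>j. n j \<ge> 0" "- x = root_comb n"
    by (auto simp: nonneg_comb_def)
  have "m = (\<lambda>j. - n j)"
    by (rule root_comb_inj) (simp add: root_comb_minus m(2)[symmetric] n(2)[symmetric])
  with m(1) n(1) have "m = (\<lambda>j. 0 * m j)"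
    by (auto simp: fun_eq_iff order.antisym)
  then show "x = 0"
    using m(2) root_comb_scale[of 0 m] by simp
qed

text \<open>Since all simple roots are equally long, \<open>o'\<close> is just a reference vertex
  for the common scale; the factor 2 avoids a division.\<close>

lemma inv_form_root_comb:
  "2 * inv_form (root_comb m) (root_comb n) =
    inv_form (\<alpha> o') (\<alpha> o') * (\<Sum>i\<in>UNIV. \<Sum>j\<in>UNIV. m i * n j * cartan i j)"
proof -
  have right: "inv_form x (root_comb n) = (\<Sum>j\<in>UNIV. n j * inv_form x (\<alpha> j))" for x
    by (simp add: root_comb_def inv_form_sum_right inv_form_scale_right)
  have "inv_form (root_comb m) (root_comb n) = (\<Sum>i\<in>UNIV. m i * inv_form (\<alpha> i) (root_comb n))"
    unfolding root_comb_def[of m] by (simp add: inv_form_sum_left inv_form_scale_left)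
  then have "2 * inv_form (root_comb m) (root_comb n) =
      (\<Sum>i\<in>UNIV. \<Sum>j\<in>UNIV. m i * n j * (2 * inv_form (\<alpha> i) (\<alpha> j)))"
    by (simp add: right sum_distrib_left mult_ac)
  also have "\<dots> = inv_form (\<alpha> o') (\<alpha> o') * (\<Sum>i\<in>UNIV. \<Sum>j\<in>UNIV. m i * n j * cartan i j)"
  proof -
    have "m i * n j * (2 * inv_form (\<alpha> i) (\<alpha> j)) = inv_form (\<alpha> o') (\<alpha> o') * (m i * n j * cartan i j)" for i j
      unfolding inv_form_root inv_form_root_const[of i o'] by (simp only: mult_ac)
    then show ?thesis
      by (simp only: sum_distrib_left)
  qed
  finally show ?thesis .
qed

text \<open>By symmetry the off-diagonal terms come in equal pairs, and each diagonal entry is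
  2.\<close>

lemma even_quadratic_form:
  "even (\<Sum>i\<in>A. \<Sum>j\<in>A. m i * m j * cartan i j)" if "finite A" for m :: "'i \<Rightarrow> int"
  using that
proof (induction A)
  case (insert x A)
  have "(\<Sum>i\<in>A. m i * m x * cartan i x) = (\<Sum>j\<in>A. m x * m j * cartan x j)"
    by (intro sum.cong refl) (simp add: cartan_sym[of _ x])
  with insert show ?case
    by (simp add: sum.distrib cartan_diag)
qed simp

text \<open>
  The root lattice is even, so a nonzero element of it is at least as long as a root.  This
  forbids a root with both positive and negative coefficients, because its two parts meet at
  an obtuse angle.
\<close>

lemma inv_form_root_comb_ge:
  assumes "root_comb m \<noteq> 0"
  shows "inv_form (root_comb m) (root_comb m) \<ge> inv_form (\<alpha> i) (\<alpha> i)"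
proof -
  let ?c = "inv_form (\<alpha> i) (\<alpha> i)"
  obtain k where k: "(\<Sum>i\<in>UNIV. \<Sum>j\<in>UNIV. m i * m j * cartan i j) = 2 * k"
    using even_quadratic_form[of UNIV m] by auto
  then have eq: "inv_form (root_comb m) (root_comb m) = ?c * k"
    using inv_form_root_comb[of m m i] by simp
  have c: "?c > 0"
    by (rule inv_form_pos[OF root_nonzero])
  with inv_form_pos[OF assms] eq have "k > 0"
    by (simp add: zero_less_mult_iff)
  then have "?c * 1 \<le> ?c * k"
    using c by (intro mult_left_mono) auto
  then show ?thesis
    using eq by simp
qed

lemma root_word_comb: "\<exists>m. word_element D is (\<alpha> i) = root_comb m"
proof (induction "is")
  case Nil
  then show ?case
    using nonneg_comb_root[of i] by (auto simp: nonneg_comb_def)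
next
  case (Cons k "is")
  then obtain m where m: "word_element D is (\<alpha> i) = root_comb m"
    by blast
  have "refl k (root_comb m) =
      root_comb (\<lambda>j. m j + (if j = k then - pairing (\<alpha>\<^sup>\<or> k) (root_comb m) else 0))"
    unfolding root_comb_add root_comb_single
    by (simp add: simple_reflection_def vec_eq_iff)
  then show ?case
    using m by auto
qed

lemma root_pos_or_neg:
  "nonneg_comb (word_element D is (\<alpha> i)) \<or> nonneg_comb (- word_element D is (\<alpha> i))"
proof (rule ccontr)
  assume neg: "\<not> ?thesis"
  obtain m where m: "word_element D is (\<alpha> i) = root_comb m"
    using root_word_comb by blast
  let ?c = "inv_form (\<alpha> i) (\<alpha> i)"
  \<comment> \<open>Positive and negative parts of the coefficients. Both are nonzero vectors here,
    hence at least as long as a root; as they meet at an obtuse angle, their difference is longer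
    than a root.\<close>
  define a where "a = (\<lambda>j. max (m j) 0)"
  define b where "b = (\<lambda>j. max (- m j) 0)"
  have "m = (\<lambda>j. a j + - b j)"
    by (auto simp: a_def b_def fun_eq_iff)
  then have split: "root_comb m = root_comb a + - root_comb b"
    by (metis root_comb_add root_comb_minus)
  have "nonneg_comb (root_comb a)" "nonneg_comb (root_comb b)"
    unfolding nonneg_comb_def a_def b_def by (metis max.cobounded2)+
  with neg m split have "root_comb a \<noteq> 0" "root_comb b \<noteq> 0"
    by auto
  then have ge: "inv_form (root_comb a) (root_comb a) \<ge> ?c" "inv_form (root_comb b) (root_comb b) \<ge> ?c"
    by (simp_all add: inv_form_root_comb_ge)
  \<comment> \<open>On the diagonal one of the two coefficients vanishes, and off it the Cartan
    entry is at most 0.\<close>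
  have "a j * b k * cartan j k \<le> 0" for j k
    by (cases "j = k") (auto simp: a_def b_def cartan_eq max_def mult_le_0_iff)
  then have "(\<Sum>j\<in>UNIV. \<Sum>k\<in>UNIV. a j * b k * cartan j k) \<le> 0"
    by (intro sum_nonpos)
  then have "2 * inv_form (root_comb a) (root_comb b) \<le> 0"
    unfolding inv_form_root_comb[of a b i]
    using inv_form_pos[OF root_nonzero[of i]] by (simp add: mult_le_0_iff)
  moreover have "inv_form (root_comb m) (root_comb m) = ?c"
    unfolding m[symmetric] by (rule inv_form_word)
  moreover have "inv_form (root_comb m) (root_comb m) = inv_form (root_comb a) (root_comb a)
      + inv_form (root_comb b) (root_comb b) - 2 * inv_form (root_comb a) (root_comb b)"
    unfolding split
    by (simp only: inv_form_add_right inv_form_minus_right inv_form_add_left inv_form_minus_left)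
       (simp add: inv_form_commute[of "root_comb b" "root_comb a"])
  ultimately show False
    using ge inv_form_pos[OF root_nonzero[of i]] by linarith
qed

text \<open>The reflection \<open>s_k\<close> changes the coefficient of \<open>\<alpha> k\<close>
  only, so every other coefficient is both nonnegative and nonpositive. The root is thus a multiple
  of \<open>\<alpha> k\<close>, and comparing lengths makes the multiple 1.\<close>

lemma positive_root_made_negative:
  assumes "nonneg_comb (word_element D is (\<alpha> i))"
    and "nonneg_comb (- refl k (word_element D is (\<alpha> i)))"
  shows "word_element D is (\<alpha> i) = \<alpha> k"
proof -
  let ?x = "word_element D is (\<alpha> i)"
  obtain m where m: "\<forall>j. m j \<ge> 0" "?x = root_comb m"
    using assms(1) by (auto simp: nonneg_comb_def)
  obtain n where n: "\<forall>j. n j \<ge> 0" "- refl k ?x = root_comb n"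
    using assms(2) by (auto simp: nonneg_comb_def)
  let ?p = "pairing (\<alpha>\<^sup>\<or> k) ?x"
  have "root_comb (\<lambda>j. m j + (if j = k then - ?p else 0)) = root_comb (\<lambda>j. - n j)"
    unfolding root_comb_add root_comb_single root_comb_minus m(2)[symmetric] n(2)[symmetric]
    by (simp add: simple_reflection_def vec_eq_iff)
  then have "(\<lambda>j. m j + (if j = k then - ?p else 0)) = (\<lambda>j. - n j)"
    by (rule root_comb_inj)
  then have eq: "m j + (if j = k then - ?p else 0) = - n j" for j
    unfolding fun_eq_iff by (rule spec)
  have "m j = (if j = k then m k else 0)" for j
    using eq[of j] m(1) n(1) by (smt (verit))
  then have mk: "?x = m k *s \<alpha> k"
    unfolding m(2) root_comb_single[symmetric] by metis
  have "inv_form ?x ?x = inv_form (\<alpha> k) (\<alpha> k)"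
    by (simp add: inv_form_word inv_form_root_const[of i k])
  moreover have "inv_form ?x ?x = m k * m k * inv_form (\<alpha> k) (\<alpha> k)"
    unfolding mk by (simp add: inv_form_scale_right inv_form_scale_left)
  ultimately have "m k * m k = 1"
    using inv_form_pos[OF root_nonzero[of k]] by simp
  then have "m k = 1"
    using m(1)[rule_format, of k] zmult_eq_1_iff[of "m k" "m k"] by auto
  with mk show ?thesis
    by simp
qed

text \<open>The form expresses coroots through roots and is invariant, so a Weyl group element that
  carries one simple root to another also carries the coroot along.\<close>

lemma refl_conj:
  assumes "word_element D is (\<alpha> i) = \<alpha> k"
  shows "word_element D is \<circ> refl i = refl k \<circ> word_element D is"
proof
  fix x
  let ?w = "word_element D is"
  have "pairing (\<alpha>\<^sup>\<or> i) x * inv_form (\<alpha> k) (\<alpha> k) = 2 * inv_form (?w (\<alpha> i)) (?w x)"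
    by (simp only: inv_form_word inv_form_root inv_form_root_const[of i k])
  also have "\<dots> = pairing (\<alpha>\<^sup>\<or> k) (?w x) * inv_form (\<alpha> k) (\<alpha> k)"
    by (simp only: assms inv_form_root)
  finally have "pairing (\<alpha>\<^sup>\<or> i) x = pairing (\<alpha>\<^sup>\<or> k) (?w x)"
    using inv_form_pos[OF root_nonzero[of k]] by simp
  moreover have "?w (refl i x) = ?w x + - pairing (\<alpha>\<^sup>\<or> i) x *s ?w (\<alpha> i)"
    unfolding simple_reflection_def
    by (metis (no_types) diff_conv_add_uminus vector_sneg_minus1 vector_smult_assoc word_element_add
        word_element_scale mult_minus1)
  ultimately show "(?w \<circ> refl i) x = (refl k \<circ> ?w) x"
    using assms by (simp add: simple_reflection_def vec_eq_iff)
qed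

text \<open>Apply the letters to \<open>\<alpha> i\<close> from the right. At some letter
  \<open>k\<close> the root turns negative; just before, it equals \<open>\<alpha> k\<close>, and by
  \<open>refl_conj\<close> this letter cancels against \<open>s_i\<close> appended at the
  end.\<close>

lemma exchange:
  assumes "nonneg_comb (- word_element D is (\<alpha> i))"
  shows "\<exists>js. Suc (length js) = length is \<and> word_element D js = word_element D is \<circ> refl i"
  using assms
proof (induction "is")
  case Nil
  then show ?case
    using nonneg_comb_antisym[OF nonneg_comb_root, of i] root_nonzero by auto
next
  case (Cons k "is")
  show ?case
  proof (cases "nonneg_comb (- word_element D is (\<alpha> i))")
    case True
    then obtain js where "Suc (length js) = length is"
        "word_element D js = word_element D is \<circ> refl i"
      using Cons.IH by blast
    then show ?thesis
      by (intro exI[of _ "k # js"]) (simp add: comp_assoc)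
  next
    case False
    then have "word_element D is (\<alpha> i) = \<alpha> k"
      using root_pos_or_neg[of "is" i] Cons.prems
      by (intro positive_root_made_negative) auto
    from refl_conj[OF this] have "word_element D (k # is) \<circ> refl i = word_element D is"
      by (metis comp_assoc comp_id refl_comp_refl id_comp word_element_Cons)
    then show ?thesis
      by (intro exI[of _ "is"] conjI) (simp, simp only:)
  qed
qed

section \<open>Length and right descents\<close>

lemma weyl_length_refl_le:
  assumes "w \<in> weyl_group D"
  shows "weyl_length D w \<le> Suc (weyl_length D (w \<circ> refl i))"
proof -
  obtain "is" where "is": "reduced_word D (w \<circ> refl i) is"
    using reduced_word_exists[OF weyl_comp_refl[OF assms]] .
  then have "word_element D (is @ [i]) = w"
    by (simp add: reduced_word_def word_element_append comp_assoc)
  then show ?thesis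
    using weyl_length_le[of D "is @ [i]"] "is" by (simp add: reduced_word_def)
qed

lemma weyl_length_refl_neg:
  assumes "w \<in> weyl_group D" and "nonneg_comb (- w (\<alpha> i))"
  shows "weyl_length D w = Suc (weyl_length D (w \<circ> refl i))"
proof -
  obtain "is" where "is": "reduced_word D w is"
    using reduced_word_exists[OF assms(1)] .
  then obtain js where "Suc (length js) = length is" "word_element D js = w \<circ> refl i"
    using exchange[of "is" i] assms(2) by (auto simp: reduced_word_def)
  then have "Suc (weyl_length D (w \<circ> refl i)) \<le> weyl_length D w"
    using weyl_length_le[of D js] "is" by (simp add: reduced_word_def)
  then show ?thesis
    using weyl_length_refl_le[OF assms(1), of i] by simp
qed

text \<open>Otherwise \<open>w\<close> keeps \<open>\<alpha> i\<close> positive, so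
  \<open>w s_i\<close> makes it negative and is by \<open>weyl_length_refl_neg\<close> longer than
  \<open>w\<close>.\<close>

lemma descent_neg:
  assumes w: "w \<in> weyl_group D" and "weyl_length D (w \<circ> refl i) \<le> weyl_length D w"
  shows "nonneg_comb (- w (\<alpha> i))"
proof (rule ccontr)
  assume neg: "\<not> ?thesis"
  obtain "is" where "is": "w = word_element D is"
    using w by (auto simp: weyl_group_def)
  have "nonneg_comb (- (w \<circ> refl i) (\<alpha> i))"
    using root_pos_or_neg[of "is" i] neg "is" by (simp add: refl_root_self word_element_minus)
  from weyl_length_refl_neg[of "w \<circ> refl i", OF weyl_comp_refl[OF w] this] assms(2) show False
    by (simp add: comp_assoc)
qed

lemma longest_neg: "longest_element D w \<Longrightarrow> nonneg_comb (- w (\<alpha> i))"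
  by (rule descent_neg) (auto simp: longest_element_def weyl_comp_refl)

lemma reduced_word_snoc:
  assumes "reduced_word D w (is @ [i])"
  shows "reduced_word D (w \<circ> refl i) is" and "nonneg_comb (- w (\<alpha> i))"
proof -
  have w: "w = word_element D (is @ [i])" and len: "weyl_length D w = Suc (length is)"
    using assms by (auto simp: reduced_word_def)
  then have eq: "word_element D is = w \<circ> refl i"
    by (simp add: word_element_append comp_assoc)
  have "w \<in> weyl_group D"
    using w by (simp add: weyl_group_def)
  moreover have "weyl_length D (w \<circ> refl i) \<le> length is"
    unfolding eq[symmetric] by (rule weyl_length_le)
  ultimately show "reduced_word D (w \<circ> refl i) is" "nonneg_comb (- w (\<alpha> i))"
    using weyl_length_refl_le[of w i] descent_neg[of w i] len eq
    by (auto simp: reduced_word_def)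
qed

lemma reduced_word_snocI:
  assumes "w \<in> weyl_group D" "nonneg_comb (- w (\<alpha> i))" "reduced_word D (w \<circ> refl i) is"
  shows "reduced_word D w (is @ [i])"
proof -
  have "word_element D (is @ [i]) = w"
    using assms(3) by (simp add: reduced_word_def word_element_append comp_assoc)
  then show ?thesis
    using weyl_length_refl_neg[OF assms(1,2)] assms(3) by (simp add: reduced_word_def)
qed

text \<open>
  Matsumoto's theorem.  If \<open>i\<close> and \<open>j\<close> are both right descents of \<open>w\<close>, then \<open>w\<close> has a reduced word
  that ends in a reduced word of the longest element of the subgroup generated by both.
\<close>

lemma reduced_word_foldr:
  fixes T :: "'i \<Rightarrow> 'b \<Rightarrow> 'b"
  assumes comm: "\<And>i j. \<lbrakk>\<not> adjacent D i j; i \<noteq> j\<rbrakk> \<Longrightarrow> T i \<circ> T j = T j \<circ> T i"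
    and braid: "\<And>i j. adjacent D i j \<Longrightarrow> T i \<circ> T j \<circ> T i = T j \<circ> T i \<circ> T j"
    and "reduced_word D w is" and "reduced_word D w js"
  shows "foldr T is = foldr T js"
  using assms(3,4)
proof (induction "length is" arbitrary: w "is" js rule: less_induct)
  case (less "is" w js)
  have len: "length is = length js"
    using less.prems by (simp add: reduced_word_def)
  show ?case
  proof (cases "is" rule: rev_cases)
    case Nil
    with len show ?thesis by simp
  next
    case (snoc is' i)
    with len obtain js' j where js: "js = js' @ [j]"
      by (cases js rule: rev_cases) auto
    have w: "w \<in> weyl_group D"
      using less.prems by (auto simp: reduced_word_def weyl_group_def)
    note ri = reduced_word_snoc[OF less.prems(1)[unfolded snoc]]
    note rj = reduced_word_snoc[OF less.prems(2)[unfolded js]]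
    obtain u where u: "w = word_element D u"
      using w by (auto simp: weyl_group_def)
    have wi: "w \<circ> refl i \<in> weyl_group D" and wj: "w \<circ> refl j \<in> weyl_group D"
      using w by (simp_all add: weyl_comp_refl)
    consider "i = j" | "i \<noteq> j" "\<not> adjacent D i j" | "adjacent D i j"
      by blast
    then show ?thesis
    proof cases
      case 1
      then have "foldr T is' = foldr T js'"
        using less.hyps[OF _ ri(1)] rj(1) snoc by simp
      then show ?thesis
        using snoc js 1 by (simp add: foldr_snoc)
    next
      case 2
      let ?v = "w \<circ> refl i \<circ> refl j"
      have v: "?v = w \<circ> refl j \<circ> refl i"
        using refl_commute[OF 2(2,1)] by (simp add: fun_eq_iff)
      have "?v \<in> weyl_group D"
        using wi by (rule weyl_comp_refl)
      then obtain ks where ks: "reduced_word D ?v ks"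
        by (rule reduced_word_exists)
      have "reduced_word D (w \<circ> refl i) (ks @ [j])"
        by (rule reduced_word_snocI[OF wi _ ks]) (use rj(2) in \<open>simp add: refl_root_nonadj 2\<close>)
      then have eq: "foldr T is' = foldr T (ks @ [j])"
        using less.hyps[OF _ ri(1)] snoc by simp
      have "reduced_word D (w \<circ> refl j) (ks @ [i])"
        by (rule reduced_word_snocI[OF wj _ ks[unfolded v]])
          (use ri(2) 2 in \<open>simp add: refl_root_nonadj adjacent_sym[of j i]\<close>)
      then have "foldr T js' = foldr T (ks @ [i])"
        using less.hyps[OF _ rj(1)] snoc len js by simp
      with eq show ?thesis
        using comm[OF 2(2,1)] by (simp add: snoc js foldr_snoc comp_assoc del: foldr_append)
    next
      case 3
      then have adj: "adjacent D j i"
        by (simp add: adjacent_sym)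
      let ?v = "w \<circ> refl i \<circ> refl j \<circ> refl i"
      have v: "?v = w \<circ> refl j \<circ> refl i \<circ> refl j"
        using refl_braid[OF 3] by (simp add: fun_eq_iff)
      have wij: "w \<circ> refl i \<circ> refl j \<in> weyl_group D" and wji: "w \<circ> refl j \<circ> refl i \<in> weyl_group D"
        using wi wj by (simp_all add: weyl_comp_refl)
      then have "?v \<in> weyl_group D"
        by (simp add: weyl_comp_refl)
      then obtain ks where ks: "reduced_word D ?v ks"
        by (rule reduced_word_exists)
      \<comment> \<open>The sum \<open>\<alpha> i + \<alpha> j\<close> is the image of either root
        under the other reflection. That \<open>w\<close> makes it negative says that
        \<open>j\<close> is a descent of \<open>w s_i\<close> and \<open>i\<close> one of
        \<open>w s_j\<close>.\<close>
      have both: "nonneg_comb (- w (\<alpha> i + \<alpha> j))"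
        using nonneg_comb_add[OF ri(2) rj(2)] by (simp add: u word_element_add)
      have "reduced_word D (w \<circ> refl i \<circ> refl j) (ks @ [i])"
        by (rule reduced_word_snocI[OF wij _ ks])
          (use rj(2) in \<open>simp add: refl_root_adj 3 adj refl_add refl_root_self\<close>)
      then have "reduced_word D (w \<circ> refl i) ((ks @ [i]) @ [j])"
        using both by (intro reduced_word_snocI[OF wi]) (simp_all only: comp_apply refl_root_adj 3)
      then have eq: "foldr T is' = foldr T ((ks @ [i]) @ [j])"
        using less.hyps[OF _ ri(1)] snoc by simp
      have "reduced_word D (w \<circ> refl j \<circ> refl i) (ks @ [j])"
        by (rule reduced_word_snocI[OF wji _ ks[unfolded v]])
          (use ri(2) in \<open>simp add: refl_root_adj 3 adj refl_add refl_root_self\<close>)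
      then have "reduced_word D (w \<circ> refl j) ((ks @ [j]) @ [i])"
        using both by (intro reduced_word_snocI[OF wj]) (simp_all only: comp_apply refl_root_adj adj add.commute)
      then have "foldr T js' = foldr T ((ks @ [j]) @ [i])"
        using less.hyps[OF _ rj(1)] snoc len js by simp
      with eq show ?thesis
        using braid[OF 3] by (simp only: snoc js foldr_snoc comp_assoc)
    qed
  qed
qed

text \<open>Every \<open>i\<close> is a right descent of the longest element, which therefore has a
  reduced word ending in \<open>i\<close>. Matsumoto's theorem replaces the given word by it, and
  idempotency absorbs the extra operator.\<close>

lemma longest_foldr_absorb:
  fixes T :: "'i \<Rightarrow> 'b \<Rightarrow> 'b"
  assumes comm: "\<And>i j. \<lbrakk>\<not> adjacent D i j; i \<noteq> j\<rbrakk> \<Longrightarrow> T i \<circ> T j = T j \<circ> T i"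
    and braid: "\<And>i j. adjacent D i j \<Longrightarrow> T i \<circ> T j \<circ> T i = T j \<circ> T i \<circ> T j"
    and idem: "\<And>x. T i (T i x) = T i x"
    and w: "longest_element D w" and "is": "reduced_word D w is"
  shows "foldr T is (T i x) = foldr T is x"
proof -
  have W: "w \<in> weyl_group D"
    using w by (simp add: longest_element_def)
  obtain js where "reduced_word D (w \<circ> refl i) js"
    using reduced_word_exists[OF weyl_comp_refl[OF W]] .
  then have "reduced_word D w (js @ [i])"
    using reduced_word_snocI[OF W longest_neg[OF w]] by blast
  with comm braid "is" have "foldr T is = foldr T (js @ [i])"
    by (intro reduced_word_foldr[of T w]) simp_all
  then show ?thesis
    by (simp add: idem)
qed

end

section \<open>Demazure operators\<close>

text \<open>Every element of the group ring is an integer combination of exponentials, so additive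
  identities need checking on exponentials only.\<close>

lemma char_induct [case_names exp add minus]:
  fixes P :: "'n::finite char_ring \<Rightarrow> bool"
  assumes e: "\<And>\<mu>. P (wt_exp \<mu>)" and a: "\<And>f g. \<lbrakk>P f; P g\<rbrakk> \<Longrightarrow> P (f + g)"
    and m: "\<And>f. P f \<Longrightarrow> P (- f)"
  shows "P g"
proof -
  have z: "P 0"
    using a[OF e m[OF e], of 0 0] by simp
  have nat: "P (Poly_Mapping.single \<mu> (int n))" for \<mu> n
  proof (induction n)
    case (Suc n)
    then show ?case
      using a[OF e[of \<mu>]] by (simp add: single_add)
  qed (simp add: z)
  have int: "P (Poly_Mapping.single \<mu> c)" for \<mu> c
  proof (cases "c \<ge> 0")
    case True
    then show ?thesis
      using nat[of \<mu> "nat c"] by simp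
  next
    case False
    then show ?thesis
      using m[OF nat[of \<mu> "nat (- c)"]] by (simp add: single_uminus)
  qed
  have "P (\<Sum>\<mu>\<in>A. Poly_Mapping.single \<mu> (Poly_Mapping.lookup g \<mu>))" for A
    by (induction A rule: infinite_finite_induct) (simp_all add: z a int)
  moreover have "(\<Sum>\<mu>\<in>Poly_Mapping.keys g. Poly_Mapping.single \<mu> (Poly_Mapping.lookup g \<mu>)) = g"
    by (rule poly_mapping_eqI) (auto simp: lookup_sum lookup_single when_def in_keys_iff)
  ultimately show ?thesis
    by metis
qed

definition lin_ext :: "('a \<Rightarrow> 'b::ring_1) \<Rightarrow> ('a \<Rightarrow>\<^sub>0 int) \<Rightarrow> 'b" where
  "lin_ext h g = (\<Sum>\<mu>\<in>Poly_Mapping.keys g. of_int (Poly_Mapping.lookup g \<mu>) * h \<mu>)"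

lemma lin_ext_superset:
  assumes "finite A" "Poly_Mapping.keys g \<subseteq> A"
  shows "lin_ext h g = (\<Sum>\<mu>\<in>A. of_int (Poly_Mapping.lookup g \<mu>) * h \<mu>)"
  unfolding lin_ext_def by (rule sum.mono_neutral_left) (use assms in \<open>auto simp: in_keys_iff\<close>)

lemma lin_ext_add: "lin_ext h (f + g) = lin_ext h f + lin_ext h g"
proof -
  let ?A = "Poly_Mapping.keys f \<union> Poly_Mapping.keys g"
  show ?thesis
    using Poly_Mapping.keys_add[of f g]
    by (simp add: lin_ext_superset[of ?A] lookup_add distrib_right sum.distrib)
qed

lemma lin_ext_minus: "lin_ext h (- g) = - lin_ext h g"
  by (simp add: lin_ext_def sum_negf keys_minus)

lemma lin_ext_diff: "lin_ext h (f - g) = lin_ext h f - lin_ext h g"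
  using lin_ext_add[of h f "- g"] by (simp add: lin_ext_minus)

lemma lin_ext_exp [simp]: "lin_ext h (wt_exp \<mu>) = h \<mu>"
  by (simp add: lin_ext_def)

lemma lin_ext_zero [simp]: "lin_ext h 0 = 0"
  by (simp add: lin_ext_def)

lemma lin_ext_sum: "lin_ext h (\<Sum>x\<in>A. f x) = (\<Sum>x\<in>A. lin_ext h (f x))"
  by (induction A rule: infinite_finite_induct) (simp_all add: lin_ext_add)

lemma wt_exp_mult: "wt_exp \<mu> * wt_exp \<nu> = wt_exp (\<mu> + \<nu>)"
  by (simp add: mult_single)

lemma lookup_mult_exp:
  "Poly_Mapping.lookup (g * wt_exp \<nu>) (\<mu> + \<nu>) = Poly_Mapping.lookup g \<mu>" for g :: "'n::finite char_ring"
  by (induction g rule: char_induct)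
     (simp_all add: wt_exp_mult lookup_single lookup_add distrib_right)

text \<open>An element killed by \<open>1 - e^{-\<beta>}\<close> is periodic under translation by
  \<open>\<beta>\<close>; if nonzero it would have infinite support.\<close>

lemma one_minus_exp_cancel:
  fixes f g :: "'n::finite char_ring"
  assumes "\<beta> \<noteq> 0" and "f * (1 - wt_exp (- \<beta>)) = g * (1 - wt_exp (- \<beta>))"
  shows "f = g"
proof (rule ccontr)
  assume "f \<noteq> g"
  define d where "d = f - g"
  have d: "d * wt_exp (- \<beta>) = d"
    using assms(2) by (simp add: d_def algebra_simps)
  obtain \<mu> where \<mu>: "Poly_Mapping.lookup d \<mu> \<noteq> 0"
    using \<open>f \<noteq> g\<close> by (metis d_def eq_iff_diff_eq_0 lookup_zero poly_mapping_eqI)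
  have "Poly_Mapping.lookup d (\<mu> + of_nat n *s \<beta>) \<noteq> 0" for n
  proof (induction n)
    case (Suc n)
    have "\<mu> + of_nat (Suc n) *s \<beta> + - \<beta> = \<mu> + of_nat n *s \<beta>"
      by (simp add: vec_eq_iff algebra_simps)
    then show ?case
      using lookup_mult_exp[of d "- \<beta>" "\<mu> + of_nat (Suc n) *s \<beta>"] Suc unfolding d by metis
  qed (use \<mu> in simp)
  then have "range (\<lambda>n. \<mu> + of_nat n *s \<beta>) \<subseteq> Poly_Mapping.keys d"
    by (auto simp: in_keys_iff)
  then have "finite (range (\<lambda>n. \<mu> + of_nat n *s \<beta>))"
    by (rule finite_subset) simp
  moreover have "inj (\<lambda>n. \<mu> + of_nat n *s \<beta>)"
  proof (rule injI)
    fix m n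
    assume "\<mu> + of_nat m *s \<beta> = \<mu> + of_nat n *s \<beta>"
    moreover obtain k where "\<beta> $ k \<noteq> 0"
      using assms(1) by (auto simp: vec_eq_iff)
    ultimately show "m = n"
      by (auto simp: vec_eq_iff)
  qed
  ultimately show False
    by (simp add: finite_image_iff)
qed

context simply_laced_datum
begin

lemma pairing_refl: "pairing (\<alpha>\<^sup>\<or> i) (refl i \<mu>) = - pairing (\<alpha>\<^sup>\<or> i) \<mu>"
  by (simp add: simple_reflection_def pairing_diff pairing_scale cartan_diag)

lemma string_sum:
  assumes "pairing (\<alpha>\<^sup>\<or> i) \<mu> = int n"
  shows "(\<Sum>a\<le>n. wt_exp (\<mu> - int a *s \<alpha> i)) * (1 - wt_exp (- \<alpha> i)) =
    wt_exp \<mu> - wt_exp (refl i \<mu> - \<alpha> i)"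
proof -
  have "(\<Sum>a\<le>m. wt_exp (\<mu> - int a *s \<alpha> i)) * (1 - wt_exp (- \<alpha> i)) =
      wt_exp \<mu> - wt_exp (\<mu> - int (Suc m) *s \<alpha> i)" for m
  proof (induction m)
    case (Suc m)
    have shift: "\<mu> - int (Suc m) *s \<alpha> i + - \<alpha> i = \<mu> - int (Suc (Suc m)) *s \<alpha> i"
      by (simp add: vec_eq_iff algebra_simps)
    show ?case
      unfolding sum.atMost_Suc distrib_right Suc by (simp only: right_diff_distrib wt_exp_mult shift) simp
  qed (simp add: right_diff_distrib wt_exp_mult)
  moreover have "\<mu> - int (Suc n) *s \<alpha> i = refl i \<mu> - \<alpha> i"
    using assms by (simp add: simple_reflection_def vec_eq_iff algebra_simps)
  ultimately show ?thesis
    by metis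
qed

lemma demazure_exp_unique:
  assumes "g * (1 - wt_exp (- \<alpha> i)) = wt_exp \<mu> - wt_exp (refl i \<mu> - \<alpha> i)"
  shows "demazure_exp D i \<mu> = g"
  unfolding demazure_exp_def
  by (rule the_equality, rule assms) (metis assms one_minus_exp_cancel root_nonzero)

lemma demazure_exp_string:
  "pairing (\<alpha>\<^sup>\<or> i) \<mu> = int n \<Longrightarrow> demazure_exp D i \<mu> = (\<Sum>a\<le>n. wt_exp (\<mu> - int a *s \<alpha> i))"
  by (rule demazure_exp_unique[OF string_sum])

lemma demazure_exp_eq:
  "demazure_exp D i \<mu> * (1 - wt_exp (- \<alpha> i)) = wt_exp \<mu> - wt_exp (refl i \<mu> - \<alpha> i)"
proof -
  let ?p = "pairing (\<alpha>\<^sup>\<or> i) \<mu>"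
  have "\<exists>g. g * (1 - wt_exp (- \<alpha> i)) = wt_exp \<mu> - wt_exp (refl i \<mu> - \<alpha> i)"
  proof -
    consider "?p \<ge> 0" | "?p = -1" | "?p \<le> -2"
      by linarith
    then show ?thesis
    proof cases
      case 1
      then show ?thesis
        using string_sum[of i \<mu> "nat ?p"] by auto
    next
      case 2
      then have "refl i \<mu> - \<alpha> i = \<mu>"
        by (simp add: simple_reflection_def vec_eq_iff)
      then show ?thesis
        by (intro exI[of _ 0]) simp
    next
      case 3
      \<comment> \<open>The map taking \<open>\<mu>\<close> to \<open>s_i \<mu> - \<alpha> i\<close>
        is an involution. It exchanges the two terms of the numerator and sends the pairing
        \<open>p\<close> to \<open>-p - 2\<close>, which reduces this case to the first one.\<close>
      let ?\<nu> = "refl i \<mu> - \<alpha> i"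
      have "pairing (\<alpha>\<^sup>\<or> i) ?\<nu> = int (nat (- ?p - 2))"
        using 3 by (simp add: pairing_diff pairing_refl cartan_diag)
      from string_sum[OF this]
      have "(- (\<Sum>a\<le>nat (- ?p - 2). wt_exp (?\<nu> - int a *s \<alpha> i))) * (1 - wt_exp (- \<alpha> i)) =
          - (wt_exp ?\<nu> - wt_exp (refl i ?\<nu> - \<alpha> i))"
        by (simp only: mult_minus_left)
      moreover have "refl i ?\<nu> - \<alpha> i = \<mu>"
        by (simp add: refl_diff refl_root_self)
      ultimately show ?thesis
        by (metis minus_diff_eq)
    qed
  qed
  then show ?thesis
    using demazure_exp_unique by metis
qed

lemma demazure_lin_ext: "demazure D i = lin_ext (demazure_exp D i)"
  by (simp add: demazure_def lin_ext_def fun_eq_iff)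

lemmas demazure_add = lin_ext_add[of "demazure_exp D _", folded demazure_lin_ext]
  and demazure_sum = lin_ext_sum[of "demazure_exp D _", folded demazure_lin_ext]
  and demazure_wt_exp = lin_ext_exp[of "demazure_exp D _", folded demazure_lin_ext]

section \<open>Idempotency and braid relations of the Demazure operators\<close>

definition act :: "'i \<Rightarrow> 'n char_ring \<Rightarrow> 'n char_ring" where
  "act i = lin_ext (\<lambda>\<mu>. wt_exp (refl i \<mu>))"

lemma act_exp [simp]: "act i (wt_exp \<mu>) = wt_exp (refl i \<mu>)"
  and act_add: "act i (f + g) = act i f + act i g"
  and act_minus: "act i (- g) = - act i g"
  and act_diff: "act i (f - g) = act i f - act i g"
  by (simp_all add: act_def lin_ext_add lin_ext_minus lin_ext_diff)

lemma act_one [simp]: "act i 1 = 1"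
  using act_exp[of i 0] by simp

lemma act_mult: "act i (f * g) = act i f * act i g"
proof (induction f rule: char_induct)
  case (exp \<mu>)
  show ?case
    by (induction g rule: char_induct)
       (simp_all add: wt_exp_mult refl_add act_add act_minus distrib_left)
qed (simp_all add: act_add act_minus distrib_right)

lemma act_act [simp]: "act i (act i g) = g"
  by (induction g rule: char_induct) (simp_all add: act_add act_minus)

lemma act_commute: "\<lbrakk>\<not> adjacent D i j; i \<noteq> j\<rbrakk> \<Longrightarrow> act i (act j g) = act j (act i g)"
  by (induction g rule: char_induct) (simp_all add: act_add act_minus refl_commute[of i j])

lemma act_braid: "adjacent D i j \<Longrightarrow> act i (act j (act i g)) = act j (act i (act j g))"
  by (induction g rule: char_induct) (simp_all add: act_add act_minus refl_braid[of i j])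

text \<open>A division-free description of the operator. The identities below are obtained by
  multiplying with such denominators, transporting by \<open>act\<close>, and cancelling with
  \<open>one_minus_exp_cancel\<close>.\<close>

lemma demazure_eq: "demazure D i g * (1 - wt_exp (- \<alpha> i)) = g - wt_exp (- \<alpha> i) * act i g"
proof (induction g rule: char_induct)
  case (exp \<mu>)
  show ?case
    by (simp add: demazure_wt_exp demazure_exp_eq wt_exp_mult)
next
  case (add f g)
  show ?case
    unfolding demazure_add act_add distrib_right add by (simp add: algebra_simps)
next
  case (minus f)
  then show ?case
    by (simp add: demazure_lin_ext lin_ext_minus act_minus algebra_simps)
qed

text \<open>Reflecting \<open>demazure_eq\<close> turns the denominator into
  \<open>1 - e^{\<alpha> i}\<close>, and multiplication by \<open>-e^{-\<alpha> i}\<close> restores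
  the original one; the numerator is restored at the same time.\<close>

lemma act_demazure: "act i (demazure D i g) = demazure D i g"
proof (rule one_minus_exp_cancel[OF root_nonzero])
  let ?x = "wt_exp (- \<alpha> i)" and ?x' = "wt_exp (\<alpha> i)"
  have x: "?x * ?x' = 1"
    by (simp add: wt_exp_mult)
  have "act i (demazure D i g * (1 - ?x)) = act i (g - ?x * act i g)"
    by (simp only: demazure_eq)
  then have "act i (demazure D i g) * (1 - ?x') = act i g - ?x' * g"
    by (simp add: act_mult act_diff refl_minus refl_root_self)
  moreover have "act i (demazure D i g) * (?x * ?x' - ?x) = - ?x * (act i (demazure D i g) * (1 - ?x'))"
    by (simp add: algebra_simps)
  ultimately have "act i (demazure D i g) * (?x * ?x' - ?x) = - ?x * (act i g - ?x' * g)"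
    by (simp only:)
  also have "\<dots> = ?x * ?x' * g - ?x * act i g"
    by (simp add: algebra_simps)
  finally have "act i (demazure D i g) * (?x * ?x' - ?x) = ?x * ?x' * g - ?x * act i g" .
  then have "act i (demazure D i g) * (1 - ?x) = g - ?x * act i g"
    by (simp only: x mult_1_left)
  then show "act i (demazure D i g) * (1 - ?x) = demazure D i g * (1 - ?x)"
    by (simp add: demazure_eq)
qed

lemma demazure_idem: "demazure D i (demazure D i g) = demazure D i g"
proof (rule one_minus_exp_cancel[OF root_nonzero])
  show "demazure D i (demazure D i g) * (1 - wt_exp (- \<alpha> i)) = demazure D i g * (1 - wt_exp (- \<alpha> i))"
    unfolding demazure_eq[of i "demazure D i g"] act_demazure by (simp add: algebra_simps)
qed

text \<open>After clearing both denominators, either side is the alternating sum over the four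
  products of the two commuting reflections, which is symmetric in \<open>i\<close> and
  \<open>j\<close>.\<close>

lemma demazure_commute:
  assumes "\<not> adjacent D i j" "i \<noteq> j"
  shows "demazure D i (demazure D j g) = demazure D j (demazure D i g)"
proof -
  have eq: "demazure D i (demazure D j g) * (1 - wt_exp (- \<alpha> i)) * (1 - wt_exp (- \<alpha> j)) =
      g - wt_exp (- \<alpha> i) * act i g - wt_exp (- \<alpha> j) * act j g
        + wt_exp (- \<alpha> i) * wt_exp (- \<alpha> j) * act i (act j g)"
    if ij: "\<not> adjacent D i j" "i \<noteq> j" for i j
  proof -
    have 1: "demazure D j g * (1 - wt_exp (- \<alpha> j)) = g - wt_exp (- \<alpha> j) * act j g"
      by (rule demazure_eq)
    have 2: "demazure D i (demazure D j g) * (1 - wt_exp (- \<alpha> i)) =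
        demazure D j g - wt_exp (- \<alpha> i) * act i (demazure D j g)"
      by (rule demazure_eq)
    have "act i (demazure D j g * (1 - wt_exp (- \<alpha> j))) = act i (g - wt_exp (- \<alpha> j) * act j g)"
      by (simp only: demazure_eq)
    then have 3: "act i (demazure D j g) * (1 - wt_exp (- \<alpha> j)) = act i g - wt_exp (- \<alpha> j) * act i (act j g)"
      by (simp add: act_mult act_diff refl_minus refl_root_nonadj ij)
    have "demazure D i (demazure D j g) * (1 - wt_exp (- \<alpha> i)) * (1 - wt_exp (- \<alpha> j)) =
        demazure D j g * (1 - wt_exp (- \<alpha> j))
          - wt_exp (- \<alpha> i) * (act i (demazure D j g) * (1 - wt_exp (- \<alpha> j)))"
      unfolding 2 by (simp add: left_diff_distrib mult.assoc)
    then show ?thesis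
      unfolding 1 3 by (simp add: right_diff_distrib mult.assoc)
  qed
  have ji: "\<not> adjacent D j i" "j \<noteq> i"
    using assms by (auto simp: adjacent_sym[of i j])
  have "demazure D i (demazure D j g) * (1 - wt_exp (- \<alpha> i)) * (1 - wt_exp (- \<alpha> j)) =
      demazure D j (demazure D i g) * (1 - wt_exp (- \<alpha> i)) * (1 - wt_exp (- \<alpha> j))"
  proof -
    have "demazure D i (demazure D j g) * (1 - wt_exp (- \<alpha> i)) * (1 - wt_exp (- \<alpha> j)) =
        demazure D j (demazure D i g) * (1 - wt_exp (- \<alpha> j)) * (1 - wt_exp (- \<alpha> i))"
      unfolding eq[OF assms] eq[OF ji] by (simp add: act_commute[OF assms] mult.commute algebra_simps)
    then show ?thesis
      by (simp only: mult_ac)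
  qed
  then show ?thesis
    by (metis one_minus_exp_cancel root_nonzero)
qed

text \<open>Clearing the denominators of the three positive roots of type A2 leaves the alternating
  sum over its six Weyl group elements, the numerator of a Weyl character formula. It is symmetric
  in \<open>i\<close> and \<open>j\<close> by the braid relation for \<open>act\<close>.\<close>

lemma demazure_braid:
  assumes "adjacent D i j"
  shows "demazure D i (demazure D j (demazure D i k)) = demazure D j (demazure D i (demazure D j k))"
proof -
  have eq: "demazure D i (demazure D j (demazure D i k)) *
      (1 - wt_exp (- \<alpha> i)) * (1 - wt_exp (- \<alpha> j)) * (1 - wt_exp (- (\<alpha> i + \<alpha> j))) =
      k - x * act i k - y * act j k + x * y ^ 2 * act j (act i k) + x ^ 2 * y * act i (act j k)
        - x ^ 2 * y ^ 2 * act i (act j (act i k))"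
    if ij: "adjacent D i j" and x: "x = wt_exp (- \<alpha> i)" and y: "y = wt_exp (- \<alpha> j)" for i j x y
  proof -
    have ji: "adjacent D j i"
      using ij by (simp add: adjacent_sym)
    have rji: "refl j (\<alpha> i) = \<alpha> i + \<alpha> j"
      using refl_root_adj[OF ji] by (simp add: add.commute)
    have xy: "wt_exp (- (\<alpha> i + \<alpha> j)) = x * y"
      by (simp add: x y wt_exp_mult)
    have sx: "act j x = x * y" and sy: "act i y = x * y" and sxy: "act i (x * y) = y"
      by (simp_all add: x y wt_exp_mult refl_minus refl_diff refl_root_adj ij rji refl_root_self)
    let ?g = "demazure D i k"
    let ?h = "demazure D j ?g"
    have 1: "?g * (1 - x) = k - x * act i k"
      unfolding x by (rule demazure_eq)
    have 2: "?h * (1 - y) = ?g - y * act j ?g"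
      unfolding y by (rule demazure_eq)
    have 3: "demazure D i ?h * (1 - x) = ?h - x * act i ?h"
      unfolding x by (rule demazure_eq)
    have "act j (?g * (1 - x)) = act j (k - x * act i k)"
      by (simp only: 1)
    then have 4: "act j ?g * (1 - x * y) = act j k - x * y * act j (act i k)"
      by (simp add: act_mult act_diff sx)
    have "act i (?h * (1 - y)) = act i (?g - y * act j ?g)"
      by (simp only: 2)
    then have 5: "act i ?h * (1 - x * y) = ?g - x * y * act i (act j ?g)"
      by (simp add: act_mult act_diff sy act_demazure)
    have "act i (act j ?g * (1 - x * y)) = act i (act j k - x * y * act j (act i k))"
      by (simp only: 4)
    then have 6: "act i (act j ?g) * (1 - y) = act i (act j k) - y * act i (act j (act i k))"
      by (simp only: act_mult[of i "x * y"] act_mult[of i "act j ?g"] act_diff sxy act_one)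
    have "demazure D i ?h * (1 - x) * (1 - y) * (1 - x * y) =
        (1 - x * y) * (?h * (1 - y)) - x * (1 - y) * (act i ?h * (1 - x * y))"
      unfolding 3 by (simp add: algebra_simps)
    also have "\<dots> = ?g * (1 - x) - y * (act j ?g * (1 - x * y)) + x ^ 2 * y * (act i (act j ?g) * (1 - y))"
      unfolding 2 5 by (simp add: algebra_simps power2_eq_square)
    also have "\<dots> = k - x * act i k - y * act j k + x * y ^ 2 * act j (act i k) + x ^ 2 * y * act i (act j k)
        - x ^ 2 * y ^ 2 * act i (act j (act i k))"
      unfolding 1 4 6 by (simp add: algebra_simps power2_eq_square)
    finally show ?thesis
      by (simp only: xy x y)
  qed
  have "demazure D i (demazure D j (demazure D i k)) *
      (1 - wt_exp (- \<alpha> i)) * (1 - wt_exp (- \<alpha> j)) * (1 - wt_exp (- (\<alpha> i + \<alpha> j))) =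
    demazure D j (demazure D i (demazure D j k)) *
      (1 - wt_exp (- \<alpha> i)) * (1 - wt_exp (- \<alpha> j)) * (1 - wt_exp (- (\<alpha> i + \<alpha> j)))"
  proof -
    have ji: "adjacent D j i"
      using assms by (simp add: adjacent_sym)
    have "demazure D i (demazure D j (demazure D i k)) *
        (1 - wt_exp (- \<alpha> i)) * (1 - wt_exp (- \<alpha> j)) * (1 - wt_exp (- (\<alpha> i + \<alpha> j))) =
      demazure D j (demazure D i (demazure D j k)) *
        (1 - wt_exp (- \<alpha> j)) * (1 - wt_exp (- \<alpha> i)) * (1 - wt_exp (- (\<alpha> j + \<alpha> i)))"
      unfolding eq[OF assms HOL.refl HOL.refl] eq[OF ji HOL.refl HOL.refl] act_braid[OF assms]
      by (simp add: algebra_simps)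
    then show ?thesis
      by (simp only: mult_ac add.commute)
  qed
  moreover have "\<alpha> i + \<alpha> j \<noteq> 0"
    using refl_root_adj[OF assms] root_nonzero[of j] by (metis refl_refl refl_zero)
  ultimately show ?thesis
    by (metis one_minus_exp_cancel root_nonzero)
qed

lemma demazure_weyl_absorb:
  assumes w: "longest_element D w"
  shows "demazure_weyl D w (demazure D i g) = demazure_weyl D w g"
proof -
  have "\<exists>is. reduced_word D w is"
    using assms reduced_word_exists by (metis longest_element_def)
  then have "reduced_word D w (SOME is. reduced_word D w is)"
    by (rule someI_ex)
  moreover have "foldr (demazure D) is (demazure D i g) = foldr (demazure D) is g"
    if "reduced_word D w is" for "is"
    using that
  proof (intro longest_foldr_absorb[of "demazure D", where w = w] demazure_idem)
    show "demazure D i \<circ> demazure D j = demazure D j \<circ> demazure D i" if "\<not> adjacent D i j" "i \<noteq> j" for i j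
      using demazure_commute[OF that] by (simp add: fun_eq_iff)
    show "demazure D i \<circ> demazure D j \<circ> demazure D i = demazure D j \<circ> demazure D i \<circ> demazure D j"
      if "adjacent D i j" for i j
      using demazure_braid[OF that] by (simp add: fun_eq_iff)
  qed (simp_all add: w)
  ultimately show ?thesis
    by (simp add: demazure_weyl_def)
qed

lemma demazure_weyl_fixed:
  assumes "\<And>i. demazure D i g = g"
  shows "demazure_weyl D w g = g"
proof -
  have "foldr (demazure D) is g = g" for "is"
    by (induction "is") (simp_all add: assms)
  then show ?thesis
    by (simp add: demazure_weyl_def)
qed

end

section \<open>Submodules of injective hulls over the preprojective algebra\<close>

text \<open>
  Vector spaces over the field with two elements are handled as sets closed under addition,
  and dimensions as cardinalities.
\<close>

type_synonym 'i path_fun = "'i list \<Rightarrow> bit"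

lemma path_fun_add_self [simp]: "f + f = 0" for f :: "'i path_fun"
  by (simp add: fun_eq_iff)

lemma path_fun_add_cancel [simp]: "f + (f + g) = g" for f :: "'i path_fun"
  by (simp add: add.assoc[symmetric])

definition add_closed :: "'i path_fun set \<Rightarrow> bool" where
  "add_closed V \<longleftrightarrow> 0 \<in> V \<and> (\<forall>f\<in>V. \<forall>g\<in>V. f + g \<in> V)"

lemma add_closed_sum:
  assumes "add_closed V" "\<And>a. a \<in> A \<Longrightarrow> F a \<in> V"
  shows "sum F A \<in> V"
  using assms by (induction A rule: infinite_finite_induct) (auto simp: add_closed_def)

lemma add_closed_extend:
  assumes V: "add_closed V" and "finite V" and f: "f \<notin> V"
  shows "add_closed (V \<union> (+) f ` V)" and "card (V \<union> (+) f ` V) = 2 * card V"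
proof -
  show "add_closed (V \<union> (+) f ` V)"
    unfolding add_closed_def
  proof (intro conjI ballI)
    show "0 \<in> V \<union> (+) f ` V"
      using V by (simp add: add_closed_def)
  next
    have add: "a + b \<in> V" if "a \<in> V" "b \<in> V" for a b
      using that V by (simp add: add_closed_def)
    fix a b
    assume "a \<in> V \<union> (+) f ` V" "b \<in> V \<union> (+) f ` V"
    then consider "a \<in> V" "b \<in> V" | a' where "a' \<in> V" "a = f + a'" "b \<in> V"
      | b' where "a \<in> V" "b' \<in> V" "b = f + b'"
      | a' b' where "a' \<in> V" "a = f + a'" "b' \<in> V" "b = f + b'"
      by blast
    then show "a + b \<in> V \<union> (+) f ` V"
    proof cases
      case 1
      then show ?thesis
        by (intro UnI1 add)
    next
      case (2 a')
      have "a + b = f + (a' + b)"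
        unfolding 2 by (rule add.assoc)
      with 2 show ?thesis
        by (metis UnI2 add imageI)
    next
      case (3 b')
      have "a + b = f + (a + b')"
        unfolding 3 by (rule add.left_commute)
      with 3 show ?thesis
        by (metis UnI2 add imageI)
    next
      case (4 a' b')
      have "a + b = a' + b'"
        unfolding 4 by (simp only: add.assoc add.left_commute[of a'] path_fun_add_cancel)
      with 4 show ?thesis
        by (metis UnI1 add)
    qed
  qed
  have "V \<inter> (+) f ` V = {}"
  proof -
    have "f \<in> V" if "f + g \<in> V" "g \<in> V" for g
    proof -
      have "f = (f + g) + g"
        by (simp add: add.assoc)
      also have "\<dots> \<in> V"
        using that V unfolding add_closed_def by blast
      finally show ?thesis .
    qed
    with f show ?thesis
      by auto
  qed
  moreover have "card ((+) f ` V) = card V"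
    by (rule card_image) simp
  ultimately show "card (V \<union> (+) f ` V) = 2 * card V"
    using \<open>finite V\<close> by (simp add: card_Un_disjoint)
qed

text \<open>Over two elements a maximal proper subspace above \<open>U\<close> has index two, since
  adjoining any single vector outside it already gives \<open>V\<close>.\<close>

lemma add_closed_hyperplane:
  assumes V: "add_closed V" "finite V" and U: "add_closed U" "U \<subset> V"
  obtains H where "add_closed H" "U \<subseteq> H" "H \<subseteq> V" "card V = 2 * card H"
proof -
  define A where "A = {H. add_closed H \<and> U \<subseteq> H \<and> H \<subset> V}"
  have "finite A"
    by (rule finite_subset[of _ "Pow V"]) (use V in \<open>auto simp: A_def\<close>)
  moreover have "U \<in> A"
    using U by (simp add: A_def)
  ultimately have "\<exists>H\<in>A. U \<le> H \<and> (\<forall>K\<in>A. H \<le> K \<longrightarrow> H = K)"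
    by (rule finite_has_maximal2)
  then obtain H where "H \<in> A" and max: "\<And>K. \<lbrakk>K \<in> A; H \<subseteq> K\<rbrakk> \<Longrightarrow> H = K"
    by metis
  then have H: "add_closed H" "U \<subseteq> H" "H \<subset> V"
    by (simp_all add: A_def)
  from H obtain f where f: "f \<in> V" "f \<notin> H"
    by blast
  let ?K = "H \<union> (+) f ` H"
  have "finite H"
    by (rule finite_subset[OF psubset_imp_subset[OF H(3)] V(2)])
  note K = add_closed_extend[OF H(1) this f(2)]
  have "f + 0 \<in> (+) f ` H"
    using H(1) unfolding add_closed_def by blast
  then have "f \<in> ?K"
    by simp
  have "f + g \<in> V" if "g \<in> H" for g
    using H f(1) V(1) that unfolding add_closed_def by blast
  then have "?K \<subseteq> V"
    using H by auto
  have "?K = V"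
  proof (rule ccontr)
    assume "?K \<noteq> V"
    with \<open>?K \<subseteq> V\<close> K(1) H have "?K \<in> A"
      unfolding A_def by blast
    then have "H = ?K"
      by (rule max) blast
    with \<open>f \<in> ?K\<close> f(2) show False
      by blast
  qed
  then have "card V = 2 * card H"
    using K(2) by (simp only:)
  moreover have "H \<subseteq> V" "U \<subseteq> H" "add_closed H"
    using H by blast+
  ultimately show ?thesis
    by (intro that)
qed

text \<open>Rank-nullity: the nonempty fibres of \<open>T\<close> are translates of the
  kernel.\<close>

lemma card_kernel_image:
  assumes V: "add_closed V" "finite V" and T: "\<And>f g. T (f + g) = T f + (T g :: 'j path_fun)"
  shows "card V = card {f \<in> V. T f = 0} * card (T ` V)"
proof -
  let ?K = "{f \<in> V. T f = 0}"
  have "card {f \<in> V. T f = h} = card ?K" if h: "h \<in> T ` V" for h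
  proof -
    obtain g where g: "g \<in> V" "h = T g"
      using h by (rule imageE)
    have "bij_betw ((+) g) ?K {f \<in> V. T f = h}"
      by (rule bij_betw_byWitness[where f' = "(+) g"]) (use g V T in \<open>auto simp: add_closed_def\<close>)
    from bij_betw_same_card[OF this] show ?thesis
      by (rule sym)
  qed
  moreover have "card V = (\<Sum>h\<in>T ` V. card {f \<in> V. T f = h})"
    using sum.image_gen[OF V(2), of "\<lambda>_. 1" T] by (simp only: card_eq_sum)
  ultimately show ?thesis
    by simp
qed


text \<open>The action of the arrow into \<open>j\<close>: a path is the list of the vertices
  visited after its start.\<close>

definition shift :: "'i \<Rightarrow> 'i path_fun \<Rightarrow> 'i path_fun" where
  "shift j f = (\<lambda>xs. f (j # xs))"

lemma shift_add: "shift j (f + g) = shift j f + shift j g"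
  and shift_zero [simp]: "shift j 0 = 0"
  by (simp_all add: shift_def fun_eq_iff del: add_bit_eq_xor)

text \<open>Inverse to recording the value at the empty path together with the images under all
  arrows; it identifies the middle terms below with products.\<close>

definition splice_fun :: "bit \<Rightarrow> ('i \<Rightarrow> 'i path_fun) \<Rightarrow> 'i path_fun" where
  "splice_fun w g = (\<lambda>xs. case xs of [] \<Rightarrow> w | j # ys \<Rightarrow> g j ys)"

lemma splice_fun_Nil [simp]: "splice_fun w g [] = w"
  and shift_splice_fun [simp]: "shift j (splice_fun w g) = g j"
  and splice_fun_shift: "splice_fun (f []) (\<lambda>j. shift j f) = f"
  by (simp_all add: splice_fun_def shift_def fun_eq_iff split: list.split)

section \<open>Mesh complexes and moves\<close>

context simply_laced_datum
begin

text \<open>The exponent of \<open>y_{i,l}\<close> in the monomial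
  \<open>y_R z_S^{-1}\<close>.\<close>

definition expo_mset :: "('i \<times> int) multiset \<Rightarrow> ('i \<times> int) multiset \<Rightarrow> 'i \<Rightarrow> int \<Rightarrow> int" where
  "expo_mset R S i l = int (count R (i, l)) - int (count S (i, l)) - int (count S (i, l - 2))
     + (\<Sum>j | adjacent D i j. int (count S (j, l - 1)))"

text \<open>The preprojective relation at \<open>i\<close>, a sum over round trips through the
  neighbours; in characteristic two it needs no signs.\<close>

definition mesh :: "'i \<Rightarrow> 'i path_fun \<Rightarrow> 'i path_fun" where
  "mesh i f = (\<Sum>j | adjacent D i j. shift i (shift j f))"

text \<open>
  The middle term of the complex \<open>V(i,k) \<rightarrow> \<Oplus> V(j,k+1) \<oplus> W(i,k+2) \<rightarrow> V(i,k+2)\<close>, where \<open>W\<close> is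
  one-dimensional and sits at \<open>x\<close>.
\<close>

definition middle :: "'i \<times> int \<Rightarrow> ('i \<times> int \<Rightarrow> 'i path_fun set) \<Rightarrow> 'i \<Rightarrow> int \<Rightarrow> 'i path_fun set"
  where
  "middle x V i k = {f. (f [] \<noteq> 0 \<longrightarrow> (i, k + 2) = x) \<and>
     (\<forall>j. shift j f \<in> (if adjacent D i j then V (j, k + 1) else {0}))}"

text \<open>
  Submodules, of dimension vector \<open>S\<close>, of the injective hull of the simple module at \<open>x\<close> over the
  \<open>\<int>\<close>-cover of the preprojective algebra; an element is the function that records its images in
  the socle along all paths.
\<close>

definition path_module :: "'i \<times> int \<Rightarrow> ('i \<times> int \<Rightarrow> 'i path_fun set) \<Rightarrow> ('i \<times> int) multiset \<Rightarrow> bool"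
  where
  "path_module x V S \<longleftrightarrow> (\<forall>y. add_closed (V y) \<and> card (V y) = 2 ^ count S y) \<and>
     (\<forall>i k. V (i, k) \<subseteq> {f \<in> middle x V i k. mesh i f = 0}) \<and>
     set_mset S \<subseteq> parity_vertices D \<and> (\<forall>y\<in>#S. snd y < snd x)"

lemma path_moduleD:
  assumes "path_module x V S"
  shows "add_closed (V y)" and "card (V y) = 2 ^ count S y"
    and "V (i, k) \<subseteq> {f \<in> middle x V i k. mesh i f = 0}"
    and "set_mset S \<subseteq> parity_vertices D" and "y \<in># S \<Longrightarrow> snd y < snd x"
  using assms unfolding path_module_def by blast+

lemma mesh_add: "mesh i (f + g) = mesh i f + mesh i g"
  by (simp add: mesh_def shift_add sum.distrib)

lemma mesh_zero [simp]: "mesh i 0 = 0"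
  by (simp add: mesh_def)

lemma add_closed_middle: "(\<And>y. add_closed (V y)) \<Longrightarrow> add_closed (middle x V i k)"
  by (auto simp: add_closed_def middle_def shift_add)

lemma add_closed_mesh_image:
  assumes "\<And>y. add_closed (V y)"
  shows "add_closed (mesh i ` middle x V i k)"
proof -
  have mid: "add_closed (middle x V i k)"
    by (rule add_closed_middle[OF assms])
  have "mesh i 0 \<in> mesh i ` middle x V i k"
    using mid by (intro imageI) (simp only: add_closed_def)
  moreover have "a + b \<in> mesh i ` middle x V i k"
    if ab: "a \<in> mesh i ` middle x V i k" "b \<in> mesh i ` middle x V i k" for a b
  proof -
    obtain f g where "f \<in> middle x V i k" "g \<in> middle x V i k" and eq: "a = mesh i f" "b = mesh i g"
      using ab by (elim imageE)
    with mid have "f + g \<in> middle x V i k"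
      unfolding add_closed_def by blast
    then show ?thesis
      unfolding eq mesh_add[symmetric] by (rule imageI)
  qed
  ultimately show ?thesis
    by (simp only: add_closed_def mesh_zero) blast
qed

lemma middle_mono: "(\<And>y. V y \<subseteq> V' y) \<Longrightarrow> middle x V i k \<subseteq> middle x V' i k"
proof
  fix f
  assume mono: "\<And>y. V y \<subseteq> V' y" and "f \<in> middle x V i k"
  then have nil: "f [] \<noteq> 0 \<longrightarrow> (i, k + 2) = x"
    and sub: "shift j f \<in> (if adjacent D i j then V (j, k + 1) else {0})" for j
    unfolding middle_def by simp_all
  have "shift j f \<in> (if adjacent D i j then V' (j, k + 1) else {0})" for j
    using sub[of j] mono[of "(j, k + 1)"] by (auto split: if_splits)
  with nil show "f \<in> middle x V' i k"
    unfolding middle_def by simp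
qed

lemma card_middle:
  assumes "\<And>y. card (V y) = 2 ^ count S y"
  shows "card (middle x V i k) =
    2 ^ (count {#x#} (i, k + 2) + (\<Sum>j | adjacent D i j. count S (j, k + 1)))"
proof -
  let ?W = "if (i, k + 2) = x then UNIV else {0 :: bit}"
  let ?G = "\<lambda>j. if adjacent D i j then V (j, k + 1) else {0}"
  have "bij_betw (\<lambda>(w, g). splice_fun w g) (?W \<times> PiE UNIV ?G) (middle x V i k)"
    by (rule bij_betw_byWitness[where f' = "\<lambda>f. (f [], \<lambda>j. shift j f)"])
       (auto simp: middle_def PiE_iff splice_fun_shift split: if_splits)
  then have "card (middle x V i k) = card (?W \<times> PiE UNIV ?G)"
    by (simp add: bij_betw_same_card)
  also have "\<dots> = card ?W * (\<Prod>j\<in>UNIV. card (?G j))"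
    by (simp add: card_cartesian_product card_PiE)
  also have "card ?W = 2 ^ count {#x#} (i, k + 2)"
  proof -
    have "(UNIV :: bit set) = {0, 1}"
      by (auto simp: bit_not_one_iff)
    then have "CARD(bit) = card {0, 1 :: bit}"
      by (rule arg_cong)
    then show ?thesis
      by simp
  qed
  also have "(\<Prod>j\<in>UNIV. card (?G j)) = (\<Prod>j | adjacent D i j. 2 ^ count S (j, k + 1))"
    by (rule prod.mono_neutral_cong_right) (auto simp: assms)
  finally show ?thesis
    by (simp add: power_add power_sum)
qed

lemma mesh_image:
  assumes "path_module x V S"
  shows "mesh i ` middle x V i k \<subseteq> V (i, k + 2)"
proof -
  have "shift i (shift j f) \<in> V (i, k + 2)" if "f \<in> middle x V i k" "adjacent D i j" for f j
  proof -
    have "shift j f \<in> V (j, k + 1)"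
      using that by (auto simp: middle_def split: if_splits)
    then have "shift j f \<in> middle x V j (k + 1)"
      using path_moduleD(3)[OF assms] by blast
    then have "shift i (shift j f) \<in> V (i, k + 1 + 1)"
      using that(2) adjacent_sym[of j i] unfolding middle_def by (auto dest: spec[of _ i])
    then show ?thesis
      by (simp add: add.assoc)
  qed
  then show ?thesis
    using path_moduleD(1)[OF assms] by (auto simp: mesh_def intro!: add_closed_sum)
qed

text \<open>Read through \<open>card_middle\<close>, this is the dimension of the middle term minus
  the dimensions of \<open>V (i, k)\<close> and \<open>V (i, k + 2)\<close>.\<close>

lemma expo_mset_add2:
  "expo_mset {#x#} S i (k + 2) =
    int (count {#x#} (i, k + 2) + (\<Sum>j | adjacent D i j. count S (j, k + 1)))
      - int (count S (i, k) + count S (i, k + 2))"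
  by (simp add: expo_mset_def add.commute[of 1 k])

lemma middle_rank:
  assumes "path_module x V S"
  shows "2 ^ (count {#x#} (i, k + 2) + (\<Sum>j | adjacent D i j. count S (j, k + 1))) =
    card {f \<in> middle x V i k. mesh i f = 0} * card (mesh i ` middle x V i k)"
    and "finite (middle x V i k)"
proof -
  note closed = path_moduleD(1)[OF assms] and card = path_moduleD(2)[OF assms]
  \<comment> \<open>An infinite set has \<open>card\<close> 0, which is not a power of two, so the
    cardinality formula already yields finiteness.\<close>
  show "finite (middle x V i k)"
    using card_middle[OF card, of x i k] by (metis card.infinite power_not_zero zero_neq_numeral)
  from card_kernel_image[OF add_closed_middle[OF closed] this, of "mesh i"]
  show "2 ^ (count {#x#} (i, k + 2) + (\<Sum>j | adjacent D i j. count S (j, k + 1))) =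
    card {f \<in> middle x V i k. mesh i f = 0} * card (mesh i ` middle x V i k)"
    by (simp only: mesh_add card_middle[OF card])
qed

lemma finite_path_module: "path_module x V S \<Longrightarrow> finite (V y)"
  unfolding path_module_def by (metis card.infinite power_not_zero zero_neq_numeral)

text \<open>The mesh map has its image in \<open>V (i, k + 2)\<close>, so a positive exponent makes
  its kernel larger than \<open>V (i, k)\<close>. A kernel element outside \<open>V (i, k)\<close>
  can be adjoined there: its images under the arrows already lie in the module.\<close>

lemma path_module_grow:
  assumes V: "path_module x V S" and x: "x \<in> parity_vertices D" and pos: "expo_mset {#x#} S i (k + 2) > 0"
  shows "\<exists>V. path_module x V (add_mset (i, k) S)"
proof -
  let ?K = "{f \<in> middle x V i k. mesh i f = 0}"
  let ?n = "count {#x#} (i, k + 2) + (\<Sum>j | adjacent D i j. count S (j, k + 1))"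
  note closed = path_moduleD(1)[OF V] and card = path_moduleD(2)[OF V]
    and sub = path_moduleD(3)[OF V]
  have "card (mesh i ` middle x V i k) \<le> 2 ^ count S (i, k + 2)"
    unfolding card[symmetric] by (rule card_mono[OF finite_path_module[OF V] mesh_image[OF V]])
  then have "2 ^ ?n \<le> card ?K * 2 ^ count S (i, k + 2)"
    unfolding middle_rank(1)[OF V] by simp
  moreover have "(2::nat) ^ (count S (i, k) + count S (i, k + 2)) < 2 ^ ?n"
    using pos unfolding expo_mset_add2 by (intro power_strict_increasing) linarith+
  ultimately have "2 ^ (count S (i, k) + count S (i, k + 2)) < card ?K * 2 ^ count S (i, k + 2)"
    by (rule less_le_trans[rotated])
  then have "card (V (i, k)) < card ?K"
    unfolding power_add card by (simp only: mult_less_cancel2)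
  then have "\<not> ?K \<subseteq> V (i, k)"
    using card_mono[OF finite_path_module[OF V]] by (meson leD)
  then obtain f where f: "f \<in> ?K" "f \<notin> V (i, k)"
    by blast
  define V' where "V' = V((i, k) := V (i, k) \<union> (+) f ` V (i, k))"
  note ext = add_closed_extend[OF closed finite_path_module[OF V] f(2)]
  have "add_closed (V' y)" "card (V' y) = 2 ^ count (add_mset (i, k) S) y" for y
    using ext closed card by (auto simp: V'_def)
  moreover have "V' (j, l) \<subseteq> {f \<in> middle x V' j l. mesh j f = 0}" for j l
  proof -
    have "add_closed ?K"
      using add_closed_middle[of V x i k, OF closed] by (auto simp: add_closed_def mesh_add)
    with sub f(1) have "f + g \<in> ?K" if "g \<in> V (i, k)" for g
      using that unfolding add_closed_def by blast
    with sub have "V' (j, l) \<subseteq> {f \<in> middle x V j l. mesh j f = 0}"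
      unfolding V'_def by auto
    moreover have "middle x V j l \<subseteq> middle x V' j l"
      by (rule middle_mono) (auto simp: V'_def)
    ultimately show ?thesis
      by blast
  qed
  \<comment> \<open>The middle term is nonzero, so it involves \<open>x\<close> itself or a
    neighbour at level \<open>k + 1\<close> in \<open>S\<close>; either one fixes the parity and
    bounds the level.\<close>
  moreover have "(i, k) \<in> parity_vertices D \<and> k < snd x"
  proof (cases "(i, k + 2) = x")
    case True
    with x show ?thesis
      by (auto simp: parity_vertices_def)
  next
    case False
    have "\<exists>j. adjacent D i j \<and> count S (j, k + 1) \<noteq> 0"
    proof (rule ccontr)
      assume "\<not> ?thesis"
      then have "(\<Sum>j | adjacent D i j. count S (j, k + 1)) = 0"
        by (simp add: count_eq_zero_iff)
      with False pos show False
        unfolding expo_mset_add2 by simp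
    qed
    then obtain j where "adjacent D i j" "(j, k + 1) \<in># S"
      by (auto simp: count_eq_zero_iff)
    moreover from this V have "(j, k + 1) \<in> parity_vertices D" "k + 1 < snd x"
      by (auto simp: path_module_def)
    ultimately show ?thesis
      using two_colouring[of i j] by (auto simp: parity_vertices_def)
  qed
  ultimately have "path_module x V' (add_mset (i, k) S)"
    using V by (auto simp: path_module_def)
  then show ?thesis
    by blast
qed

text \<open>Dually, the kernel contains \<open>V (i, k)\<close>, so a negative exponent makes the
  image of the mesh map a proper subspace of \<open>V (i, k + 2)\<close>. A hyperplane containing
  the image can replace \<open>V (i, k + 2)\<close>.\<close>

lemma path_module_shrink:
  assumes V: "path_module x V S" and neg: "expo_mset {#x#} S i (k + 2) < 0"
  shows "(i, k + 2) \<in># S" and "\<exists>V. path_module x V (S - {#(i, k + 2)#})"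
proof -
  let ?K = "{f \<in> middle x V i k. mesh i f = 0}" and ?U = "mesh i ` middle x V i k"
  let ?n = "count {#x#} (i, k + 2) + (\<Sum>j | adjacent D i j. count S (j, k + 1))"
  note closed = path_moduleD(1)[OF V] and card = path_moduleD(2)[OF V]
    and sub = path_moduleD(3)[OF V]
  have "2 ^ count S (i, k) \<le> card ?K"
    unfolding card[symmetric] by (rule card_mono[OF _ sub]) (use middle_rank(2)[OF V] in simp)
  then have "2 ^ count S (i, k) * card ?U \<le> 2 ^ ?n"
    unfolding middle_rank(1)[OF V] by simp
  moreover have "(2::nat) ^ ?n < 2 ^ (count S (i, k) + count S (i, k + 2))"
    using neg unfolding expo_mset_add2 by (intro power_strict_increasing) linarith+
  ultimately have "2 ^ count S (i, k) * card ?U < 2 ^ count S (i, k) * card (V (i, k + 2))"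
    by (simp only: card power_add)
  then have "?U \<subset> V (i, k + 2)"
    using mesh_image[OF V, of i k] by auto
  moreover have "add_closed ?U"
    by (rule add_closed_mesh_image[OF closed])
  ultimately obtain H where H: "add_closed H" "?U \<subseteq> H" "H \<subseteq> V (i, k + 2)" "card (V (i, k + 2)) = 2 * card H"
    using add_closed_hyperplane[OF closed finite_path_module[OF V]] by metis
  \<comment> \<open>A space with twice as many elements as its hyperplane is not of dimension
    0.\<close>
  then have "odd (2 ^ count S (i, k + 2) :: nat) = False"
    by (simp add: card)
  then show mem: "(i, k + 2) \<in># S"
    by (cases "count S (i, k + 2) = 0") (simp_all add: not_in_iff)
  define V' where "V' = V((i, k + 2) := H)"
  have mono: "V' y \<subseteq> V y" for y
    using H(3) by (simp add: V'_def)
  have "add_closed (V' y)" for y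
    using H closed by (auto simp: V'_def)
  moreover have "card (V' y) = 2 ^ count (S - {#(i, k + 2)#}) y" for y
  proof (cases "y = (i, k + 2)")
    case True
    have "count S y = Suc (count (S - {#(i, k + 2)#}) y)"
      using mem True by simp
    with H(4) card[of y] True have "2 * card H = 2 ^ Suc (count (S - {#(i, k + 2)#}) y)"
      by metis
    with True show ?thesis
      by (simp add: V'_def)
  next
    case False
    then show ?thesis
      by (simp add: V'_def card)
  qed
  moreover have "V' (j, l) \<subseteq> {f \<in> middle x V' j l. mesh j f = 0}" for j l
  proof
    fix f
    assume "f \<in> V' (j, l)"
    then have f: "f \<in> V (j, l)"
      using mono by blast
    then have mid: "f \<in> middle x V j l" and "mesh j f = 0"
      using sub by auto
    moreover have "shift i f \<in> H" if "adjacent D j i" "l = k + 1"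
    proof -
      \<comment> \<open>The tuple whose only component is \<open>f\<close> at \<open>j\<close>. The
        mesh map sends it to \<open>shift i f\<close>, so every arrow into \<open>(i, k + 2)\<close>
        lands in the image, hence in \<open>H\<close>.\<close>
      let ?F = "splice_fun 0 (\<lambda>j'. if j' = j then f else 0)"
      have "?F \<in> middle x V i k"
        using f that closed by (auto simp: middle_def add_closed_def adjacent_sym[of i j])
      moreover have "mesh i ?F = (\<Sum>j' | adjacent D i j'. if j' = j then shift i f else 0)"
        unfolding mesh_def by (intro sum.cong) (auto simp: shift_def fun_eq_iff splice_fun_def)
      moreover have "\<dots> = shift i f"
        by (subst sum.delta) (simp_all add: adjacent_sym[of i j] that(1))
      ultimately have "shift i f \<in> mesh i ` middle x V i k"
        by (metis imageI)
      with H(2) show ?thesis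
        by (rule subsetD)
    qed
    ultimately show "f \<in> {f \<in> middle x V' j l. mesh j f = 0}"
      by (auto simp: middle_def V'_def split: if_splits)
  qed
  moreover have "set_mset (S - {#(i, k + 2)#}) \<subseteq> set_mset S"
    by (auto dest: in_diffD)
  ultimately have "path_module x V' (S - {#(i, k + 2)#})"
    using V unfolding path_module_def by blast
  then show "\<exists>V. path_module x V (S - {#(i, k + 2)#})"
    by blast
qed

text \<open>
  For the monomial \<open>y\<^sub>R z\<^sub>S\<^sup>-\<^sup>1\<close>, closure under multiplication by \<open>z\<^bsub>i,k\<^esub>\<^sup>-\<^sup>1\<close> whenever the exponent of
  \<open>y\<^bsub>i,k+2\<^esub>\<close> is positive, and by \<open>z\<^bsub>i,l\<^esub>\<close> whenever the exponent of \<open>y\<^bsub>i,l\<^esub>\<close> is negative.  Unlike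
  closure under the crystal operators this passes to products.
\<close>

definition move_closed :: "('i \<times> int) multiset \<Rightarrow> ('i \<times> int) multiset set \<Rightarrow> bool" where
  "move_closed R H \<longleftrightarrow> {#} \<in> H \<and> (\<forall>S\<in>H. set_mset S \<subseteq> parity_vertices D \<and>
     (\<forall>y\<in>#S. \<exists>x\<in>#R. snd y < snd x) \<and>
     (\<forall>i k. expo_mset R S i (k + 2) > 0 \<longrightarrow> add_mset (i, k) S \<in> H) \<and>
     (\<forall>i l. expo_mset R S i l < 0 \<longrightarrow> (i, l) \<in># S \<and> S - {#(i, l)#} \<in> H))"

lemma move_closedD:
  assumes "move_closed R H"
  shows "{#} \<in> H"
    and "S \<in> H \<Longrightarrow> set_mset S \<subseteq> parity_vertices D"
    and "\<lbrakk>S \<in> H; y \<in># S\<rbrakk> \<Longrightarrow> \<exists>x\<in>#R. snd y < snd x"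
    and "\<lbrakk>S \<in> H; expo_mset R S i (k + 2) > 0\<rbrakk> \<Longrightarrow> add_mset (i, k) S \<in> H"
    and "\<lbrakk>S \<in> H; expo_mset R S i l < 0\<rbrakk> \<Longrightarrow> (i, l) \<in># S"
    and "\<lbrakk>S \<in> H; expo_mset R S i l < 0\<rbrakk> \<Longrightarrow> S - {#(i, l)#} \<in> H"
  using assms unfolding move_closed_def by blast+

lemma move_closed_single:
  assumes "x \<in> parity_vertices D"
  shows "move_closed {#x#} {S. \<exists>V. path_module x V S}"
proof -
  let ?H = "{S. \<exists>V. path_module x V S}"
  have "path_module x (\<lambda>_. {0}) {#}"
    by (auto simp: path_module_def add_closed_def middle_def mesh_def)
  moreover have "set_mset S \<subseteq> parity_vertices D \<and> (\<forall>y\<in>#S. \<exists>x\<in>#{#x#}. snd y < snd x) \<and>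
      (\<forall>i k. expo_mset {#x#} S i (k + 2) > 0 \<longrightarrow> add_mset (i, k) S \<in> ?H) \<and>
      (\<forall>i l. expo_mset {#x#} S i l < 0 \<longrightarrow> (i, l) \<in># S \<and> S - {#(i, l)#} \<in> ?H)"
    if "S \<in> ?H" for S
  proof -
    obtain V where V: "path_module x V S"
      using \<open>S \<in> ?H\<close> by (elim CollectE exE)
    have "add_mset (i, k) S \<in> ?H" if "expo_mset {#x#} S i (k + 2) > 0" for i k
      using path_module_grow[OF V assms that] by simp
    moreover have "(i, l) \<in># S \<and> S - {#(i, l)#} \<in> ?H" if "expo_mset {#x#} S i l < 0" for i l
      using path_module_shrink[OF V, of i "l - 2"] that by simp
    moreover have "\<forall>y\<in>#S. \<exists>x\<in>#{#x#}. snd y < snd x"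
      using path_moduleD(5)[OF V] by simp
    ultimately show ?thesis
      using path_moduleD(4)[OF V] by blast
  qed
  ultimately show ?thesis
    unfolding move_closed_def by blast
qed

lemma expo_mset_plus: "expo_mset (R + R') (S + S') i l = expo_mset R S i l + expo_mset R' S' i l"
  by (simp add: expo_mset_def sum.distrib)

text \<open>A sum of two exponents can be positive, or negative, only if one summand is; the move is
  made in that factor.\<close>

lemma move_closed_plus:
  assumes "move_closed R H" and "move_closed R' H'"
  shows "move_closed (R + R') {S + S' | S S'. S \<in> H \<and> S' \<in> H'}"
proof -
  let ?H = "{S + S' | S S'. S \<in> H \<and> S' \<in> H'}"
  have props: "set_mset (S + S') \<subseteq> parity_vertices D \<and> (\<forall>y\<in>#S + S'. \<exists>x\<in>#R + R'. snd y < snd x) \<and>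
      (\<forall>i k. expo_mset (R + R') (S + S') i (k + 2) > 0 \<longrightarrow> add_mset (i, k) (S + S') \<in> ?H) \<and>
      (\<forall>i l. expo_mset (R + R') (S + S') i l < 0 \<longrightarrow>
        (i, l) \<in># S + S' \<and> S + S' - {#(i, l)#} \<in> ?H)"
    if S: "S \<in> H" and S': "S' \<in> H'" for S S'
  proof (intro conjI allI impI)
    show "set_mset (S + S') \<subseteq> parity_vertices D"
      using move_closedD(2)[OF assms(1) S] move_closedD(2)[OF assms(2) S'] by simp
    show "\<forall>y\<in>#S + S'. \<exists>x\<in>#R + R'. snd y < snd x"
      using move_closedD(3)[OF assms(1) S] move_closedD(3)[OF assms(2) S'] by (metis union_iff)
  next
    fix i k
    assume "expo_mset (R + R') (S + S') i (k + 2) > 0"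
    then consider "expo_mset R S i (k + 2) > 0" | "expo_mset R' S' i (k + 2) > 0"
      unfolding expo_mset_plus by linarith
    then show "add_mset (i, k) (S + S') \<in> ?H"
    proof cases
      case 1
      then have "add_mset (i, k) S \<in> H"
        using assms S by (auto simp: move_closed_def)
      then show ?thesis
        using S' by force
    next
      case 2
      then have "add_mset (i, k) S' \<in> H'"
        using assms S' by (auto simp: move_closed_def)
      then show ?thesis
        using S by force
    qed
  next
    fix i l
    assume neg: "expo_mset (R + R') (S + S') i l < 0"
    have "(i, l) \<in># S \<and> S - {#(i, l)#} \<in> H \<or> (i, l) \<in># S' \<and> S' - {#(i, l)#} \<in> H'"
    proof (cases "expo_mset R S i l < 0")
      case True
      then show ?thesis
        using assms S by (auto simp: move_closed_def)
    next
      case False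
      with neg have "expo_mset R' S' i l < 0"
        unfolding expo_mset_plus by linarith
      then show ?thesis
        using assms S' by (auto simp: move_closed_def)
    qed
    moreover have "S + S' - {#(i, l)#} = S - {#(i, l)#} + S'" if "(i, l) \<in># S"
      using that by simp
    moreover have "S + S' - {#(i, l)#} = S + (S' - {#(i, l)#})" if "(i, l) \<in># S'"
      using that by simp
    ultimately show "(i, l) \<in># S + S'" "S + S' - {#(i, l)#} \<in> ?H"
      using S S' by (simp_all only: union_iff mem_Collect_eq) metis+
  qed
  moreover have "{#} \<in> ?H"
    using assms by (force simp: move_closed_def)
  ultimately show ?thesis
    unfolding move_closed_def[of "R + R'"] by blast
qed

lemma move_closed_empty: "move_closed {#} {{#}}"
  by (auto simp: move_closed_def expo_mset_def)

text \<open>Working with multisets instead of monomials allows \<open>R\<close> to be split into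
  single vertices, although a single fundamental weight may lie outside the weight lattice.\<close>

lemma move_closed_exists: "set_mset R \<subseteq> parity_vertices D \<Longrightarrow> \<exists>H. move_closed R H"
proof (induction R)
  case empty
  show ?case
    using move_closed_empty by blast
next
  case (add x R)
  then obtain H where "move_closed R H"
    by auto
  then show ?case
    using move_closed_plus[OF move_closed_single[of x]] add.prems by fastforce
qed

end

section \<open>Monomials along one vertex of the diagram\<close>

lemma expo_add: "expo (p + q) i l = expo p i l + expo q i l"
  and expo_diff: "expo (p - q) i l = expo p i l - expo q i l"
  and expo_zero [simp]: "expo 0 i l = 0"
  by (simp_all add: expo_def lookup_add lookup_minus)

lemma expo_sum: "expo (\<Sum>a\<in>A. f a) i l = (\<Sum>a\<in>A. expo (f a) i l)"
  by (induction A rule: infinite_finite_induct) (simp_all add: expo_add)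

lemma finite_expo: "finite {l. expo p i l \<noteq> 0}"
proof -
  have "{l. expo p i l \<noteq> 0} = Pair i -` Poly_Mapping.keys (snd p)"
    by (auto simp: expo_def in_keys_iff)
  then show ?thesis
    by (simp add: finite_vimageI inj_on_def)
qed

text \<open>One function controls both operators: \<open>eps_at\<close> is its negative and
  \<open>phi_at\<close> is its distance from the total, so its minimum gives both \<open>eps\<close>
  and \<open>phi\<close>.\<close>

definition prefix :: "'i \<Rightarrow> ('i, 'n) monomial \<Rightarrow> int \<Rightarrow> int" where
  "prefix i p m = (\<Sum>l | l \<le> m \<and> expo p i l \<noteq> 0. expo p i l)"

definition total :: "'i \<Rightarrow> ('i, 'n) monomial \<Rightarrow> int" where
  "total i p = (\<Sum>l | expo p i l \<noteq> 0. expo p i l)"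

lemma prefix_superset:
  assumes "finite A" "{l. expo p i l \<noteq> 0} \<subseteq> A"
  shows "prefix i p m = (\<Sum>l\<in>A. if l \<le> m then expo p i l else 0)"
proof -
  have "(\<Sum>l\<in>A. if l \<le> m then expo p i l else 0) = (\<Sum>l\<in>{l. l \<le> m \<and> expo p i l \<noteq> 0}. if l \<le> m then expo p i l else 0)"
    by (rule sum.mono_neutral_right) (use assms in auto)
  then show ?thesis
    by (simp add: prefix_def)
qed

lemma total_superset:
  assumes "finite A" "{l. expo p i l \<noteq> 0} \<subseteq> A"
  shows "total i p = (\<Sum>l\<in>A. expo p i l)"
  unfolding total_def by (rule sum.mono_neutral_left) (use assms in auto)

lemma prefix_add: "prefix i (p + q) m = prefix i p m + prefix i q m"
proof -
  let ?A = "{l. expo p i l \<noteq> 0} \<union> {l. expo q i l \<noteq> 0}"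
  have "finite ?A" "{l. expo (p + q) i l \<noteq> 0} \<subseteq> ?A"
    by (auto simp: expo_add finite_expo)
  then show ?thesis
    by (simp add: prefix_superset[of ?A] expo_add sum.distrib[symmetric] if_distrib[of "\<lambda>x. x + _"] cong: if_cong)
qed

lemma total_add: "total i (p + q) = total i p + total i q"
proof -
  let ?A = "{l. expo p i l \<noteq> 0} \<union> {l. expo q i l \<noteq> 0}"
  have "finite ?A" "{l. expo (p + q) i l \<noteq> 0} \<subseteq> ?A"
    by (auto simp: expo_add finite_expo)
  then show ?thesis
    by (simp add: total_superset[of ?A] expo_add sum.distrib[symmetric])
qed

lemma prefix_diff: "prefix i (p - q) m = prefix i p m - prefix i q m"
  using prefix_add[of i "p - q" q m] by simp

lemma total_diff: "total i (p - q) = total i p - total i q"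
  using total_add[of i "p - q" q] by simp

lemma prefix_step: "prefix i p m = prefix i p (m - 1) + expo p i m"
proof -
  let ?A = "insert m {l. expo p i l \<noteq> 0}"
  have A: "finite ?A" "{l. expo p i l \<noteq> 0} \<subseteq> ?A"
    by (auto simp: finite_expo)
  have "(\<Sum>l\<in>?A. if l \<le> m then expo p i l else 0) =
      (\<Sum>l\<in>?A. (if l \<le> m - 1 then expo p i l else 0) + (if l = m then expo p i m else 0))"
    by (intro sum.cong) auto
  also have "\<dots> = (\<Sum>l\<in>?A. if l \<le> m - 1 then expo p i l else 0) + expo p i m"
    using A by (simp add: sum.distrib)
  finally show ?thesis
    by (simp only: prefix_superset[OF A])
qed

lemma prefix_low: "\<exists>lo. \<forall>m<lo. prefix i p m = 0"
proof -
  obtain lo where "\<forall>l\<in>{l. expo p i l \<noteq> 0}. lo \<le> l"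
    using bdd_below_finite[OF finite_expo[of p i]] by (auto simp: bdd_below_def)
  then have "{l. l \<le> m \<and> expo p i l \<noteq> 0} = {}" if "m < lo" for m
    using that by force
  then show ?thesis
    unfolding prefix_def by (metis sum.empty)
qed

lemma prefix_high: "\<exists>hi. \<forall>m\<ge>hi. prefix i p m = total i p"
proof -
  obtain hi where "\<forall>l\<in>{l. expo p i l \<noteq> 0}. l \<le> hi"
    using bdd_above_finite[OF finite_expo[of p i]] by (auto simp: bdd_above_def)
  then have "{l. l \<le> m \<and> expo p i l \<noteq> 0} = {l. expo p i l \<noteq> 0}" if "m \<ge> hi" for m
    using that by force
  then show ?thesis
    unfolding prefix_def total_def by metis
qed

lemma finite_range_prefix: "finite (range (prefix i p))"
proof -
  have "range (prefix i p) \<subseteq> sum (expo p i) ` Pow {l. expo p i l \<noteq> 0}"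
    by (auto simp: prefix_def)
  then show ?thesis
    by (rule finite_subset) (simp add: finite_expo)
qed

section \<open>Minima of prefix sums and positions of the crystal operators\<close>

definition pmin :: "'i \<Rightarrow> ('i, 'n) monomial \<Rightarrow> int" where
  "pmin i p = Min (range (prefix i p))"

lemma pmin_le: "pmin i p \<le> prefix i p m"
  unfolding pmin_def by (rule Min_le[OF finite_range_prefix]) simp

lemma pmin_attained: "\<exists>m. prefix i p m = pmin i p"
  using Min_in[OF finite_range_prefix[of i p]] unfolding pmin_def by auto

lemma pmin_eqI: "\<lbrakk>prefix i p m = c; \<And>m. prefix i p m \<ge> c\<rbrakk> \<Longrightarrow> pmin i p = c"
  unfolding pmin_def by (rule Min_eqI[OF finite_range_prefix]) auto

lemma pmin_le_zero: "pmin i p \<le> 0"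
proof -
  obtain lo where "\<forall>m<lo. prefix i p m = 0"
    using prefix_low[of i p] by blast
  then have "prefix i p (lo - 1) = 0"
    by simp
  then show ?thesis
    using pmin_le[of i p "lo - 1"] by simp
qed

lemma pmin_le_total: "pmin i p \<le> total i p"
  using prefix_high[of i p] pmin_le[of i p] by (metis order_refl)

text \<open>The reindexing \<open>g\<close> is the identity for \<open>eps\<close> and a shift by
  one for \<open>phi\<close>.\<close>

lemma Max_image_uminus_pmin: "Max (range (\<lambda>k. c - prefix i p (g k))) = c - pmin i p"
  if "surj g" for g :: "int \<Rightarrow> int"
proof (rule Max_eqI)
  have "range (\<lambda>k. c - prefix i p (g k)) \<subseteq> (\<lambda>x. c - x) ` range (prefix i p)"
    by auto
  then show "finite (range (\<lambda>k. c - prefix i p (g k)))"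
    by (rule finite_subset) (simp add: finite_range_prefix)
  obtain m where "prefix i p m = pmin i p"
    using pmin_attained[of i p] by blast
  moreover obtain k where "m = g k"
    using \<open>surj g\<close> by (metis surjD)
  ultimately show "c - pmin i p \<in> range (\<lambda>k. c - prefix i p (g k))"
    by (metis rangeI)
qed (use pmin_le[of i p] in auto)

lemma eps_at_prefix: "eps_at i k p = 0 - prefix i p k"
  by (simp add: eps_at_def prefix_def)

lemma phi_at_prefix: "phi_at i k p = total i p - prefix i p (k - 1)"
proof -
  have "total i p = phi_at i k p + prefix i p (k - 1)"
    unfolding total_def phi_at_def prefix_def
    by (subst sum.union_disjoint[symmetric]) (auto intro: sum.cong finite_subset[OF _ finite_expo[of p i]])
  then show ?thesis
    by simp
qed

lemma eps_pmin: "eps i p = - pmin i p"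
  unfolding eps_def eps_at_prefix using Max_image_uminus_pmin[of id 0 i p] by simp

lemma phi_pmin: "phi i p = total i p - pmin i p"
proof -
  have "surj (\<lambda>k. k - 1 :: int)"
    by (metis add_diff_cancel_right' surjI)
  then show ?thesis
    unfolding phi_def phi_at_prefix by (rule Max_image_uminus_pmin)
qed

lemma eps_nonneg: "eps i p \<ge> 0" and phi_nonneg: "phi i p \<ge> 0"
  using pmin_le_zero[of i p] pmin_le_total[of i p] by (simp_all add: eps_pmin phi_pmin)

lemma phi_minus_eps: "phi i p - eps i p = total i p"
  by (simp add: eps_pmin phi_pmin)

text \<open>The prefix sum attains its minimum last at \<open>F - 1\<close>, and in
  \<open>e_pos\<close> first at \<open>E\<close>. The offset between the two conventions comes from
  \<open>phi_at_prefix\<close>.\<close>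

definition f_pos :: "'i \<Rightarrow> ('i, 'n) monomial \<Rightarrow> int \<Rightarrow> bool" where
  "f_pos i p F \<longleftrightarrow> prefix i p (F - 1) = pmin i p \<and> (\<forall>m\<ge>F. prefix i p m > pmin i p)"

definition e_pos :: "'i \<Rightarrow> ('i, 'n) monomial \<Rightarrow> int \<Rightarrow> bool" where
  "e_pos i p E \<longleftrightarrow> prefix i p E = pmin i p \<and> (\<forall>m<E. prefix i p m > pmin i p)"

text \<open>If \<open>phi\<close> is nonzero, the final constant value of the prefix sum is above
  the minimum, so the minimum points are bounded above. For \<open>e_pos\<close> the initial value 0
  bounds them below.\<close>

lemma f_pos_exists:
  assumes "phi i p \<noteq> 0"
  shows "\<exists>F. f_pos i p F"
proof -
  obtain hi where hi: "\<forall>m\<ge>hi. prefix i p m = total i p"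
    using prefix_high[of i p] by blast
  obtain m0 where m0: "prefix i p m0 = pmin i p"
    using pmin_attained[of i p] by blast
  let ?A = "{m \<in> {m0..hi}. prefix i p m = pmin i p}"
  have ne: "prefix i p m \<noteq> pmin i p" if "m \<ge> hi" for m
    using hi that assms by (simp add: phi_pmin)
  then have "m0 < hi"
    using m0 by (metis linorder_not_le)
  with m0 have "m0 \<in> ?A"
    by simp
  moreover have fin: "finite ?A"
    by (rule finite_subset[of _ "{m0..hi}"]) auto
  ultimately have mem: "Max ?A \<in> ?A"
    by (metis (no_types, lifting) Max_in empty_iff)
  have ne': "prefix i p m \<noteq> pmin i p" if "m > Max ?A" for m
  proof
    assume "prefix i p m = pmin i p"
    moreover from this ne have "m < hi"
      by (metis linorder_not_le)
    ultimately have "m \<in> ?A"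
      using that mem by auto
    with that Max_ge[OF fin] show False
      by force
  qed
  have "prefix i p m > pmin i p" if "m \<ge> Max ?A + 1" for m
    using ne'[of m] pmin_le[of i p m] that by linarith
  with mem have "f_pos i p (Max ?A + 1)"
    unfolding f_pos_def by simp
  then show ?thesis
    by blast
qed

lemma e_pos_exists:
  assumes "eps i p \<noteq> 0"
  shows "\<exists>E. e_pos i p E"
proof -
  obtain lo where lo: "\<forall>m<lo. prefix i p m = 0"
    using prefix_low[of i p] by blast
  obtain m0 where m0: "prefix i p m0 = pmin i p"
    using pmin_attained[of i p] by blast
  let ?A = "{m \<in> {lo..m0}. prefix i p m = pmin i p}"
  have ne: "prefix i p m \<noteq> pmin i p" if "m < lo" for m
    using lo that assms by (simp add: eps_pmin)
  then have "lo \<le> m0"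
    using m0 by (metis linorder_not_le)
  with m0 have "m0 \<in> ?A"
    by simp
  moreover have fin: "finite ?A"
    by (rule finite_subset[of _ "{lo..m0}"]) auto
  ultimately have mem: "Min ?A \<in> ?A"
    by (metis (no_types, lifting) Min_in empty_iff)
  have ne': "prefix i p m \<noteq> pmin i p" if "m < Min ?A" for m
  proof
    assume "prefix i p m = pmin i p"
    moreover from this ne have "lo \<le> m"
      by (metis linorder_not_le)
    ultimately have "m \<in> ?A"
      using that mem by auto
    with that Min_le[OF fin] show False
      by force
  qed
  have "prefix i p m > pmin i p" if "m < Min ?A" for m
    using ne'[OF that] pmin_le[of i p m] by linarith
  with mem have "e_pos i p (Min ?A)"
    unfolding e_pos_def by simp
  then show ?thesis
    by blast
qed

lemma f_pos_phi: "f_pos i p F \<Longrightarrow> phi i p \<noteq> 0"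
proof -
  assume F: "f_pos i p F"
  obtain hi where "\<forall>m\<ge>hi. prefix i p m = total i p"
    using prefix_high[of i p] by blast
  then have "prefix i p (max hi F) = total i p"
    by simp
  moreover have "prefix i p (max hi F) > pmin i p"
    using F by (simp add: f_pos_def)
  ultimately show ?thesis
    by (simp add: phi_pmin)
qed

lemma e_pos_eps: "e_pos i p E \<Longrightarrow> eps i p \<noteq> 0"
proof -
  assume E: "e_pos i p E"
  obtain lo where "\<forall>m<lo. prefix i p m = 0"
    using prefix_low[of i p] by blast
  then have "prefix i p (min lo E - 1) = 0"
    by simp
  moreover have "prefix i p (min lo E - 1) > pmin i p"
    using E by (simp add: e_pos_def)
  ultimately show ?thesis
    by (simp add: eps_pmin)
qed

lemma crystal_f_eq:
  assumes F: "f_pos i p F"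
  shows "crystal_f D i p = Some (p - z_mon D (i, F - 2))"
proof -
  have "(GREATEST k. phi_at i k p = phi i p) = F"
  proof (rule Greatest_equality)
    show "phi_at i F p = phi i p"
      using F by (simp add: phi_at_prefix phi_pmin f_pos_def)
    fix k
    assume "phi_at i k p = phi i p"
    then have "prefix i p (k - 1) = pmin i p"
      by (simp add: phi_at_prefix phi_pmin)
    then have "\<not> k - 1 \<ge> F"
      using F unfolding f_pos_def by (metis less_irrefl)
    then show "k \<le> F"
      by simp
  qed
  then show ?thesis
    using f_pos_phi[OF F] by (simp add: crystal_f_def)
qed

lemma crystal_e_eq:
  assumes E: "e_pos i p E"
  shows "crystal_e D i p = Some (p + z_mon D (i, E))"
proof -
  have "(LEAST k. eps_at i k p = eps i p) = E"
  proof (rule Least_equality)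
    show "eps_at i E p = eps i p"
      using E by (simp add: eps_at_prefix eps_pmin e_pos_def)
    fix k
    assume "eps_at i k p = eps i p"
    then have "prefix i p k = pmin i p"
      by (simp add: eps_at_prefix eps_pmin)
    then have "\<not> k < E"
      using E unfolding e_pos_def by (metis less_irrefl)
    then show "E \<le> k"
      by simp
  qed
  then show ?thesis
    using e_pos_eps[OF E] by (simp add: crystal_e_def)
qed

lemma crystal_f_SomeD: "crystal_f D i p = Some q \<Longrightarrow> \<exists>F. f_pos i p F \<and> q = p - z_mon D (i, F - 2)"
  using f_pos_exists[of i p] crystal_f_eq[of i p _ D] by (auto simp: crystal_f_def split: if_splits)

lemma crystal_e_SomeD: "crystal_e D i p = Some q \<Longrightarrow> \<exists>E. e_pos i p E \<and> q = p + z_mon D (i, E)"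
  using e_pos_exists[of i p] crystal_e_eq[of i p _ D] by (auto simp: crystal_e_def split: if_splits)

lemma f_pos_expo: "f_pos i p F \<Longrightarrow> expo p i F > 0"
  using prefix_step[of i p F] unfolding f_pos_def by (metis less_add_same_cancel1 order_refl)

lemma e_pos_expo: "e_pos i p E \<Longrightarrow> expo p i E < 0"
  using prefix_step[of i p E] unfolding e_pos_def by (auto dest: spec[of _ "E - 1"])

context simply_laced_datum
begin

lemma expo_z_mon:
  "expo (z_mon D (i, k)) j l = (if j = i \<and> (l = k \<or> l = k + 2) then 1 else 0) -
    (if adjacent D i j \<and> l = k + 1 then 1 else 0)"
proof -
  have "(\<Sum>x | adjacent D i x. if (x, k + 1) = (j, l) then 1 else 0 :: int) =
      (\<Sum>x | adjacent D i x. if x = j then (if l = k + 1 then 1 else 0) else 0)"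
    by (intro sum.cong) auto
  also have "\<dots> = (if adjacent D i j \<and> l = k + 1 then 1 else 0)"
    by (subst sum.delta) auto
  finally have sum: "(\<Sum>x | adjacent D i x. if (x, k + 1) = (j, l) then 1 else 0 :: int) =
      (if adjacent D i j \<and> l = k + 1 then 1 else 0)" .
  have "expo (z_mon D (i, k)) j l = (if (i, k) = (j, l) then 1 else 0) + (if (i, k + 2) = (j, l) then 1 else 0)
      - (\<Sum>x | adjacent D i x. if (x, k + 1) = (j, l) then 1 else 0)"
    by (simp only: expo_def z_mon_def prod.case snd_conv lookup_add lookup_minus lookup_sum lookup_single when_def)
  then show ?thesis
    unfolding sum by auto
qed

lemma prefix_z_mon:
  "prefix i (z_mon D (i, k)) m = (if m \<ge> k then 1 else 0) + (if m \<ge> k + 2 then 1 else 0)"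
proof -
  have "{l. expo (z_mon D (i, k)) i l \<noteq> 0} \<subseteq> {k, k + 2}"
    by (auto simp: expo_z_mon split: if_splits)
  then have "prefix i (z_mon D (i, k)) m = (\<Sum>l\<in>{k, k + 2}. if l \<le> m then expo (z_mon D (i, k)) i l else 0)"
    by (intro prefix_superset) simp_all
  then show ?thesis
    by (simp add: expo_z_mon)
qed

lemma total_z_mon: "total i (z_mon D (j, k)) = cartan i j"
proof -
  have "{l. expo (z_mon D (j, k)) i l \<noteq> 0} \<subseteq> {k, k + 1, k + 2}"
    by (auto simp: expo_z_mon split: if_splits)
  then have "total i (z_mon D (j, k)) = (\<Sum>l\<in>{k, k + 1, k + 2}. expo (z_mon D (j, k)) i l)"
    by (intro total_superset) simp_all
  then show ?thesis
    by (simp add: expo_z_mon cartan_eq adjacent_sym[of j i])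
qed

lemma wt_z_mon [simp]: "wt (z_mon D (i, k)) = \<alpha> i"
  by (simp add: z_mon_def)

lemma monomials_iff:
  "p \<in> monomials D \<longleftrightarrow> (\<forall>i l. expo p i l \<noteq> 0 \<longrightarrow> (i, l) \<in> parity_vertices D) \<and>
     (\<forall>i. pairing (\<alpha>\<^sup>\<or> i) (wt p) = total i p)"
  by (auto simp: monomials_def total_def expo_def in_keys_iff subset_iff)

lemma monomials_diff: "\<lbrakk>p \<in> monomials D; q \<in> monomials D\<rbrakk> \<Longrightarrow> p - q \<in> monomials D"
  unfolding monomials_iff by (auto simp: expo_diff total_diff pairing_diff) metis

lemma z_mon_monomials: "x \<in> parity_vertices D \<Longrightarrow> z_mon D x \<in> monomials D"
  unfolding monomials_iff using two_colouring
  by (cases x) (auto simp: total_z_mon expo_z_mon parity_vertices_def split: if_splits)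

lemma parity_gap:
  assumes "p \<in> monomials D" "expo p i l \<noteq> 0"
  shows "expo p i (l - 1) = 0" and "expo p i (l + 1) = 0"
proof -
  have "(i, l) \<in> parity_vertices D" and "expo p i m \<noteq> 0 \<Longrightarrow> (i, m) \<in> parity_vertices D" for m
    using assms by (auto simp: monomials_iff)
  then show "expo p i (l - 1) = 0" "expo p i (l + 1) = 0"
    by (fastforce simp: parity_vertices_def)+
qed

text \<open>Multiplying by \<open>z_{i,F-2}^{-1}\<close> lowers the prefix sum by 1 at
  \<open>F - 2\<close> and \<open>F - 1\<close>, and by 2 from \<open>F\<close> on, where it
  exceeded the minimum. By parity the exponent at \<open>F - 1\<close> is 0, so the old minimum is
  already attained at \<open>F - 2\<close>; that becomes the first place of the new one.\<close>

lemma
  assumes p: "p \<in> monomials D" and F: "f_pos i p F"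
  defines "q \<equiv> p - z_mon D (i, F - 2)"
  shows pmin_f: "pmin i q = pmin i p - 1" and e_pos_f: "e_pos i q (F - 2)"
proof -
  have pre: "prefix i q m = prefix i p m - (if m \<ge> F - 2 then 1 else 0) - (if m \<ge> F then 1 else 0)" for m
    by (simp add: q_def prefix_diff prefix_z_mon)
  have "expo p i (F - 1) = 0"
    using parity_gap(1)[OF p] f_pos_expo[OF F] by simp
  then have "prefix i p (F - 2) = pmin i p"
    using F prefix_step[of i p "F - 1"] by (simp add: f_pos_def)
  then have at: "prefix i q (F - 2) = pmin i p - 1"
    by (simp add: pre)
  have "prefix i q m \<ge> pmin i p - 1" for m
    using pmin_le[of i p m] F unfolding pre f_pos_def by (auto dest: spec[of _ m])
  from pmin_eqI[OF at this] show min: "pmin i q = pmin i p - 1" .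
  have "prefix i q m > pmin i p - 1" if "m < F - 2" for m
    using that pmin_le[of i p m] by (simp add: pre)
  with at show "e_pos i q (F - 2)"
    unfolding e_pos_def min by simp
qed

lemma
  assumes p: "p \<in> monomials D" and E: "e_pos i p E"
  defines "q \<equiv> p + z_mon D (i, E)"
  shows pmin_e: "pmin i q = pmin i p + 1" and f_pos_e: "f_pos i q (E + 2)"
proof -
  have pre: "prefix i q m = prefix i p m + (if m \<ge> E then 1 else 0) + (if m \<ge> E + 2 then 1 else 0)" for m
    by (simp add: q_def prefix_add prefix_z_mon)
  have "expo p i (E + 1) = 0"
    using parity_gap(2)[OF p] e_pos_expo[OF E] by simp
  then have "prefix i p (E + 1) = pmin i p"
    using E prefix_step[of i p "E + 1"] by (simp add: e_pos_def)
  then have at: "prefix i q (E + 1) = pmin i p + 1"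
    by (simp add: pre)
  have "prefix i q m \<ge> pmin i p + 1" for m
    using pmin_le[of i p m] E unfolding pre e_pos_def by (auto dest: spec[of _ m])
  from pmin_eqI[OF at this] show min: "pmin i q = pmin i p + 1" .
  have "prefix i q m > pmin i p + 1" if "m \<ge> E + 2" for m
    using that pmin_le[of i p m] by (simp add: pre)
  with at show "f_pos i q (E + 2)"
    unfolding f_pos_def min by (simp add: algebra_simps)
qed

lemma crystal_f_e:
  assumes "p \<in> monomials D" "crystal_f D i p = Some q"
  shows "crystal_e D i q = Some p" "wt q = wt p - \<alpha> i" "eps i q = eps i p + 1" "phi i q = phi i p - 1"
proof -
  obtain F where F: "f_pos i p F" and q: "q = p - z_mon D (i, F - 2)"
    using crystal_f_SomeD[OF assms(2)] by blast
  note f = pmin_f[OF assms(1) F] e_pos_f[OF assms(1) F]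
  show "crystal_e D i q = Some p"
    unfolding q crystal_e_eq[OF f(2)] by simp
  show "wt q = wt p - \<alpha> i" "eps i q = eps i p + 1" "phi i q = phi i p - 1"
    using f(1) by (simp_all add: q eps_pmin phi_pmin total_diff total_z_mon cartan_diag)
qed

lemma crystal_e_f:
  assumes "p \<in> monomials D" "crystal_e D i p = Some q"
  shows "crystal_f D i q = Some p" "wt q = wt p + \<alpha> i" "eps i q = eps i p - 1" "phi i q = phi i p + 1"
proof -
  obtain E where E: "e_pos i p E" and q: "q = p + z_mon D (i, E)"
    using crystal_e_SomeD[OF assms(2)] by blast
  note e = pmin_e[OF assms(1) E] f_pos_e[OF assms(1) E]
  show "crystal_f D i q = Some p"
    unfolding q crystal_f_eq[OF e(2)] by simp
  show "wt q = wt p + \<alpha> i" "eps i q = eps i p - 1" "phi i q = phi i p + 1"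
    using e(1) by (simp_all add: q eps_pmin phi_pmin total_add total_z_mon cartan_diag)
qed

lemma phi_minus_eps_pairing: "p \<in> monomials D \<Longrightarrow> phi i p - eps i p = pairing (\<alpha>\<^sup>\<or> i) (wt p)"
  by (simp add: phi_minus_eps monomials_iff)

end

section \<open>Strings\<close>

lemma f_pos_unique:
  assumes "f_pos i p F" "f_pos i p F'"
  shows "F = F'"
proof -
  have "\<not> F - 1 \<ge> F'" "\<not> F' - 1 \<ge> F"
    using assms unfolding f_pos_def by (metis less_irrefl)+
  then show ?thesis
    by simp
qed

text \<open>With \<open>k\<close> the lowest position in use, this says that \<open>f_i\<close> acts
  at some \<open>F - 2\<close> not below \<open>k\<close>. A last minimum before \<open>k\<close>
  would have value 0, but the value at \<open>k\<close> is no larger; a last minimum at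
  \<open>k\<close> is repeated at \<open>k + 1\<close>.\<close>

lemma f_pos_ge:
  assumes F: "f_pos i p F" and low: "\<And>m. m < k \<Longrightarrow> prefix i p m = 0"
    and nonpos: "prefix i p k \<le> 0" and gap: "prefix i p (k + 1) = prefix i p k"
  shows "F \<ge> k + 2"
proof (rule ccontr)
  assume "\<not> F \<ge> k + 2"
  then consider "F - 1 < k" | "F - 1 = k"
    by linarith
  then show False
  proof cases
    case 1
    then have "pmin i p = 0" "prefix i p k > pmin i p"
      using F low[of "F - 1"] by (auto simp: f_pos_def)
    then show False
      using nonpos by simp
  next
    case 2
    then have "prefix i p k = pmin i p" "prefix i p (k + 1) > pmin i p"
      using F by (auto simp: f_pos_def)
    then show False
      using gap by simp
  qed
qed

context simply_laced_datum
begin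

text \<open>Closure for one vertex only, because a truncation is shown closed only under the
  operators of a minimal vertex.\<close>

definition string_closed :: "'i \<Rightarrow> ('i, 'n) monomial set \<Rightarrow> bool" where
  "string_closed i X \<longleftrightarrow> X \<subseteq> monomials D \<and>
     (\<forall>p\<in>X. \<forall>q. crystal_f D i p = Some q \<or> crystal_e D i p = Some q \<longrightarrow> q \<in> X)"

lemma string_closedD:
  assumes "string_closed i X" "p \<in> X"
  shows "p \<in> monomials D"
    and "crystal_f D i p = Some q \<Longrightarrow> q \<in> X"
    and "crystal_e D i p = Some q \<Longrightarrow> q \<in> X"
  using assms unfolding string_closed_def by blast+

lemma string_level_shift:
  fixes g :: "int ^ 'n \<Rightarrow> 'b::comm_monoid_add"
  assumes X: "string_closed i X"
  shows "(\<Sum>p | p \<in> X \<and> eps i p = int a + 1 \<and> phi i p = int b. g (wt p)) =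
    (\<Sum>p | p \<in> X \<and> eps i p = int a \<and> phi i p = int b + 1. g (wt p - \<alpha> i))"
proof -
  have mon: "p \<in> monomials D" if "p \<in> X" for p
    using that by (rule string_closedD(1)[OF X])
  have f: "crystal_f D i p = Some (the (crystal_f D i p)) \<and> the (crystal_f D i p) \<in> X"
    if "p \<in> X" "phi i p \<noteq> 0" for p
    using that string_closedD(2)[OF X that(1)] by (simp add: crystal_f_def)
  have e: "crystal_e D i p = Some (the (crystal_e D i p)) \<and> the (crystal_e D i p) \<in> X"
    if "p \<in> X" "eps i p \<noteq> 0" for p
    using that string_closedD(3)[OF X that(1)] by (simp add: crystal_e_def)
  show ?thesis
  proof (rule sum.reindex_bij_witness[where i = "\<lambda>p. the (crystal_f D i p)" and j = "\<lambda>p. the (crystal_e D i p)"])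
    fix p
    assume "p \<in> {p. p \<in> X \<and> eps i p = int a + 1 \<and> phi i p = int b}"
    then have p: "p \<in> X" "eps i p = int a + 1" "phi i p = int b"
      by simp_all
    define q where "q = the (crystal_e D i p)"
    have q: "crystal_e D i p = Some q" "q \<in> X"
      using e[of p] p by (simp_all add: q_def)
    note ef = crystal_e_f[OF mon[OF p(1)] q(1)]
    show "the (crystal_f D i (the (crystal_e D i p))) = p"
      "the (crystal_e D i p) \<in> {p. p \<in> X \<and> eps i p = int a \<and> phi i p = int b + 1}"
      "g (wt (the (crystal_e D i p)) - \<alpha> i) = g (wt p)"
      using ef q(2) p by (simp_all add: q_def[symmetric])
  next
    fix p
    assume "p \<in> {p. p \<in> X \<and> eps i p = int a \<and> phi i p = int b + 1}"
    then have p: "p \<in> X" "eps i p = int a" "phi i p = int b + 1"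
      by simp_all
    define q where "q = the (crystal_f D i p)"
    have q: "crystal_f D i p = Some q" "q \<in> X"
      using f[of p] p by (simp_all add: q_def)
    note fe = crystal_f_e[OF mon[OF p(1)] q(1)]
    show "the (crystal_e D i (the (crystal_f D i p))) = p"
      "the (crystal_f D i p) \<in> {p. p \<in> X \<and> eps i p = int a + 1 \<and> phi i p = int b}"
      using fe q(2) p by (simp_all add: q_def[symmetric])
  qed
qed

lemma string_level_top:
  fixes g :: "int ^ 'n \<Rightarrow> 'b::comm_monoid_add"
  assumes X: "string_closed i X"
  shows "(\<Sum>p | p \<in> X \<and> eps i p = int a \<and> phi i p = int b. g (wt p)) =
    (\<Sum>p | p \<in> X \<and> eps i p = 0 \<and> phi i p = int (a + b). g (wt p - int a *s \<alpha> i))"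
\<comment> \<open>Each step up a string replaces \<open>g\<close> by a translate, so
  \<open>g\<close> has to vary.\<close>
proof (induction a arbitrary: b g)
  case (Suc a)
  have "(\<Sum>p | p \<in> X \<and> eps i p = int (Suc a) \<and> phi i p = int b. g (wt p)) =
      (\<Sum>p | p \<in> X \<and> eps i p = int a \<and> phi i p = int (Suc b). g (wt p - \<alpha> i))"
    using string_level_shift[OF X, where a = a and b = b and g = g] by (simp add: add.commute)
  also have "\<dots> = (\<Sum>p | p \<in> X \<and> eps i p = 0 \<and> phi i p = int (a + Suc b). g (wt p - int a *s \<alpha> i - \<alpha> i))"
    by (rule Suc)
  also have "\<dots> = (\<Sum>p | p \<in> X \<and> eps i p = 0 \<and> phi i p = int (Suc a + b). g (wt p - int (Suc a) *s \<alpha> i))"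
  proof -
    have "\<mu> - int a *s \<alpha> i - \<alpha> i = \<mu> - int (Suc a) *s \<alpha> i" for \<mu>
      by (simp add: vec_eq_iff algebra_simps)
    then show ?thesis
      by (simp only: add_Suc add_Suc_right)
  qed
  finally show ?case .
qed simp

text \<open>The sum \<open>eps + phi\<close> is the length of a string and constant along it, while
  \<open>eps\<close> is the depth in it. Grouping by both, the string below a top \<open>p\<close>
  of length \<open>m\<close> contributes
  \<open>\<Sum>a\<le>m. wt_exp (wt p - int a *s \<alpha> i)\<close>, which is \<open>pi_i\<close> of
  the exponential of its top.\<close>

lemma char_string_closed:
  assumes X: "string_closed i X" and fin: "finite X"
  shows "crystal_char X = demazure D i (crystal_char {p \<in> X. eps i p = 0})"
proof -
  let ?m = "\<lambda>p. nat (eps i p + phi i p)"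
  let ?T = "\<lambda>m. {p. p \<in> X \<and> eps i p = 0 \<and> phi i p = int m}"
  have level: "(\<Sum>p | p \<in> X \<and> ?m p = m. wt_exp (wt p)) = (\<Sum>p\<in>?T m. demazure_exp D i (wt p))" for m
  proof -
    have "(\<Sum>p | p \<in> X \<and> ?m p = m. wt_exp (wt p)) =
        (\<Sum>a\<le>m. \<Sum>p | p \<in> {p. p \<in> X \<and> ?m p = m} \<and> nat (eps i p) = a. wt_exp (wt p))"
    proof (rule sum.group[symmetric])
      show "(\<lambda>p. nat (eps i p)) ` {p. p \<in> X \<and> ?m p = m} \<subseteq> {..m}"
        using phi_nonneg[of i] by (auto intro!: nat_mono)
    qed (use fin in auto)
    also have "\<dots> = (\<Sum>a\<le>m. \<Sum>p | p \<in> X \<and> eps i p = int a \<and> phi i p = int (m - a). wt_exp (wt p))"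
    proof (intro sum.cong HOL.refl)
      fix a
      assume "a \<in> {..m}"
      moreover have "eps i p \<ge> 0 \<and> phi i p \<ge> 0" for p :: "('i, 'n) monomial"
        by (simp add: eps_nonneg phi_nonneg)
      ultimately have "?m p = m \<and> nat (eps i p) = a \<longleftrightarrow> eps i p = int a \<and> phi i p = int (m - a)"
        for p :: "('i, 'n) monomial"
        by (smt (verit) atMost_iff int_nat_eq nat_int of_nat_diff)
      then show "{p \<in> {p. p \<in> X \<and> ?m p = m}. nat (eps i p) = a} =
          {p. p \<in> X \<and> eps i p = int a \<and> phi i p = int (m - a)}"
        by auto
    qed
    also have "\<dots> = (\<Sum>a\<le>m. \<Sum>p\<in>?T m. wt_exp (wt p - int a *s \<alpha> i))"
    proof (rule sum.cong[OF HOL.refl])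
      fix a
      assume "a \<in> {..m}"
      then show "(\<Sum>p | p \<in> X \<and> eps i p = int a \<and> phi i p = int (m - a). wt_exp (wt p)) =
          (\<Sum>p\<in>?T m. wt_exp (wt p - int a *s \<alpha> i))"
        using string_level_top[OF X, where a = a and b = "m - a" and g = wt_exp] by simp
    qed
    also have "\<dots> = (\<Sum>p\<in>?T m. \<Sum>a\<le>m. wt_exp (wt p - int a *s \<alpha> i))"
      by (rule sum.swap)
    also have "\<dots> = (\<Sum>p\<in>?T m. demazure_exp D i (wt p))"
    proof (intro sum.cong HOL.refl)
      fix p
      assume "p \<in> ?T m"
      then have "pairing (\<alpha>\<^sup>\<or> i) (wt p) = int m"
        using phi_minus_eps_pairing[OF string_closedD(1)[OF X, of p], of i] by auto
      then show "(\<Sum>a\<le>m. wt_exp (wt p - int a *s \<alpha> i)) = demazure_exp D i (wt p)"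
        by (simp add: demazure_exp_string)
    qed
    finally show ?thesis .
  qed
  have "crystal_char X = (\<Sum>m\<in>?m ` X. \<Sum>p | p \<in> X \<and> ?m p = m. wt_exp (wt p))"
    unfolding crystal_char_def by (rule sum.group[symmetric]) (use fin in auto)
  also have "\<dots> = (\<Sum>m\<in>?m ` X. \<Sum>p\<in>?T m. demazure_exp D i (wt p))"
    by (simp only: level)
  also have "\<dots> = (\<Sum>m\<in>?m ` X. \<Sum>p | p \<in> {p \<in> X. eps i p = 0} \<and> ?m p = m. demazure_exp D i (wt p))"
  proof (intro sum.cong HOL.refl)
    fix m
    have "p \<in> X \<and> eps i p = 0 \<and> phi i p = int m \<longleftrightarrow> p \<in> {p \<in> X. eps i p = 0} \<and> ?m p = m" for p
      using phi_nonneg[of i p] by (cases "eps i p = 0") (simp_all add: nat_eq_iff)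
    then show "?T m = {p \<in> {p \<in> X. eps i p = 0}. ?m p = m}"
      by (rule Collect_cong)
  qed
  also have "\<dots> = (\<Sum>p | p \<in> X \<and> eps i p = 0. demazure_exp D i (wt p))"
  proof (rule sum.group)
    show "?m ` {p \<in> X. eps i p = 0} \<subseteq> ?m ` X"
      by (rule image_mono) blast
  qed (use fin in simp_all)
  also have "\<dots> = demazure D i (crystal_char {p \<in> X. eps i p = 0})"
    by (simp add: crystal_char_def demazure_sum demazure_wt_exp)
  finally show ?thesis .
qed

lemma char_string_closed_fixed:
  "\<lbrakk>string_closed i X; finite X\<rbrakk> \<Longrightarrow> demazure D i (crystal_char X) = crystal_char X"
  by (simp only: char_string_closed[of i X] demazure_idem)

lemma crystal_char_Un: "\<lbrakk>finite A; finite B; A \<inter> B = {}\<rbrakk> \<Longrightarrow> crystal_char (A \<union> B) = crystal_char A + crystal_char B"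
  by (simp add: crystal_char_def sum.union_disjoint)

text \<open>
  An \<open>i\<close>-string whose first \<open>f\<^sub>i\<close> acts at the lowest possible position \<open>k\<close> meets the subset in its
  top only; in all other strings \<open>f\<^sub>i\<close> never acts at \<open>k\<close>, because the operators acting at \<open>k\<close> come
  first, and the whole string lies in the subset.
\<close>

lemma char_lowest_position:
  assumes X: "string_closed i X" and fin: "finite X"
    and low: "\<And>p m. \<lbrakk>p \<in> X; m < k\<rbrakk> \<Longrightarrow> prefix i p m = 0"
    and nonpos: "\<And>p. p \<in> X \<Longrightarrow> prefix i p k \<le> 0"
    and gap: "\<And>p. p \<in> X \<Longrightarrow> prefix i p (k + 1) = prefix i p k"
  shows "crystal_char X = demazure D i (crystal_char {p \<in> X. prefix i p k = 0})"
proof -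
  \<comment> \<open>\<open>X0\<close> is the smaller truncation, \<open>T\<close> consists of the
    tops of all strings and \<open>T1\<close> of the tops at which \<open>f_i\<close> acts at
    \<open>k\<close>. The remainder \<open>Y\<close> will turn out to consist of whole
    strings.\<close>
  define X0 where "X0 = {p \<in> X. prefix i p k = 0}"
  define T where "T = {p \<in> X. eps i p = 0}"
  define T1 where "T1 = {p \<in> T. \<forall>m\<ge>k + 2. prefix i p m > 0}"
  define Y where "Y = X0 - T1"
  have mon: "p \<in> monomials D" if "p \<in> X" for p
    using that by (rule string_closedD(1)[OF X])
  have F_ge: "F \<ge> k + 2" if "p \<in> X" "f_pos i p F" for p F
    using that(2) low[OF that(1)] nonpos[OF that(1)] gap[OF that(1)] by (rule f_pos_ge)
  have T_X0: "T \<subseteq> X0"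
  proof
    fix p
    assume p: "p \<in> T"
    then have "prefix i p k \<ge> 0"
      using pmin_le[of i p k] by (simp add: T_def eps_pmin)
    with p nonpos[of p] show "p \<in> X0"
      by (simp add: T_def X0_def)
  qed
  have T1_f: "f_pos i p (k + 2)" if "p \<in> T1" for p
  proof -
    have "p \<in> X0" "pmin i p = 0" "\<forall>m\<ge>k + 2. prefix i p m > 0"
      using that T_X0 by (auto simp: T1_def T_def eps_pmin)
    then show ?thesis
      using gap[of p] by (simp add: f_pos_def X0_def add.commute)
  qed
  have Y: "string_closed i Y"
    unfolding string_closed_def
  proof (intro conjI ballI allI impI)
    show "Y \<subseteq> monomials D"
      using mon by (auto simp: Y_def X0_def)
    fix p q
    assume "p \<in> Y"
    then have p: "p \<in> X" "prefix i p k = 0" "p \<notin> T1"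
      by (auto simp: Y_def X0_def)
    assume "crystal_f D i p = Some q \<or> crystal_e D i p = Some q"
    then have "q \<in> X"
      using string_closedD(2,3)[OF X p(1)] by blast
    from \<open>crystal_f D i p = Some q \<or> crystal_e D i p = Some q\<close> show "q \<in> Y"
    proof
      assume f: "crystal_f D i p = Some q"
      then obtain F where F: "f_pos i p F" "q = p - z_mon D (i, F - 2)"
        using crystal_f_SomeD by blast
      \<comment> \<open>Acting at \<open>k\<close> would make the minimum equal to the value 0 at
        \<open>k\<close>, so \<open>p\<close> would be the top of its string and lie in
        \<open>T1\<close>.\<close>
      have "F \<noteq> k + 2"
      proof
        assume "F = k + 2"
        then have "prefix i p (k + 1) = pmin i p" and above: "\<forall>m\<ge>k + 2. prefix i p m > pmin i p"
          using F(1) by (simp_all add: f_pos_def add.commute[of 1 k])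
        then have "pmin i p = 0"
          using gap[OF p(1)] p(2) by simp
        with above p(1) have "p \<in> T1"
          by (simp add: T1_def T_def eps_pmin)
        with p(3) show False
          by simp
      qed
      with F_ge[OF p(1) F(1)] have "prefix i q k = 0"
        using p(2) by (simp add: F(2) prefix_diff prefix_z_mon)
      moreover have "eps i q \<noteq> 0"
        using crystal_f_e(3)[OF mon[OF p(1)] f] eps_nonneg[of i p] by simp
      ultimately show "q \<in> Y"
        using \<open>q \<in> X\<close> by (simp add: Y_def X0_def T1_def T_def)
    next
      assume "crystal_e D i p = Some q"
      then obtain E where E: "e_pos i p E" "q = p + z_mon D (i, E)"
        using crystal_e_SomeD by blast
      have "prefix i q k = (if k \<ge> E then 1 else 0) + (if k \<ge> E + 2 then 1 else 0)"
        using p(2) by (simp add: E(2) prefix_add prefix_z_mon)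
      \<comment> \<open>The value at \<open>k\<close> was 0 and may not become positive, so
        \<open>e_i\<close> acts strictly above \<open>k\<close>.\<close>
      with nonpos[OF \<open>q \<in> X\<close>] have "k < E" "prefix i q k = 0"
        by (auto split: if_splits)
      moreover have "q \<notin> T1"
        using f_pos_unique[OF T1_f f_pos_e[OF mon[OF p(1)] E(1), folded E(2)]] \<open>k < E\<close> by auto
      ultimately show "q \<in> Y"
        using \<open>q \<in> X\<close> by (simp add: Y_def X0_def)
    qed
  qed
  have finite: "finite Y" "finite T1" "finite T"
    using fin by (simp_all add: Y_def X0_def T1_def T_def)
  have X0_split: "X0 = Y \<union> T1"
    using T_X0 by (auto simp: Y_def T1_def)
  have T_split: "T = {p \<in> Y. eps i p = 0} \<union> T1"
    using T_X0 by (auto simp: Y_def T1_def X0_def T_def)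
  \<comment> \<open>As \<open>Y\<close> consists of whole strings, \<open>pi_i\<close> gives the
    same result on \<open>Y\<close> as on its tops. Together with \<open>T1\<close> these are all
    the tops of \<open>X\<close>.\<close>
  have "demazure D i (crystal_char X0) = demazure D i (crystal_char Y) + demazure D i (crystal_char T1)"
    unfolding X0_split using finite by (subst crystal_char_Un) (auto simp: Y_def demazure_add)
  also have "demazure D i (crystal_char Y) = demazure D i (crystal_char {p \<in> Y. eps i p = 0})"
    using char_string_closed[OF Y finite(1)] char_string_closed_fixed[OF Y finite(1)] by simp
  also have "\<dots> + demazure D i (crystal_char T1) = demazure D i (crystal_char T)"
    unfolding T_split using finite by (subst crystal_char_Un) (auto simp: Y_def demazure_add)
  also have "\<dots> = crystal_char X"
    unfolding T_def by (rule char_string_closed[OF X fin, symmetric])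
  finally show ?thesis
    by (simp add: X0_def)
qed

end

section \<open>The product monomial crystal\<close>

lemma of_lattice_inj: "of_lattice \<mu> = of_lattice \<nu> \<longleftrightarrow> \<mu> = \<nu>"
  by (auto simp: of_lattice_def vec_eq_iff)

lemma of_lattice_add: "of_lattice (\<mu> + \<nu>) = of_lattice \<mu> + of_lattice \<nu>"
  and of_lattice_zero [simp]: "of_lattice 0 = 0"
  by (simp_all add: of_lattice_def vec_eq_iff)

lemma of_lattice_sum: "of_lattice (\<Sum>x\<in>A. f x) = (\<Sum>x\<in>A. of_lattice (f x))"
  by (induction A rule: infinite_finite_induct) (simp_all add: of_lattice_add)

lemma of_lattice_to_lattice: "v \<in> range of_lattice \<Longrightarrow> of_lattice (to_lattice v) = v"
  unfolding to_lattice_def by (rule theI') (auto simp: of_lattice_inj)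

lemma pairing_of_lattice: "pairing a (of_lattice \<mu>) = of_int (pairing a \<mu>)"
  by (simp add: pairing_def of_lattice_def)

lemma sum_replicate_count: "(\<Sum>x\<in>set_mset R. replicate_mset (count R x) x) = R"
  by (rule multiset_eqI) (auto simp: count_sum count_eq_zero_iff if_distrib cong: if_cong)

text \<open>Grouping by vertices matters because \<open>based_mset\<close> puts only these multiples
  of the fundamental weights into the lattice.\<close>

lemma sum_mset_eq_sum_count:
  fixes D :: "('i::finite, 'n::finite) root_datum"
  shows "(\<Sum>(i, c) \<in># R. fund_weight D i) = (\<Sum>x\<in>set_mset R. of_nat (count R x) *s fund_weight D (fst x))"
proof -
  have rep: "(\<Sum>y\<in>#replicate_mset n x. f y) = of_nat n *s f x" for n x and f :: "_ \<Rightarrow> rat ^ 'n"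
    by (induction n) (simp_all add: vec_eq_iff algebra_simps)
  have "(\<Sum>y\<in>#R. f y) = (\<Sum>x\<in>set_mset R. \<Sum>y\<in>#replicate_mset (count R x) x. f y)" for f :: "_ \<Rightarrow> rat ^ 'n"
  proof -
    have "(\<Sum>y\<in>#(\<Sum>x\<in>A. G x). f y) = (\<Sum>x\<in>A. \<Sum>y\<in>#G x. f y)"
      if "finite A" for A and G :: "_ \<Rightarrow> _ multiset"
      using that by (induction A) simp_all
    from this[OF finite_set_mset, of "\<lambda>x. replicate_mset (count R x) x" R] show ?thesis
      unfolding sum_replicate_count .
  qed
  then show ?thesis
    unfolding case_prod_unfold by (simp only: rep)
qed

lemma finite_multisets_bounded:
  assumes "finite A"
  shows "finite {S. set_mset S \<subseteq> A \<and> size S \<le> n}"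
proof (rule finite_subset)
  show "{S. set_mset S \<subseteq> A \<and> size S \<le> n} \<subseteq> mset ` {xs. set xs \<subseteq> A \<and> length xs \<le> n}"
  proof
    fix S
    assume S: "S \<in> {S. set_mset S \<subseteq> A \<and> size S \<le> n}"
    obtain xs where "S = mset xs"
      using ex_mset by metis
    with S show "S \<in> mset ` {xs. set xs \<subseteq> A \<and> length xs \<le> n}"
      by auto
  qed
qed (simp add: assms finite_lists_length_le)

lemma z_mset_empty [simp]: "z_mset D {#} = 0"
  and z_mset_add_mset: "z_mset D (add_mset x S) = z_mon D x + z_mset D S"
  and z_mset_plus: "z_mset D (S + S') = z_mset D S + z_mset D S'"
  by (simp_all add: z_mset_def)

lemma z_mset_sum: "finite A \<Longrightarrow> z_mset D (\<Sum>x\<in>A. s x) = (\<Sum>x\<in>A. z_mset D (s x))"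
  by (induction A rule: finite_induct) (simp_all add: z_mset_plus)

lemma expo_y_mset: "expo (y_mset D R) i l = int (count R (i, l))"
proof -
  have "Poly_Mapping.lookup (\<Sum>x\<in>#R. Poly_Mapping.single x 1) y = int (count R y)" for y
    by (induction R) (auto simp: lookup_add lookup_single when_def)
  then show ?thesis
    by (simp add: expo_def y_mset_def)
qed

context simply_laced_datum
begin

definition mono :: "('i \<times> int) multiset \<Rightarrow> ('i \<times> int) multiset \<Rightarrow> ('i, 'n) monomial" where
  "mono R S = y_mset D R - z_mset D S"

lemma mono_empty [simp]: "mono R {#} = y_mset D R"
  by (simp add: mono_def)

lemma mono_add_mset: "mono R (add_mset x S) = mono R S - z_mon D x"
  by (simp add: mono_def z_mset_add_mset)

lemma mono_remove: "x \<in># S \<Longrightarrow> mono R (S - {#x#}) = mono R S + z_mon D x"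
  using mono_add_mset[of R x "S - {#x#}"] by simp

lemma expo_z_mset: "expo (z_mset D S) i l =
    int (count S (i, l)) + int (count S (i, l - 2)) - (\<Sum>j | adjacent D i j. int (count S (j, l - 1)))"
proof (induction S)
  case (add x S)
  obtain j k where x: "x = (j, k)"
    by (cases x)
  have "(\<Sum>j' | adjacent D i j'. int (count (add_mset x S) (j', l - 1))) =
      (\<Sum>j' | adjacent D i j'. int (count S (j', l - 1)) + (if j' = j then (if l = k + 1 then 1 else 0) else 0))"
    by (intro sum.cong) (auto simp: x)
  also have "\<dots> = (\<Sum>j' | adjacent D i j'. int (count S (j', l - 1)))
      + (if adjacent D i j \<and> l = k + 1 then 1 else 0)"
    by (simp add: sum.distrib sum.delta)
  finally show ?case
    using add by (auto simp: x z_mset_add_mset expo_add expo_z_mon adjacent_sym[of j i])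
qed simp

lemma expo_mono: "expo (mono R S) i l = expo_mset R S i l"
  by (simp add: mono_def expo_diff expo_y_mset expo_z_mset expo_mset_def)

text \<open>The exponents are unitriangular in the multiplicities: at level \<open>l\<close> a new
  multiplicity appears once, next to multiplicities from levels \<open>l - 1\<close> and
  \<open>l - 2\<close>. Induction starts below all levels, where everything is 0.\<close>

lemma z_mset_inj:
  assumes "z_mset D S = z_mset D S'"
  shows "S = S'"
proof -
  have "bdd_below (snd ` set_mset (S + S'))"
    by (rule bdd_below_finite) simp
  then obtain lo where lo: "\<And>x. x \<in># S + S' \<Longrightarrow> lo \<le> snd x"
    by (auto simp: bdd_below_def)
  have "count S (i, l) = count S' (i, l)" for i l
  proof (induction "nat (l - lo + 1)" arbitrary: i l rule: less_induct)
    case (less l i)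
    show ?case
    proof (cases "l < lo")
      case True
      then have "(i, l) \<notin># S" "(i, l) \<notin># S'"
        using lo[of "(i, l)"] by auto
      then show ?thesis
        by (simp add: not_in_iff)
    next
      case False
      then have IH: "count S (j, l - 1) = count S' (j, l - 1)" "count S (j, l - 2) = count S' (j, l - 2)" for j
        using less[of "l - 1" j] less[of "l - 2" j] by simp_all
      have "expo (z_mset D S) i l = expo (z_mset D S') i l"
        by (simp only: assms)
      then show ?thesis
        by (simp add: expo_z_mset IH)
    qed
  qed
  then show ?thesis
    by (intro multiset_eqI) (metis surj_pair)
qed

lemma mono_inj: "mono R S = mono R S' \<Longrightarrow> S = S'"
  by (rule z_mset_inj) (simp add: mono_def)

lemma mon_supp_mono:
  assumes "set_mset S \<subseteq> parity_vertices D"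
  shows "mon_supp D R (mono R S) = set_mset R \<union> set_mset S"
proof -
  have "(THE S'. set_mset S' \<subseteq> parity_vertices D \<and> mono R S = y_mset D R - z_mset D S') = S"
    using assms mono_inj[of R S] by (intro the_equality) (auto simp: mono_def)
  then show ?thesis
    by (simp add: mon_supp_def)
qed

lemma wt_mono: "wt (mono R S) = wt_mset D R - (\<Sum>x\<in>#S. \<alpha> (fst x))"
proof -
  have "wt (z_mset D S) = (\<Sum>x\<in>#S. \<alpha> (fst x))"
    by (induction S) (auto simp: z_mset_add_mset)
  then show ?thesis
    by (simp add: mono_def y_mset_def)
qed

lemma of_lattice_wt_mset:
  assumes "based_mset D R"
  shows "of_lattice (wt_mset D R) = (\<Sum>x\<in>set_mset R. of_nat (count R x) *s fund_weight D (fst x))"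
proof -
  have "\<exists>\<mu>. of_lattice \<mu> = of_nat (count R x) *s fund_weight D (fst x)" for x
    using assms by (cases x) (auto simp: based_mset_def image_iff, metis)
  then obtain \<mu> where "\<And>x. of_lattice (\<mu> x) = of_nat (count R x) *s fund_weight D (fst x)"
    by metis
  then have "(\<Sum>x\<in>set_mset R. of_nat (count R x) *s fund_weight D (fst x)) = of_lattice (\<Sum>x\<in>set_mset R. \<mu> x)"
    by (simp add: of_lattice_sum)
  then show ?thesis
    unfolding wt_mset_def sum_mset_eq_sum_count by (metis of_lattice_to_lattice rangeI)
qed

lemma y_mset_monomials:
  assumes "based_mset D R"
  shows "y_mset D R \<in> monomials D"
  unfolding monomials_iff
proof (intro conjI allI impI)
  fix i l
  assume "expo (y_mset D R) i l \<noteq> 0"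
  then show "(i, l) \<in> parity_vertices D"
    using assms by (auto simp: expo_y_mset based_mset_def)
next
  fix i
  have "of_int (pairing (\<alpha>\<^sup>\<or> i) (wt_mset D R)) = (of_int (total i (y_mset D R)) :: rat)"
  proof -
    have "of_int (pairing (\<alpha>\<^sup>\<or> i) (wt_mset D R)) =
        (\<Sum>x\<in>set_mset R. of_nat (count R x) * pairing (\<alpha>\<^sup>\<or> i) (fund_weight D (fst x)))"
      by (simp add: pairing_of_lattice[symmetric] of_lattice_wt_mset[OF assms] pairing_sum pairing_scale)
    also have "\<dots> = (\<Sum>x\<in>{x \<in> set_mset R. fst x = i}. of_nat (count R x))"
      by (rule sum.mono_neutral_cong_right) (auto simp: fund_weight)
    also have "\<dots> = (\<Sum>l | expo (y_mset D R) i l \<noteq> 0. of_nat (count R (i, l)))"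
      by (rule sum.reindex_bij_witness[where i = "Pair i" and j = snd]) (auto simp: expo_y_mset)
    also have "\<dots> = of_int (total i (y_mset D R))"
      by (simp add: total_def expo_y_mset)
    finally show ?thesis .
  qed
  then show "pairing (\<alpha>\<^sup>\<or> i) (wt (y_mset D R)) = total i (y_mset D R)"
    by (simp add: y_mset_def)
qed

lemma based_mset_replicate:
  assumes "based_mset D R" "x \<in># R"
  shows "based_mset D (replicate_mset (count R x) x)"
proof -
  have zero: "(0 :: rat ^ 'n) \<in> range of_lattice"
    by (metis of_lattice_zero rangeI)
  have "of_nat (if y = x then count R x else 0) *s fund_weight D (fst y) \<in> range of_lattice" for y
    using assms zero by (cases y) (auto simp: based_mset_def)
  then show ?thesis
    using assms zero by (auto simp: based_mset_def subset_iff split: if_splits)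
qed

lemma y_mset_eq_sum:
  assumes "based_mset D R"
  shows "y_mset D R = (\<Sum>x\<in>set_mset R. y_mset D (replicate_mset (count R x) x))"
proof (rule prod_eqI)
  have "of_lattice (wt_mset D (replicate_mset (count R x) x)) = of_nat (count R x) *s fund_weight D (fst x)"
    if "x \<in># R" for x
    using of_lattice_wt_mset[OF based_mset_replicate[OF assms that]] that
    by (auto simp: set_mset_replicate_mset_subset count_eq_zero_iff)
  then have "of_lattice (wt_mset D R) = of_lattice (\<Sum>x\<in>set_mset R. wt_mset D (replicate_mset (count R x) x))"
    by (simp add: of_lattice_wt_mset[OF assms] of_lattice_sum)
  then show "fst (y_mset D R) = fst (\<Sum>x\<in>set_mset R. y_mset D (replicate_mset (count R x) x))"
    by (simp add: of_lattice_inj fst_sum y_mset_def)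
  show "snd (y_mset D R) = snd (\<Sum>x\<in>set_mset R. y_mset D (replicate_mset (count R x) x))"
  proof (rule poly_mapping_eqI)
    fix y :: "'i \<times> int"
    obtain i l where y: "y = (i, l)"
      by (cases y)
    have "expo (\<Sum>x\<in>set_mset R. y_mset D (replicate_mset (count R x) x)) i l =
        int (count (\<Sum>x\<in>set_mset R. replicate_mset (count R x) x) (i, l))"
      by (simp only: expo_sum expo_y_mset count_sum of_nat_sum)
    then show "Poly_Mapping.lookup (snd (y_mset D R)) y =
        Poly_Mapping.lookup (snd (\<Sum>x\<in>set_mset R. y_mset D (replicate_mset (count R x) x))) y"
      unfolding sum_replicate_count using expo_y_mset[of D R i l] by (simp add: expo_def y)
  qed
qed

text \<open>\<open>f_i\<close> acts where the exponent is positive and \<open>e_i\<close> where it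
  is negative, so both are among the permitted moves.\<close>

lemma subcrystal_move_closed:
  assumes H: "move_closed R H" and R: "based_mset D R"
  shows "subcrystal D (mono R ` H)"
  unfolding subcrystal_def
proof (intro conjI ballI allI impI)
  have "mono R S \<in> monomials D" if "set_mset S \<subseteq> parity_vertices D" for S
    using that
    by (induction S) (simp_all add: y_mset_monomials[OF R] mono_add_mset monomials_diff z_mon_monomials)
  then show "mono R ` H \<subseteq> monomials D"
    using move_closedD(2)[OF H] by blast
  fix p i q
  assume "p \<in> mono R ` H" and q: "crystal_f D i p = Some q \<or> crystal_e D i p = Some q"
  then obtain S where S: "S \<in> H" and p: "p = mono R S"
    by blast
  from q show "q \<in> mono R ` H"
  proof
    assume "crystal_f D i p = Some q"
    then obtain F where F: "f_pos i p F" "q = p - z_mon D (i, F - 2)"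
      using crystal_f_SomeD by blast
    then have "add_mset (i, F - 2) S \<in> H"
      using f_pos_expo[OF F(1)] move_closedD(4)[OF H S, of i "F - 2"] by (simp add: p expo_mono)
    moreover have "q = mono R (add_mset (i, F - 2) S)"
      by (simp add: F(2) p mono_add_mset)
    ultimately show ?thesis
      by blast
  next
    assume "crystal_e D i p = Some q"
    then obtain E where E: "e_pos i p E" "q = p + z_mon D (i, E)"
      using crystal_e_SomeD by blast
    then have neg: "expo_mset R S i E < 0"
      using e_pos_expo[OF E(1)] by (simp add: p expo_mono)
    have "q = mono R (S - {#(i, E)#})"
      by (simp add: E(2) p mono_remove move_closedD(5)[OF H S neg])
    then show ?thesis
      using move_closedD(6)[OF H S neg] by blast
  qed
qed

text \<open>Any move-closed set serves, because \<open>y_R\<close> generates it. At the lowest level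
  of a nonempty \<open>S\<close> neither \<open>R\<close> nor the rest of \<open>S\<close>
  contributes a positive term, so some exponent there is negative and some \<open>e_j\<close> is
  nonzero. It yields a smaller multiset, from which \<open>f_j\<close> leads back.\<close>

lemma fund_crystal_eq:
  assumes H: "move_closed R H" and R: "based_mset D R" "R = replicate_mset n x"
  shows "fund_crystal D x n = mono R ` H"
proof
  show "fund_crystal D x n \<subseteq> mono R ` H"
    unfolding fund_crystal_def R(2)[symmetric]
  proof (rule hull_minimal)
    have "mono R {#} \<in> mono R ` H"
      using move_closedD(1)[OF H] by (rule imageI)
    then show "{y_mset D R} \<subseteq> mono R ` H"
      by simp
  qed (rule subcrystal_move_closed[OF H R(1)])
next
  have mon: "mono R S \<in> monomials D" if "S \<in> H" for S
    using subcrystal_move_closed[OF H R(1)] that by (auto simp: subcrystal_def)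
  have "mono R S \<in> X" if "S \<in> H" "subcrystal D X" "y_mset D R \<in> X" for S X
    using that(1)
  proof (induction "size S" arbitrary: S rule: less_induct)
    case (less S)
    show ?case
    proof (cases "S = {#}")
      case True
      then show ?thesis
        using that(3) by simp
    next
      case False
      let ?l = "Min (snd ` set_mset S)"
      have fin: "finite (snd ` set_mset S)" "snd ` set_mset S \<noteq> {}"
        using False by auto
      obtain j where j: "(j, ?l) \<in># S"
        using Min_in[OF fin] by (metis (no_types, lifting) imageE prod.collapse)
      have zero: "count S (i, m) = 0" if "m < ?l" for i m
      proof -
        have "(i, m) \<notin># S"
        proof
          assume "(i, m) \<in># S"
          then have "m \<in> snd ` set_mset S"
            by (rule image_eqI[rotated]) simp
          with Min_le[OF fin(1)] that show False
            by (metis leD)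
        qed
        then show ?thesis
          by (simp only: not_in_iff)
      qed
      have "?l < snd x"
        using move_closedD(3)[OF H less.prems j] R(2) by (auto split: if_splits)
      then have R0: "count R (i, m) = 0" if "m \<le> ?l" for i m
        using that R(2) by (auto simp: count_replicate_mset)
      have "expo (mono R S) j m = 0" if "m < ?l" for m
        using that by (simp add: expo_mono expo_mset_def zero R0)
      moreover have neg: "expo (mono R S) j ?l < 0"
        using j by (simp add: expo_mono expo_mset_def zero R0)
      ultimately have "{l. l \<le> ?l \<and> expo (mono R S) j l \<noteq> 0} = {?l}"
        by (force simp: order.order_iff_strict)
      then have "prefix j (mono R S) ?l < 0"
        using neg by (simp add: prefix_def)
      then have "eps j (mono R S) \<noteq> 0"
        using pmin_le[of j "mono R S" ?l] by (simp add: eps_pmin)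
      then obtain E where E: "e_pos j (mono R S) E"
        using e_pos_exists[of j "mono R S"] by blast
      then have neg: "expo_mset R S j E < 0"
        using e_pos_expo[OF E] by (simp add: expo_mono)
      let ?S' = "S - {#(j, E)#}"
      have mem: "(j, E) \<in># S"
        by (rule move_closedD(5)[OF H less.prems neg])
      have "crystal_e D j (mono R S) = Some (mono R ?S')"
        by (simp add: crystal_e_eq[OF E] mono_remove[OF mem])
      from crystal_e_f(1)[OF mon[OF less.prems] this]
      have "crystal_f D j (mono R ?S') = Some (mono R S)" .
      moreover have "mono R ?S' \<in> X"
        using less.hyps[OF _ move_closedD(6)[OF H less.prems neg]] mem by (simp add: size_Diff1_less)
      ultimately show ?thesis
        using that(2) unfolding subcrystal_def by blast
    qed
  qed
  then show "mono R ` H \<subseteq> fund_crystal D x n"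
    unfolding fund_crystal_def hull_def R(2)[symmetric] by blast
qed

lemma move_closed_sum:
  assumes "finite A" "\<And>x. x \<in> A \<Longrightarrow> move_closed (R x) (H x)"
  shows "move_closed (\<Sum>x\<in>A. R x) {\<Sum>x\<in>A. s x | s. \<forall>x\<in>A. s x \<in> H x}"
  using assms
proof (induction A)
  case empty
  then show ?case
    using move_closed_empty by simp
next
  case (insert a A)
  have "{\<Sum>x\<in>insert a A. s x | s. \<forall>x\<in>insert a A. s x \<in> H x} =
      {S + S' | S S'. S \<in> H a \<and> S' \<in> {\<Sum>x\<in>A. s x | s. \<forall>x\<in>A. s x \<in> H x}}" (is "?L = ?R")
  proof
    show "?L \<subseteq> ?R"
      using insert.hyps by auto
    show "?R \<subseteq> ?L"
    proof
      fix y
      assume "y \<in> ?R"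
      then obtain S s where S: "S \<in> H a" and s: "\<forall>x\<in>A. s x \<in> H x" and y: "y = S + (\<Sum>x\<in>A. s x)"
        by blast
      have "(\<Sum>x\<in>A. (s(a := S)) x) = (\<Sum>x\<in>A. s x)"
        using insert.hyps by (intro sum.cong) auto
      then have "y = (\<Sum>x\<in>insert a A. (s(a := S)) x)"
        using insert.hyps by (simp add: y)
      moreover have "\<forall>x\<in>insert a A. (s(a := S)) x \<in> H x"
        using S s by simp
      ultimately show "y \<in> ?L"
        by blast
    qed
  qed
  moreover have "move_closed (R a + (\<Sum>x\<in>A. R x)) ?R"
    by (rule move_closed_plus) (use insert in auto)
  ultimately show ?case
    using insert.hyps by simp
qed

lemma product_crystal_eq:
  assumes R: "based_mset D R"
  obtains H where "move_closed R H" and "product_crystal D R = mono R ` H"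
proof -
  let ?r = "\<lambda>x. replicate_mset (count R x) x"
  have "\<exists>H. move_closed (?r x) H" if "x \<in># R" for x
    using R that by (intro move_closed_exists) (auto simp: based_mset_def split: if_splits)
  then obtain H where H: "\<And>x. x \<in># R \<Longrightarrow> move_closed (?r x) (H x)"
    by metis
  define HR where "HR = {\<Sum>x\<in>set_mset R. s x | s. \<forall>x\<in>set_mset R. s x \<in> H x}"
  have "move_closed (\<Sum>x\<in>set_mset R. ?r x) HR"
    unfolding HR_def using H by (intro move_closed_sum) auto
  then have "move_closed R HR"
    by (simp only: sum_replicate_count)
  moreover have fund: "fund_crystal D x (count R x) = mono (?r x) ` H x" if "x \<in># R" for x
    using fund_crystal_eq[OF H[OF that] based_mset_replicate[OF R that] HOL.refl] .
  have sum: "(\<Sum>x\<in>set_mset R. mono (?r x) (s x)) = mono R (\<Sum>x\<in>set_mset R. s x)" for s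
    by (simp add: mono_def sum_subtractf z_mset_sum y_mset_eq_sum[OF R])
  have "product_crystal D R = mono R ` HR"
  proof
    show "product_crystal D R \<subseteq> mono R ` HR"
    proof
      fix p
      assume "p \<in> product_crystal D R"
      then obtain q where q: "\<forall>x\<in>set_mset R. q x \<in> fund_crystal D x (count R x)"
        and p: "p = (\<Sum>x\<in>set_mset R. q x)"
        unfolding product_crystal_def by blast
      have "\<forall>x\<in>set_mset R. \<exists>S. S \<in> H x \<and> q x = mono (?r x) S"
        using q fund by blast
      then obtain s where s: "\<forall>x\<in>set_mset R. s x \<in> H x \<and> q x = mono (?r x) (s x)"
        by metis
      then have "p = mono R (\<Sum>x\<in>set_mset R. s x)"
        unfolding p sum[symmetric] by (intro sum.cong) auto
      moreover have "(\<Sum>x\<in>set_mset R. s x) \<in> HR"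
        using s unfolding HR_def by blast
      ultimately show "p \<in> mono R ` HR"
        by blast
    qed
    show "mono R ` HR \<subseteq> product_crystal D R"
    proof
      fix p
      assume "p \<in> mono R ` HR"
      then obtain s where s: "\<forall>x\<in>set_mset R. s x \<in> H x" and "p = (\<Sum>x\<in>set_mset R. mono (?r x) (s x))"
        unfolding HR_def sum by blast
      moreover have "\<forall>x\<in>set_mset R. mono (?r x) (s x) \<in> fund_crystal D x (count R x)"
        using s fund by blast
      ultimately show "p \<in> product_crystal D R"
        unfolding product_crystal_def by blast
    qed
  qed
  ultimately show ?thesis
    using that by blast
qed

lemma truncation_eq:
  assumes H: "move_closed R H" and "product_crystal D R = mono R ` H" and "set_mset R \<subseteq> J"
  shows "truncation D R J = mono R ` {S \<in> H. set_mset S \<subseteq> J}"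
proof -
  have "mon_supp D R (mono R S) \<subseteq> J \<longleftrightarrow> set_mset S \<subseteq> J" if "S \<in> H" for S
    using mon_supp_mono[OF move_closedD(2)[OF H that]] assms(3) by auto
  then show ?thesis
    unfolding truncation_def assms(2) by blast
qed

end

section \<open>Truncations\<close>

context simply_laced_datum
begin

lemma subcrystal_string_closed: "subcrystal D X \<Longrightarrow> string_closed i X"
  unfolding subcrystal_def string_closed_def by blast

section \<open>Weyl symmetry of the weights and finiteness\<close>

lemma string_closed_lower:
  assumes X: "string_closed i X" and p: "p \<in> X" and "int n \<le> phi i p"
  shows "\<exists>q\<in>X. wt q = wt p - int n *s \<alpha> i \<and> phi i q = phi i p - int n"
  using assms(3)
proof (induction n)
  case 0
  show ?case
    using p by (intro bexI[of _ p]) simp_all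
next
  case (Suc n)
  then obtain q where q: "q \<in> X" "wt q = wt p - int n *s \<alpha> i" "phi i q = phi i p - int n"
    by auto
  then have "phi i q \<noteq> 0"
    using Suc.prems by simp
  then obtain r where r: "crystal_f D i q = Some r"
    by (simp add: crystal_f_def)
  note f = crystal_f_e[OF string_closedD(1)[OF X q(1)] r]
  have "wt r = wt p - int (Suc n) *s \<alpha> i"
    by (simp add: f(2) q(2) vec_eq_iff algebra_simps)
  moreover have "phi i r = phi i p - int (Suc n)"
    by (simp add: f(4) q(3))
  ultimately show ?case
    using string_closedD(2)[OF X q(1) r] by blast
qed

lemma string_closed_raise:
  assumes X: "string_closed i X" and p: "p \<in> X" and "int n \<le> eps i p"
  shows "\<exists>q\<in>X. wt q = wt p + int n *s \<alpha> i \<and> eps i q = eps i p - int n"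
  using assms(3)
proof (induction n)
  case 0
  show ?case
    using p by (intro bexI[of _ p]) simp_all
next
  case (Suc n)
  then obtain q where q: "q \<in> X" "wt q = wt p + int n *s \<alpha> i" "eps i q = eps i p - int n"
    by auto
  then have "eps i q \<noteq> 0"
    using Suc.prems by simp
  then obtain r where r: "crystal_e D i q = Some r"
    by (simp add: crystal_e_def)
  note e = crystal_e_f[OF string_closedD(1)[OF X q(1)] r]
  have "wt r = wt p + int (Suc n) *s \<alpha> i"
    by (simp add: e(2) q(2) vec_eq_iff algebra_simps)
  moreover have "eps i r = eps i p - int (Suc n)"
    by (simp add: e(3) q(3))
  ultimately show ?case
    using string_closedD(3)[OF X q(1) r] by blast
qed

text \<open>The pairing \<open>n\<close> of the weight with the coroot is \<open>phi - eps\<close>,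
  so the string extends at least \<open>n\<close> steps down, or \<open>-n\<close> steps up if
  \<open>n\<close> is negative.\<close>

lemma string_closed_refl:
  assumes X: "string_closed i X" and p: "p \<in> X"
  shows "\<exists>q\<in>X. wt q = refl i (wt p)"
proof -
  let ?n = "pairing (\<alpha>\<^sup>\<or> i) (wt p)"
  have n: "phi i p - eps i p = ?n"
    by (rule phi_minus_eps_pairing[OF string_closedD(1)[OF X p]])
  show ?thesis
  proof (cases "?n \<ge> 0")
    case True
    then have "int (nat ?n) \<le> phi i p"
      using n eps_nonneg[of i p] by simp
    from string_closed_lower[OF X p this] show ?thesis
      using True by (auto simp: simple_reflection_def)
  next
    case False
    then have "int (nat (- ?n)) \<le> eps i p"
      using n phi_nonneg[of i p] by simp
    from string_closed_raise[OF X p this] show ?thesis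
      using False by (auto simp: simple_reflection_def vector_smult_lneg)
  qed
qed

lemma subcrystal_weyl:
  assumes X: "subcrystal D X" and p: "p \<in> X"
  shows "\<exists>q\<in>X. wt q = word_element D is (wt p)"
proof (induction "is")
  case Nil
  show ?case
    using p by auto
next
  case (Cons i "is")
  then obtain q where q: "q \<in> X" "wt q = word_element D is (wt p)"
    by blast
  from string_closed_refl[OF subcrystal_string_closed[OF X] q(1), of i] show ?case
    by (simp add: q(2))
qed

lemma nonneg_comb_sum_roots: "nonneg_comb (\<Sum>x\<in>#S. \<alpha> (fst x))"
proof (induction S)
  case empty
  have "root_comb (\<lambda>_. 0) = 0"
    by (simp add: root_comb_def)
  then show ?case
    unfolding nonneg_comb_def by (intro exI[of _ "\<lambda>_. 0"]) simp
qed (simp add: nonneg_comb_add nonneg_comb_root)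

text \<open>The longest element makes every simple root negative, and the image is nonzero, so each
  element of \<open>S\<close> adds at least 1 to the coefficient sum.\<close>

lemma longest_sum_roots:
  assumes "longest_element D (word_element D is)"
  shows "\<exists>n. (\<forall>j. n j \<ge> 0) \<and> - word_element D is (\<Sum>x\<in>#S. \<alpha> (fst x)) = root_comb n
    \<and> int (size S) \<le> (\<Sum>j\<in>UNIV. n j)"
proof (induction S)
  case empty
  show ?case
    by (intro exI[of _ "\<lambda>_. 0"]) (simp add: root_comb_def)
next
  case (add x S)
  then obtain n where n: "\<forall>j. n j \<ge> 0" "- word_element D is (\<Sum>x\<in>#S. \<alpha> (fst x)) = root_comb n"
    "int (size S) \<le> (\<Sum>j\<in>UNIV. n j)"
    by blast
  obtain m where m: "\<forall>j. m j \<ge> 0" "- word_element D is (\<alpha> (fst x)) = root_comb m"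
    using longest_neg[OF assms] by (auto simp: nonneg_comb_def)
  have "\<exists>j. m j \<noteq> 0"
  proof (rule ccontr)
    assume "\<not> ?thesis"
    then have "word_element D is (\<alpha> (fst x)) = 0"
      using m(2) by (simp add: root_comb_def)
    then show False
      using inv_form_word[of "is" "\<alpha> (fst x)" "\<alpha> (fst x)"] inv_form_pos[OF root_nonzero[of "fst x"]]
      by simp
  qed
  then obtain j where "m j \<noteq> 0"
    by blast
  then have "(\<Sum>j\<in>UNIV. m j) > 0"
    using m(1) by (intro sum_pos2[of UNIV j]) (auto simp: order.strict_iff_order)
  moreover have "- word_element D is (\<Sum>x\<in>#add_mset x S. \<alpha> (fst x)) = root_comb (\<lambda>j. m j + n j)"
    unfolding root_comb_add m(2)[symmetric] n(2)[symmetric] by (simp add: word_element_add)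
  ultimately show ?case
    using m(1) n(1,3) by (intro exI[of _ "\<lambda>j. m j + n j"]) (simp add: sum.distrib)
qed

text \<open>
  The weights of a subcrystal are stable under the Weyl group, and those of \<open>y\<^sub>R z\<^sub>S\<^sup>-\<^sup>1\<close> are bounded
  above.  Applying the longest element bounds them below, hence the size of \<open>S\<close>.
\<close>

lemma move_closed_size_bounded:
  assumes H: "move_closed R H" and R: "based_mset D R" and w: "longest_element D w"
  obtains N where "\<And>S. S \<in> H \<Longrightarrow> size S \<le> N"
proof -
  obtain "is" where "is": "w = word_element D is"
    using w by (auto simp: longest_element_def weyl_group_def)
  let ?l = "wt_mset D R" and ?b = "\<lambda>S. \<Sum>x\<in>#S. \<alpha> (fst x)"
  have bound: "\<exists>m. int (size S) \<le> (\<Sum>j\<in>UNIV. m j) \<and> ?l - word_element D is ?l = root_comb m" if S: "S \<in> H" for S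
  proof -
    have "\<exists>q\<in>mono R ` H. wt q = word_element D is (wt (mono R S))"
      using subcrystal_weyl[OF subcrystal_move_closed[OF H R]] S by blast
    then obtain S' where "wt (mono R S') = word_element D is (wt (mono R S))"
      by blast
    then have "?l - ?b S' = word_element D is ?l + - word_element D is (?b S)"
      unfolding wt_mono diff_conv_add_uminus word_element_add word_element_minus .
    then have eq: "?l - word_element D is ?l = ?b S' + - word_element D is (?b S)"
      by (simp add: algebra_simps)
    obtain m where m: "\<forall>j. m j \<ge> 0" "?b S' = root_comb m"
      using nonneg_comb_sum_roots[of S'] by (auto simp: nonneg_comb_def)
    obtain n where n: "- word_element D is (?b S) = root_comb n" "int (size S) \<le> (\<Sum>j\<in>UNIV. n j)"
      using longest_sum_roots[OF w[unfolded "is"], of S] by blast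
    have "(\<Sum>j\<in>UNIV. m j) \<ge> 0"
      using m(1) by (simp add: sum_nonneg)
    with n(2) have "int (size S) \<le> (\<Sum>j\<in>UNIV. m j + n j)"
      by (simp add: sum.distrib)
    then show ?thesis
      using eq m(2) n(1) by (intro exI[of _ "\<lambda>j. m j + n j"]) (simp add: root_comb_add)
  qed
  \<comment> \<open>The difference of the highest weight and its image does not depend on
    \<open>S\<close>, and its coefficients are unique, so one coefficient sum bounds all
    sizes.\<close>
  obtain M where M: "?l - word_element D is ?l = root_comb M"
    using bound[OF move_closedD(1)[OF H]] by blast
  have "size S \<le> nat (\<Sum>j\<in>UNIV. M j)" if S: "S \<in> H" for S
  proof -
    obtain m where "int (size S) \<le> (\<Sum>j\<in>UNIV. m j)" "root_comb M = root_comb m"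
      using bound[OF S] M by metis
    then show ?thesis
      using root_comb_inj[of M m] by simp
  qed
  then show ?thesis
    by (rule that)
qed

text \<open>Going up from an element of \<open>S\<close>, the levels occupied by \<open>S\<close> leave no gap until \<open>R\<close> is reached.\<close>

lemma move_closed_level_bound:
  assumes H: "move_closed R H" and S: "S \<in> H" and lo: "\<And>x. x \<in># R \<Longrightarrow> lo \<le> snd x"
  shows "(j, l) \<in># S \<Longrightarrow> lo \<le> l + 2 * int (size {#y \<in># S. l \<le> snd y#})"
proof (induction "size {#y \<in># S. l \<le> snd y#}" arbitrary: j l rule: less_induct)
  case (less l j)
  have mem: "(j, l) \<in># {#y \<in># S. l \<le> snd y#}"
    using less.prems by simp
  then have pos: "size {#y \<in># S. l \<le> snd y#} \<ge> 1"
    by (cases "{#y \<in># S. l \<le> snd y#}") auto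
  show ?case
  proof (cases "(j, l + 2) \<in># R")
    case True
    then show ?thesis
      using lo[of "(j, l + 2)"] pos by simp
  next
    case False
    \<comment> \<open>If \<open>S\<close> were empty on the next two levels, the exponent at
      \<open>(j, l + 2)\<close> would be negative, and move-closedness would put
      \<open>(j, l + 2)\<close> into \<open>S\<close> after all.\<close>
    have "\<exists>j' l'. (j', l') \<in># S \<and> l < l' \<and> l' \<le> l + 2"
    proof (rule ccontr)
      assume none: "\<not> ?thesis"
      have "count S (j', l') = 0" if "l < l'" "l' \<le> l + 2" for j' l'
        using none that unfolding count_eq_zero_iff by blast
      then have "count S (j, l + 2) = 0" and "(\<Sum>j' | adjacent D j j'. int (count S (j', l + 1))) = 0"
        by simp_all
      then have "expo_mset R S j (l + 2) = - int (count S (j, l))"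
        using False by (simp add: expo_mset_def not_in_iff add.commute[of 1 l])
      then have "expo_mset R S j (l + 2) < 0"
        using less.prems by simp
      from move_closedD(5)[OF H S this] none show False
        by (metis less_add_same_cancel1 order_refl zero_less_numeral)
    qed
    then obtain j' l' where l': "(j', l') \<in># S" "l < l'" "l' \<le> l + 2"
      by blast
    \<comment> \<open>The level rises by at most 2 while at least the element \<open>(j, l)\<close>
      drops out of the count; hence the factor 2 in the bound.\<close>
    have split: "{#y \<in># S. l \<le> snd y#} = {#y \<in># S. l' \<le> snd y#} + {#y \<in># S. l \<le> snd y \<and> snd y < l'#}"
      using l'(2) by (auto simp: multiset_eq_iff)
    have "(j, l) \<in># {#y \<in># S. l \<le> snd y \<and> snd y < l'#}"
      using less.prems l'(2) by simp
    then have "size {#y \<in># S. l \<le> snd y \<and> snd y < l'#} \<ge> 1"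
      by (cases "{#y \<in># S. l \<le> snd y \<and> snd y < l'#}") auto
    then have "size {#y \<in># S. l' \<le> snd y#} < size {#y \<in># S. l \<le> snd y#}"
      unfolding split by simp
    then show ?thesis
      using less.hyps[of l' j'] l' by fastforce
  qed
qed

lemma move_closed_finite:
  assumes H: "move_closed R H" and R: "based_mset D R" and w: "longest_element D w"
  shows "finite H"
proof -
  obtain N where N: "\<And>S. S \<in> H \<Longrightarrow> size S \<le> N"
    using move_closed_size_bounded[OF assms] by blast
  have fin: "finite (snd ` set_mset R)"
    by simp
  obtain lo where lo: "\<And>x. x \<in># R \<Longrightarrow> lo \<le> snd x"
    using bdd_below_finite[OF fin] by (auto simp: bdd_below_def)
  obtain hi where hi: "\<And>x. x \<in># R \<Longrightarrow> snd x \<le> hi"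
    using bdd_above_finite[OF fin] by (auto simp: bdd_above_def)
  have "set_mset S \<subseteq> UNIV \<times> {lo - 2 * int N..hi}" if S: "S \<in> H" for S
  proof
    fix y
    assume y: "y \<in># S"
    then have "lo \<le> snd y + 2 * int (size {#x \<in># S. snd y \<le> snd x#})"
      using move_closed_level_bound[OF H S lo, of "fst y" "snd y"] by simp
    moreover have "size {#x \<in># S. snd y \<le> snd x#} \<le> N"
      using N[OF S] size_filter_mset_lesseq[of _ S] order_trans by blast
    ultimately have "lo - 2 * int N \<le> snd y"
      by linarith
    moreover obtain x where "x \<in># R" "snd y < snd x"
      using move_closedD(3)[OF H S y] by blast
    then have "snd y \<le> hi"
      using hi[of x] by simp
    ultimately show "y \<in> UNIV \<times> {lo - 2 * int N..hi}"
      by (cases y) simp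
  qed
  with N have "H \<subseteq> {S. set_mset S \<subseteq> UNIV \<times> {lo - 2 * int N..hi} \<and> size S \<le> N}"
    by blast
  then show ?thesis
    by (rule finite_subset) (simp add: finite_multisets_bounded)
qed

section \<open>Enlarging an upward-closed set\<close>

lemma parity_up:
  assumes "(i, c) \<in> parity_vertices D"
  shows "(i, c + 2) \<in> parity_vertices D" and "adjacent D i j \<Longrightarrow> (j, c + 1) \<in> parity_vertices D"
  using assms two_colouring[of i j] by (auto simp: parity_vertices_def)

lemma upward_closedI:
  assumes sub: "J \<subseteq> parity_vertices D"
    and two: "\<And>i c. (i, c) \<in> J \<Longrightarrow> (i, c + 2) \<in> J"
    and one: "\<And>i j c. \<lbrakk>(i, c) \<in> J; adjacent D i j\<rbrakk> \<Longrightarrow> (j, c + 1) \<in> J"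
  shows "upward_closed D J"
proof -
  have "y \<in> J" if "vertex_le D x y" "x \<in> J" for x y
    using that(1) unfolding vertex_le_def
  proof (induction rule: rtranclp_induct)
    case base
    show ?case
      by (rule that(2))
  next
    case (step y z)
    then show ?case
      using one two by blast
  qed
  with sub show ?thesis
    unfolding upward_closed_def by blast
qed

lemma upward_closedD:
  assumes "upward_closed D J" "(i, c) \<in> J"
  shows "(i, c) \<in> parity_vertices D" and "(i, c + 2) \<in> J" and "adjacent D i j \<Longrightarrow> (j, c + 1) \<in> J"
proof -
  show par: "(i, c) \<in> parity_vertices D"
    using assms unfolding upward_closed_def by blast
  have "vertex_le D (i, c) (i, c + 2)"
    unfolding vertex_le_def by (rule r_into_rtranclp) (use par in blast)
  then show "(i, c + 2) \<in> J"
    using assms unfolding upward_closed_def by blast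
  assume adj: "adjacent D i j"
  have "vertex_le D (i, c) (j, c + 1)"
    unfolding vertex_le_def by (rule r_into_rtranclp) (use par adj in blast)
  then show "(j, c + 1) \<in> J"
    using assms unfolding upward_closed_def by blast
qed

lemma upward_closed_above:
  assumes J: "upward_closed D J" and mem: "(i, l) \<in> J" and "(i, k) \<in> parity_vertices D" "l \<le> k"
  shows "(i, k) \<in> J"
proof -
  have "(i, l + 2 * int n) \<in> J" for n
  proof (induction n)
    case (Suc n)
    have "l + 2 * int (Suc n) = l + 2 * int n + 2"
      by simp
    then show ?case
      using upward_closedD(2)[OF J Suc] by (simp only:)
  qed (simp add: mem)
  moreover have "even (k - l)"
    using upward_closedD(1)[OF J mem] assms(3) by (auto simp: parity_vertices_def)
  then have "k = l + 2 * int (nat ((k - l) div 2))"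
    using assms(4) by simp
  ultimately show ?thesis
    by metis
qed

text \<open>Minimality of \<open>(i, k)\<close> empties everything that could contribute to
  exponents of \<open>y_{i,l}\<close> with \<open>l < k\<close>, and leaves minus the multiplicity
  of \<open>(i, k)\<close> in \<open>S\<close> as exponent at \<open>k\<close>. So the smaller
  truncation is where the prefix sum vanishes at \<open>k\<close>, as in
  \<open>char_lowest_position\<close>.\<close>

lemma truncation_step:
  assumes H: "move_closed R H" and R: "based_mset D R" and fin: "finite H"
    and J: "upward_closed D J" and J': "upward_closed D (insert (i, k) J)"
    and new: "(i, k) \<notin> J" and RJ: "set_mset R \<subseteq> J"
  shows "crystal_char (mono R ` {S \<in> H. set_mset S \<subseteq> insert (i, k) J}) =
    demazure D i (crystal_char (mono R ` {S \<in> H. set_mset S \<subseteq> J}))"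
proof -
  let ?J = "insert (i, k) J"
  define X where "X = mono R ` {S \<in> H. set_mset S \<subseteq> ?J}"
  have par: "(i, k) \<in> parity_vertices D"
    by (rule upward_closedD(1)[OF J']) simp
  have below: "(i, l) \<notin> J" if "l \<le> k" for l
    using upward_closed_above[OF J _ par that] new by blast
  \<comment> \<open>Such a neighbour would force \<open>(i, l + 1)\<close> into \<open>J\<close>,
    and \<open>l + 1\<close> is at most \<open>k\<close>.\<close>
  have below_adj: "(j, l) \<notin> ?J" if "adjacent D i j" "l < k" for j l
    using upward_closedD(3)[OF J, of j l i] below[of "l + 1"] that adjacent_sym[of i j] by auto
  have mon: "mono R S \<in> monomials D" if "S \<in> H" for S
    using subcrystal_move_closed[OF H R] that by (auto simp: subcrystal_def)
  have low: "expo (mono R S) i l = 0" if S: "set_mset S \<subseteq> ?J" and "l < k" for S l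
  proof -
    have "count R (i, l) = 0" "count S (i, l) = 0" "count S (i, l - 2) = 0"
      using S RJ below[of l] below[of "l - 2"] \<open>l < k\<close> by (auto simp: count_eq_zero_iff)
    moreover have "count S (j, l - 1) = 0" if "adjacent D i j" for j
      using S below_adj[OF that, of "l - 1"] \<open>l < k\<close> by (auto simp: count_eq_zero_iff)
    ultimately show ?thesis
      by (simp add: expo_mono expo_mset_def)
  qed
  have at_k: "expo (mono R S) i k = - int (count S (i, k))" if S: "set_mset S \<subseteq> ?J" for S
  proof -
    have "count R (i, k) = 0" "count S (i, k - 2) = 0"
      using S RJ below[of k] below[of "k - 2"] by (auto simp: count_eq_zero_iff)
    moreover have "count S (j, k - 1) = 0" if "adjacent D i j" for j
      using S below_adj[OF that, of "k - 1"] by (auto simp: count_eq_zero_iff)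
    ultimately show ?thesis
      by (simp add: expo_mono expo_mset_def)
  qed
  have prefix_low: "prefix i (mono R S) m = 0" if "set_mset S \<subseteq> ?J" "m < k" for S m
    using low[OF that(1)] that(2) unfolding prefix_def by (intro sum.neutral) auto
  have prefix_k: "prefix i (mono R S) k = - int (count S (i, k))" if "set_mset S \<subseteq> ?J" for S
    using prefix_step[of i "mono R S" k] prefix_low[OF that, of "k - 1"] at_k[OF that] by simp
  have gap: "prefix i (mono R S) (k + 1) = prefix i (mono R S) k" if "S \<in> H" for S
  proof -
    have "(i, k + 1) \<notin> parity_vertices D"
      using par by (auto simp: parity_vertices_def)
    then have "expo (mono R S) i (k + 1) = 0"
      using mon[OF that] unfolding monomials_iff by blast
    then show ?thesis
      using prefix_step[of i "mono R S" "k + 1"] by simp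
  qed
  have "string_closed i X"
    unfolding string_closed_def
  proof (intro conjI ballI allI impI)
    show "X \<subseteq> monomials D"
      using mon by (auto simp: X_def)
    fix p q
    assume "p \<in> X" and q: "crystal_f D i p = Some q \<or> crystal_e D i p = Some q"
    then obtain S where S: "S \<in> H" "set_mset S \<subseteq> ?J" and p: "p = mono R S"
      by (auto simp: X_def)
    from q show "q \<in> X"
    proof
      assume "crystal_f D i p = Some q"
      then obtain F where F: "f_pos i p F" "q = p - z_mon D (i, F - 2)"
        using crystal_f_SomeD by blast
      \<comment> \<open>The vertex added by \<open>f_i\<close> is at or above \<open>(i, k)\<close>,
        so it stays in the upward-closed set; \<open>e_i\<close> only removes vertices.\<close>
      have ge: "k + 2 \<le> F"
        using F(1) prefix_low[OF S(2)] prefix_k[OF S(2)] gap[OF S(1)] unfolding p by (intro f_pos_ge) auto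
      have "expo p i F > 0"
        by (rule f_pos_expo[OF F(1)])
      moreover from this have "(i, F) \<in> parity_vertices D"
        using mon[OF S(1)] unfolding p monomials_iff by (metis less_irrefl)
      then have "(i, F - 2) \<in> parity_vertices D"
        by (simp add: parity_vertices_def)
      from upward_closed_above[OF J' insertI1 this] have "(i, F - 2) \<in> ?J"
        using ge by simp
      moreover have "add_mset (i, F - 2) S \<in> H"
        using move_closedD(4)[OF H S(1), of i "F - 2"] \<open>expo p i F > 0\<close> by (simp add: p expo_mono)
      moreover have "q = mono R (add_mset (i, F - 2) S)"
        by (simp add: F(2) p mono_add_mset)
      ultimately show ?thesis
        unfolding X_def using S(2) by (intro image_eqI) auto
    next
      assume "crystal_e D i p = Some q"
      then obtain E where E: "e_pos i p E" "q = p + z_mon D (i, E)"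
        using crystal_e_SomeD by blast
      have neg: "expo_mset R S i E < 0"
        using e_pos_expo[OF E(1)] by (simp add: p expo_mono)
      have "q = mono R (S - {#(i, E)#})"
        by (simp add: E(2) p mono_remove move_closedD(5)[OF H S(1) neg])
      then show ?thesis
        unfolding X_def using move_closedD(6)[OF H S(1) neg] S(2)
        by (intro image_eqI) (auto dest: in_diffD)
    qed
  qed
  moreover have "finite X"
    using fin by (simp add: X_def)
  ultimately have "crystal_char X = demazure D i (crystal_char {p \<in> X. prefix i p k = 0})"
  proof (rule char_lowest_position)
    show "prefix i p m = 0" if "p \<in> X" "m < k" for p m
      using that prefix_low by (auto simp: X_def)
    show "prefix i p k \<le> 0" if "p \<in> X" for p
      using that prefix_k by (auto simp: X_def)
    show "prefix i p (k + 1) = prefix i p k" if "p \<in> X" for p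
      using that gap by (auto simp: X_def)
  qed
  also have "{p \<in> X. prefix i p k = 0} = mono R ` {S \<in> H. set_mset S \<subseteq> J}"
  proof -
    have "prefix i (mono R S) k = 0 \<longleftrightarrow> set_mset S \<subseteq> J" if "set_mset S \<subseteq> ?J" for S
      using that new by (auto simp: prefix_k count_eq_zero_iff)
    then show ?thesis
      unfolding X_def by blast
  qed
  finally show ?thesis
    by (simp only: X_def)
qed

end

theorem corollary5p14:
  fixes D :: "('i::finite, 'n::finite) root_datum"
    and R :: "('i \<times> int) multiset"
    and w\<^sub>0 :: "int ^ 'n \<Rightarrow> int ^ 'n"
    and J :: "('i \<times> int) set"
  assumes "simply_laced_datum D"
    and "based_mset D R"
    and "longest_element D w\<^sub>0"
    and "upward_closed D J"
    and "set_mset R \<subseteq> J"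
  shows "crystal_char (product_crystal D R) =
    demazure_weyl D w\<^sub>0 (crystal_char (truncation D R J))"
proof -
  interpret simply_laced_datum D
    by (rule assms(1))
  obtain H where H: "move_closed R H" and prod: "product_crystal D R = mono R ` H"
    using product_crystal_eq[OF assms(2)] .
  have fin: "finite H"
    by (rule move_closed_finite[OF H assms(2,3)])
  define T where "T = (\<lambda>J. crystal_char (mono R ` {S \<in> H. set_mset S \<subseteq> J}))"
  \<comment> \<open>Vertices of one level can be added in any order, since their proper successors
    lie on higher levels, which are already present.\<close>
  have add_level: "upward_closed D (J \<union> A) \<and> demazure_weyl D w\<^sub>0 (T (J \<union> A)) = demazure_weyl D w\<^sub>0 (T J)"
    if "finite A" "A \<subseteq> {x \<in> parity_vertices D. snd x = m}" "upward_closed D J"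
      "{x \<in> parity_vertices D. snd x > m} \<subseteq> J" "set_mset R \<subseteq> J" for A m J
    using that(1,2)
  proof (induction A)
    case empty
    show ?case
      using that(3) by simp
  next
    case (insert x A)
    then have IH: "upward_closed D (J \<union> A)" "demazure_weyl D w\<^sub>0 (T (J \<union> A)) = demazure_weyl D w\<^sub>0 (T J)"
      by auto
    obtain i where x: "x = (i, m)" "(i, m) \<in> parity_vertices D"
      using insert.prems by (cases x) auto
    have up: "upward_closed D (insert (i, m) (J \<union> A))"
    proof (rule upward_closedI)
      show "insert (i, m) (J \<union> A) \<subseteq> parity_vertices D"
        using x(2) upward_closedD(1)[OF IH(1)] by auto
      show "(j, c + 2) \<in> insert (i, m) (J \<union> A)" if "(j, c) \<in> insert (i, m) (J \<union> A)" for j c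
        using that upward_closedD(2)[OF IH(1), of j c] parity_up(1)[OF x(2)]
          \<open>{x \<in> parity_vertices D. snd x > m} \<subseteq> J\<close> by auto
      show "(j', c + 1) \<in> insert (i, m) (J \<union> A)"
        if "(j, c) \<in> insert (i, m) (J \<union> A)" "adjacent D j j'" for j j' c
        using that upward_closedD(3)[OF IH(1), of j c j'] parity_up(2)[OF x(2), of j']
          \<open>{x \<in> parity_vertices D. snd x > m} \<subseteq> J\<close> by auto
    qed
    have "demazure_weyl D w\<^sub>0 (T (insert (i, m) (J \<union> A))) = demazure_weyl D w\<^sub>0 (T (J \<union> A))"
    proof (cases "(i, m) \<in> J \<union> A")
      case False
      have "T (insert (i, m) (J \<union> A)) = demazure D i (T (J \<union> A))"
        unfolding T_def using truncation_step[OF H assms(2) fin IH(1) up False] that(5) by blast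
      then show ?thesis
        by (simp add: demazure_weyl_absorb[OF assms(3)])
    qed (simp add: insert_absorb)
    with up IH(2) show ?case
      by (simp add: x(1))
  qed
  \<comment> \<open>\<open>L m\<close> fills up \<open>J\<close> with all levels from
    \<open>m\<close> on. For \<open>m\<close> above all of \<open>H\<close> this does not change the
    truncation, and for \<open>m\<close> below all of \<open>H\<close> the truncation is
    everything.\<close>
  define L where "L = (\<lambda>m. J \<union> {x \<in> parity_vertices D. snd x \<ge> m})"
  have level_closed: "upward_closed D (L m)" for m
  proof (rule upward_closedI)
    show "L m \<subseteq> parity_vertices D"
      using upward_closedD(1)[OF assms(4)] by (auto simp: L_def)
    show "(i, c + 2) \<in> L m" if "(i, c) \<in> L m" for i c
      using that upward_closedD(2)[OF assms(4)] parity_up(1) by (auto simp: L_def)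
    show "(j, c + 1) \<in> L m" if "(i, c) \<in> L m" "adjacent D i j" for i j c
      using that upward_closedD(3)[OF assms(4)] parity_up(2) by (auto simp: L_def)
  qed
  have step: "demazure_weyl D w\<^sub>0 (T (L m)) = demazure_weyl D w\<^sub>0 (T (L (m + 1)))" for m
  proof -
    let ?A = "{x \<in> parity_vertices D. snd x = m}"
    have "finite ?A"
      by (rule finite_subset[of _ "UNIV \<times> {m}"]) auto
    moreover have "{x \<in> parity_vertices D. snd x > m} \<subseteq> L (m + 1)" "set_mset R \<subseteq> L (m + 1)"
      using assms(5) by (auto simp: L_def)
    ultimately have "demazure_weyl D w\<^sub>0 (T (L (m + 1) \<union> ?A)) = demazure_weyl D w\<^sub>0 (T (L (m + 1)))"
      using add_level[of ?A m "L (m + 1)", OF _ order_refl level_closed] by blast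
    moreover have "L m = L (m + 1) \<union> ?A"
      by (auto simp: L_def)
    ultimately show ?thesis
      by (simp only:)
  qed
  have descend: "demazure_weyl D w\<^sub>0 (T (L (m - int n))) = demazure_weyl D w\<^sub>0 (T (L m))" for m n
  proof (induction n)
    case (Suc n)
    then show ?case
      using step[of "m - int (Suc n)"] by simp
  qed simp
  let ?K = "\<Union>S\<in>H. snd ` set_mset S"
  have finK: "finite ?K"
    using fin by simp
  obtain lo where lo: "\<And>c. c \<in> ?K \<Longrightarrow> lo \<le> c"
    using bdd_below_finite[OF finK] by (auto simp: bdd_below_def)
  obtain hi where hi: "\<And>c. c \<in> ?K \<Longrightarrow> c \<le> hi"
    using bdd_above_finite[OF finK] by (auto simp: bdd_above_def)
  have "{S \<in> H. set_mset S \<subseteq> L (hi + 1)} = {S \<in> H. set_mset S \<subseteq> J}"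
    using hi by (fastforce simp: L_def)
  then have top: "T (L (hi + 1)) = crystal_char (truncation D R J)"
    unfolding T_def truncation_eq[OF H prod assms(5)] by simp
  \<comment> \<open>If \<open>hi + 1 < lo\<close>, which can happen when only the empty multiset
    occurs, \<open>nat\<close> gives 0; in either case \<open>hi + 1 - int ?n\<close> is at most
    \<open>lo\<close>.\<close>
  let ?n = "nat (hi + 1 - lo)"
  have "set_mset S \<subseteq> L (hi + 1 - int ?n)" if "S \<in> H" for S
    using move_closedD(2)[OF H that] lo that by (fastforce simp: L_def)
  then have "{S \<in> H. set_mset S \<subseteq> L (hi + 1 - int ?n)} = H"
    by blast
  then have "T (L (hi + 1 - int ?n)) = crystal_char (product_crystal D R)"
    by (simp add: T_def prod)
  with descend[of "hi + 1" ?n] top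
  have "demazure_weyl D w\<^sub>0 (crystal_char (product_crystal D R)) =
      demazure_weyl D w\<^sub>0 (crystal_char (truncation D R J))"
    by simp
  moreover have "demazure D i (crystal_char (product_crystal D R)) = crystal_char (product_crystal D R)" for i
    unfolding prod using fin
    by (intro char_string_closed_fixed subcrystal_string_closed subcrystal_move_closed[OF H assms(2)]) simp
  then have "demazure_weyl D w\<^sub>0 (crystal_char (product_crystal D R)) = crystal_char (product_crystal D R)"
    by (rule demazure_weyl_fixed)
  ultimately show ?thesis
    by simp
qed

end
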